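(* Let $P\subset\mathbb{R}^2$ be a set of $n$ points in the plane, each $p\in P$ having an associated radius $r_p>0$, with radius ratio $\Psi$, and let $G$ be the transmission graph of $P$. Given a reachability oracle for $G$ that requires $S(n)$ space and has query time $Q(n)$, we can obtain in $O(n\log n\log\Psi)$ time a geometric reachability oracle for $G$ that requires $S(n)+O(n\log\Psi)$ space and can answer a query in $O(Q(n)+\log n\log\Psi)$ time.
   Context: Transmission graph: the directed graph $G$ with vertex set $P$ (points, called sites, with radii $r_p>0$) having an edge from $p$ to $q$ (for distinct $p,q$) iff $q$ lies in the closed disk $D(p)$ of radius $r_p$ centered at $p$. Radius ratio: $\Psi=\max_{p,q\in P}(r_p/r_q)$. A vertex $s$ can reach a vertex $q$ in $G$ if there is a directed path from $s$ to $q$ in $G$ (in particular $s$ can reach $s$). A reachability oracle for $G$ is a data structure that, given any two vertices $s,q$ of $G$, decides whether $s$ can reach $q$. A site $s\in P$ can reach a point $x\in\mathbb{R}^2$ if there is a site $q\in P$ such that $x\in D(q)$ and $s$ can reach $q$ in $G$. A geometric reachability oracle is a data structure that, given any site $s\in P$ and any point $x\in\mathbb{R}^2$, decides whether $s$ can reach $x$. Model of computation: it is assumed that, for a given point and a given $i\ge 0$, the cell containing the point in the axis-parallel grid of squares of diameter $2^i$ (with the origin at a corner of a cell) can be found in constant time. *)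

theory Defs
  imports "HOL-Analysis.Analysis" "Graph_Theory.Digraph"
begin

section \<open>Transmission graphs\<close>

text \<open>The metric of the product type is the Euclidean one.\<close>

type_synonym point = "real \<times> real"

definition transmission_graph ::
    "point set \<Rightarrow> (point \<Rightarrow> real) \<Rightarrow> (point, point \<times> point) pre_digraph" where
  "transmission_graph P r =
     \<lparr>verts = P, arcs = {(p, q). p \<in> P \<and> q \<in> P \<and> p \<noteq> q \<and> q \<in> cball p (r p)},
      tail = fst, head = snd\<rparr>"

definition radius_ratio :: "point set \<Rightarrow> (point \<Rightarrow> real) \<Rightarrow> real" where
  "radius_ratio P r = Max {r p / r q | p q. p \<in> P \<and> q \<in> P}"

definition reaches_point :: "point set \<Rightarrow> (point \<Rightarrow> real) \<Rightarrow> point \<Rightarrow> point \<Rightarrow> bool" where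
  "reaches_point P r s x \<longleftrightarrow>
     (\<exists>q\<in>P. x \<in> cball q (r q) \<and> s \<rightarrow>\<^sup>*\<^bsub>transmission_graph P r\<^esub> q)"

text \<open>The logarithm inside asymptotic bounds: it is the binary logarithm from 2 on, and never drops
  below 1, so that the bounds do not degenerate to 0 for one site or for equal radii.\<close>

definition lg :: "real \<Rightarrow> real" where
  "lg x = max 1 (log 2 x)"


section \<open>Real RAM with a grid operation\<close>

text \<open>A store has integer and real registers, and integer and real arrays.  A program is a fixed
  finite text, hence it uses only constantly many registers and arrays, and the constants in it are
  integers.  Integers have addition, subtraction and halving; reals have the four field operations
  and square roots.  Apart from the grid operation, reals cannot be converted to integers.\<close>

record store =
  ireg :: "nat \<Rightarrow> int"
  rreg :: "nat \<Rightarrow> real"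
  iarr :: "nat \<Rightarrow> int list"
  rarr :: "nat \<Rightarrow> real list"

datatype iexp =
    IConst int | IReg nat | IGet nat iexp | IAdd iexp iexp | ISub iexp iexp | IHalf iexp

datatype rexp =
    RConst int | RReg nat | RGet nat iexp | RAdd rexp rexp | RSub rexp rexp | RMul rexp rexp
  | RDiv rexp rexp | RSqrt rexp

datatype bexp = ILess iexp iexp | RLess rexp rexp | BNot bexp | BAnd bexp bexp

text \<open>Reading outside of the bounds of an array yields 0; writing there has no effect.\<close>

definition get :: "'a::zero list \<Rightarrow> int \<Rightarrow> 'a" where
  "get xs i = (if 0 \<le> i \<and> i < int (length xs) then xs ! nat i else 0)"

definition put :: "'a list \<Rightarrow> int \<Rightarrow> 'a \<Rightarrow> 'a list" where
  "put xs i x = (if 0 \<le> i \<and> i < int (length xs) then xs[nat i := x] else xs)"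

primrec ival :: "iexp \<Rightarrow> store \<Rightarrow> int" where
  "ival (IConst k) \<sigma> = k"
| "ival (IReg x) \<sigma> = ireg \<sigma> x"
| "ival (IGet a e) \<sigma> = get (iarr \<sigma> a) (ival e \<sigma>)"
| "ival (IAdd e f) \<sigma> = ival e \<sigma> + ival f \<sigma>"
| "ival (ISub e f) \<sigma> = ival e \<sigma> - ival f \<sigma>"
| "ival (IHalf e) \<sigma> = ival e \<sigma> div 2"

primrec rval :: "rexp \<Rightarrow> store \<Rightarrow> real" where
  "rval (RConst k) \<sigma> = of_int k"
| "rval (RReg x) \<sigma> = rreg \<sigma> x"
| "rval (RGet a e) \<sigma> = get (rarr \<sigma> a) (ival e \<sigma>)"
| "rval (RAdd e f) \<sigma> = rval e \<sigma> + rval f \<sigma>"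
| "rval (RSub e f) \<sigma> = rval e \<sigma> - rval f \<sigma>"
| "rval (RMul e f) \<sigma> = rval e \<sigma> * rval f \<sigma>"
| "rval (RDiv e f) \<sigma> = rval e \<sigma> / rval f \<sigma>"
| "rval (RSqrt e) \<sigma> = sqrt (rval e \<sigma>)"

primrec bval :: "bexp \<Rightarrow> store \<Rightarrow> bool" where
  "bval (ILess e f) \<sigma> \<longleftrightarrow> ival e \<sigma> < ival f \<sigma>"
| "bval (RLess e f) \<sigma> \<longleftrightarrow> rval e \<sigma> < rval f \<sigma>"
| "bval (BNot b) \<sigma> \<longleftrightarrow> \<not> bval b \<sigma>"
| "bval (BAnd b c) \<sigma> \<longleftrightarrow> bval b \<sigma> \<and> bval c \<sigma>"

text \<open>Every operator, constant, register access and array access costs one unit.\<close>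

primrec icost :: "iexp \<Rightarrow> nat" where
  "icost (IConst k) = 1"
| "icost (IReg x) = 1"
| "icost (IGet a e) = icost e + 1"
| "icost (IAdd e f) = icost e + icost f + 1"
| "icost (ISub e f) = icost e + icost f + 1"
| "icost (IHalf e) = icost e + 1"

primrec rcost :: "rexp \<Rightarrow> nat" where
  "rcost (RConst k) = 1"
| "rcost (RReg x) = 1"
| "rcost (RGet a e) = icost e + 1"
| "rcost (RAdd e f) = rcost e + rcost f + 1"
| "rcost (RSub e f) = rcost e + rcost f + 1"
| "rcost (RMul e f) = rcost e + rcost f + 1"
| "rcost (RDiv e f) = rcost e + rcost f + 1"
| "rcost (RSqrt e) = rcost e + 1"

primrec bcost :: "bexp \<Rightarrow> nat" where
  "bcost (ILess e f) = icost e + icost f + 1"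
| "bcost (RLess e f) = rcost e + rcost f + 1"
| "bcost (BNot b) = bcost b + 1"
| "bcost (BAnd b c) = bcost b + bcost c + 1"

datatype instr =
    Skip
  | ISet nat iexp | RSet nat rexp
  | IPut nat iexp iexp | RPut nat iexp rexp
  | IPush nat iexp | RPush nat rexp
  | IClear nat | RClear nat
  | Grid nat nat rexp rexp iexp

text \<open>\<open>IPush\<close> and \<open>RPush\<close> append one cell to an array; no other instruction allocates memory.
  \<open>Grid j k x y i\<close> puts into the integer registers \<open>j\<close> and \<open>k\<close> the column and the row of the cell
  of \<open>(x, y)\<close> in the axis-parallel grid of squares of diameter \<open>2 ^ i\<close>, that is, of side length
  \<open>2 ^ i / sqrt 2\<close>, with a corner at the origin.  Cells are half-open, and negative levels are
  treated as level 0.\<close>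

definition grid_coord :: "int \<Rightarrow> real \<Rightarrow> int" where
  "grid_coord i x = \<lfloor>x / (2 ^ nat i / sqrt 2)\<rfloor>"

primrec effect :: "instr \<Rightarrow> store \<Rightarrow> store" where
  "effect Skip \<sigma> = \<sigma>"
| "effect (ISet x e) \<sigma> = \<sigma>\<lparr>ireg := (ireg \<sigma>)(x := ival e \<sigma>)\<rparr>"
| "effect (RSet x e) \<sigma> = \<sigma>\<lparr>rreg := (rreg \<sigma>)(x := rval e \<sigma>)\<rparr>"
| "effect (IPut a i e) \<sigma> = \<sigma>\<lparr>iarr := (iarr \<sigma>)(a := put (iarr \<sigma> a) (ival i \<sigma>) (ival e \<sigma>))\<rparr>"
| "effect (RPut a i e) \<sigma> = \<sigma>\<lparr>rarr := (rarr \<sigma>)(a := put (rarr \<sigma> a) (ival i \<sigma>) (rval e \<sigma>))\<rparr>"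
| "effect (IPush a e) \<sigma> = \<sigma>\<lparr>iarr := (iarr \<sigma>)(a := iarr \<sigma> a @ [ival e \<sigma>])\<rparr>"
| "effect (RPush a e) \<sigma> = \<sigma>\<lparr>rarr := (rarr \<sigma>)(a := rarr \<sigma> a @ [rval e \<sigma>])\<rparr>"
| "effect (IClear a) \<sigma> = \<sigma>\<lparr>iarr := (iarr \<sigma>)(a := [])\<rparr>"
| "effect (RClear a) \<sigma> = \<sigma>\<lparr>rarr := (rarr \<sigma>)(a := [])\<rparr>"
| "effect (Grid j k x y i) \<sigma> =
     \<sigma>\<lparr>ireg := (ireg \<sigma>)(j := grid_coord (ival i \<sigma>) (rval x \<sigma>),
                         k := grid_coord (ival i \<sigma>) (rval y \<sigma>))\<rparr>"

primrec cost :: "instr \<Rightarrow> nat" where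
  "cost Skip = 1"
| "cost (ISet x e) = icost e + 1"
| "cost (RSet x e) = rcost e + 1"
| "cost (IPut a i e) = icost i + icost e + 1"
| "cost (RPut a i e) = icost i + rcost e + 1"
| "cost (IPush a e) = icost e + 1"
| "cost (RPush a e) = rcost e + 1"
| "cost (IClear a) = 1"
| "cost (RClear a) = 1"
| "cost (Grid j k x y i) = rcost x + rcost y + icost i + 1"

text \<open>The sums are meaningful for stores with finitely many non-empty arrays only; programs
  preserve this property.\<close>

definition finite_store :: "store \<Rightarrow> bool" where
  "finite_store \<sigma> \<longleftrightarrow> finite {a. iarr \<sigma> a \<noteq> []} \<and> finite {a. rarr \<sigma> a \<noteq> []}"

definition cells :: "store \<Rightarrow> nat" where
  "cells \<sigma> = (\<Sum>a | iarr \<sigma> a \<noteq> []. length (iarr \<sigma> a)) + (\<Sum>a | rarr \<sigma> a \<noteq> []. length (rarr \<sigma> a))"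

datatype com = Do instr | Seq com com | If bexp com com | While bexp com

text \<open>\<open>exec c \<sigma> t m \<tau>\<close>: started in \<open>\<sigma>\<close>, the program \<open>c\<close> halts in \<open>\<tau>\<close> after \<open>t\<close> units of time,
  and \<open>m\<close> is the maximal number of array cells in use at any moment of the computation.\<close>

inductive exec :: "com \<Rightarrow> store \<Rightarrow> nat \<Rightarrow> nat \<Rightarrow> store \<Rightarrow> bool" where
  exec_Do: "exec (Do i) \<sigma> (cost i) (max (cells \<sigma>) (cells (effect i \<sigma>))) (effect i \<sigma>)"
| exec_Seq: "exec c \<sigma> t m \<sigma>' \<Longrightarrow> exec d \<sigma>' t' m' \<tau> \<Longrightarrow> exec (Seq c d) \<sigma> (t + t') (max m m') \<tau>"
| exec_IfT: "bval b \<sigma> \<Longrightarrow> exec c \<sigma> t m \<tau> \<Longrightarrow> exec (If b c d) \<sigma> (bcost b + t) m \<tau>"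
| exec_IfF: "\<not> bval b \<sigma> \<Longrightarrow> exec d \<sigma> t m \<tau> \<Longrightarrow> exec (If b c d) \<sigma> (bcost b + t) m \<tau>"
| exec_WhileF: "\<not> bval b \<sigma> \<Longrightarrow> exec (While b c) \<sigma> (bcost b) (cells \<sigma>) \<sigma>"
| exec_WhileT: "bval b \<sigma> \<Longrightarrow> exec c \<sigma> t m \<sigma>' \<Longrightarrow> exec (While b c) \<sigma>' t' m' \<tau> \<Longrightarrow>
    exec (While b c) \<sigma> (bcost b + t + t') (max m m') \<tau>"

inductive_cases exec_DoE: "exec (Do i) \<sigma> t m \<tau>"
inductive_cases exec_SeqE: "exec (Seq c d) \<sigma> t m \<tau>"
inductive_cases exec_IfE: "exec (If b c d) \<sigma> t m \<tau>"
inductive_cases exec_WhileE: "exec (While b c) \<sigma> t m \<tau>"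

lemma exec_deterministic:
  "exec c \<sigma> t m \<tau> \<Longrightarrow> exec c \<sigma> t' m' \<tau>' \<Longrightarrow> t' = t \<and> m' = m \<and> \<tau>' = \<tau>"
proof (induction arbitrary: t' m' \<tau>' rule: exec.induct)
  case (exec_Do i \<sigma>)
  from exec_Do.prems show ?case by (rule exec_DoE) simp
next
  case (exec_Seq c \<sigma> t m \<sigma>' d u k \<tau>)
  from exec_Seq.prems show ?case by (rule exec_SeqE) (metis exec_Seq.IH)
next
  case (exec_IfT b \<sigma> c t m \<tau> d)
  from exec_IfT.prems show ?case by (rule exec_IfE) (use exec_IfT.hyps exec_IfT.IH in blast)+
next
  case (exec_IfF b \<sigma> d t m \<tau> c)
  from exec_IfF.prems show ?case by (rule exec_IfE) (use exec_IfF.hyps exec_IfF.IH in blast)+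
next
  case (exec_WhileF b \<sigma> c)
  from exec_WhileF.prems show ?case by (rule exec_WhileE) (use exec_WhileF.hyps in blast)+
next
  case (exec_WhileT b \<sigma> c t m \<sigma>' u k \<tau>)
  from exec_WhileT.prems show ?case
    by (rule exec_WhileE) (metis exec_WhileT.hyps(1) exec_WhileT.IH)+
qed


section \<open>Data structures and oracles\<close>

text \<open>A data structure is a store, holding the stored data, together with a program that answers
  queries.  The store may be modified by queries, and every sequence of queries has to be
  answered correctly within the given bounds; this is expressed by a set \<open>I\<close> of stores that is
  closed under queries.  Queries from \<open>D\<close> are passed in registers by \<open>load\<close>, and the answer is
  returned in the integer register 0.  The bound \<open>S\<close> covers the working memory of queries.\<close>

definition data_structure ::
    "('q \<Rightarrow> store \<Rightarrow> store) \<Rightarrow> 'q set \<Rightarrow> ('q \<Rightarrow> bool) \<Rightarrow> com \<Rightarrow> real \<Rightarrow> real \<Rightarrow> store \<Rightarrow> bool" where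
  "data_structure load D answer c S Q \<sigma> \<longleftrightarrow>
     (\<exists>I. \<sigma> \<in> I \<and>
       (\<forall>\<tau>\<in>I. finite_store \<tau> \<and> real (cells \<tau>) \<le> S \<and>
         (\<forall>x\<in>D. \<exists>t m \<tau>'. exec c (load x \<tau>) t m \<tau>' \<and> real t \<le> Q \<and> real m \<le> S \<and>
            ireg \<tau>' 0 = (if answer x then 1 else 0) \<and> \<tau>' \<in> I)))"

text \<open>Programs refer to the sites by their positions in a list \<open>ps\<close> that enumerates \<open>P\<close>.
  The coordinates of a query point are passed in even registers, because the odd names may be in
  use for the data of a reachability oracle, see \<open>link\<close> below.\<close>

definition load_pair :: "nat \<times> nat \<Rightarrow> store \<Rightarrow> store" where
  "load_pair = (\<lambda>(i, j) \<sigma>. \<sigma>\<lparr>ireg := (ireg \<sigma>)(0 := int i, 1 := int j)\<rparr>)"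

definition load_site_point :: "nat \<times> point \<Rightarrow> store \<Rightarrow> store" where
  "load_site_point = (\<lambda>(i, x) \<sigma>.
     \<sigma>\<lparr>ireg := (ireg \<sigma>)(0 := int i), rreg := (rreg \<sigma>)(0 := fst x, 2 := snd x)\<rparr>)"

definition reachability_oracle ::
    "point list \<Rightarrow> (point \<Rightarrow> real) \<Rightarrow> com \<Rightarrow> real \<Rightarrow> real \<Rightarrow> store \<Rightarrow> bool" where
  "reachability_oracle ps r =
     data_structure load_pair ({..<length ps} \<times> {..<length ps})
       (\<lambda>(i, j). ps ! i \<rightarrow>\<^sup>*\<^bsub>transmission_graph (set ps) r\<^esub> ps ! j)"

definition geometric_reachability_oracle ::
    "point list \<Rightarrow> (point \<Rightarrow> real) \<Rightarrow> com \<Rightarrow> real \<Rightarrow> real \<Rightarrow> store \<Rightarrow> bool" where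
  "geometric_reachability_oracle ps r =
     data_structure load_site_point ({..<length ps} \<times> UNIV)
       (\<lambda>(i, x). reaches_point (set ps) r (ps ! i) x)"

definition sites_store :: "point list \<Rightarrow> (point \<Rightarrow> real) \<Rightarrow> store" where
  "sites_store ps r =
     \<lparr>ireg = (\<lambda>_. 0)(0 := int (length ps)), rreg = (\<lambda>_. 0), iarr = (\<lambda>_. []),
      rarr = (\<lambda>_. [])(0 := map fst ps, 1 := map snd ps, 2 := map r ps)\<rparr>"

text \<open>The disjoint union of two stores: the names of \<open>\<sigma>\<close> become the even names and the names of
  \<open>\<tau>\<close> become the odd names.\<close>

definition interleave :: "(nat \<Rightarrow> 'a) \<Rightarrow> (nat \<Rightarrow> 'a) \<Rightarrow> nat \<Rightarrow> 'a" where
  "interleave f g k = (if even k then f (k div 2) else g (k div 2))"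

definition link :: "store \<Rightarrow> store \<Rightarrow> store" where
  "link \<sigma> \<tau> =
     \<lparr>ireg = interleave (ireg \<sigma>) (ireg \<tau>), rreg = interleave (rreg \<sigma>) (rreg \<tau>),
      iarr = interleave (iarr \<sigma>) (iarr \<tau>), rarr = interleave (rarr \<sigma>) (rarr \<tau>)\<rparr>"

end

theory Submission
  imports Defs
begin

text \<open>Scale the smallest radius to 2 and put a site of radius between \<open>2 * 2 ^ l\<close> and \<open>4 * 2 ^ l\<close> into its cell
  of the grid of diameter \<open>2 ^ l\<close>.  The sites of one cell and level reach each other, hence it suffices
  to find one of them whose disc contains the query point \<open>x\<close>.  The discs of such a group share an interior
  point; in polar coordinates around it they are the graphs of functions that cross pairwise at most twice,
  so that their upper envelope has linear size (Davenport--Schinzel).  A single bottom-up merge sort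
  both groups the sites by cells and computes all envelopes, and a binary search finds a disc of a
  given cell that contains \<open>x\<close>.  Only constantly many cells per level are close enough to \<open>x\<close>, and among all
  cells that have the same offset from the cell of \<open>x\<close> at their level, the disc found at the lowest level is
  reachable from those found at higher levels.  Hence constantly many reachability queries suffice.\<close>



section \<open>Running programs\<close>

text \<open>The origin of the polar coordinates shapes the construction. No operation of the machine
  turns the integer coordinates of a cell into reals, so a point common to the discs of a cell
  cannot be read off the cell; it has to be derived from one of its sites. Hence the merge sort runs
  twice: once with all curves equal, only to obtain a representative site of every cell, and once
  more with the discs. There is no trigonometry either. A direction is given by its sine
  \<open>s\<close> and the nonnegative root of \<open>1 - s * s\<close>, which reaches only the
  points above the origin. With the origin below the representative and every site stored a second
  time, mirrored, each point lies strictly above the origin in at least one of the two copies of a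
  given site. This is the source of the \<open>2 * n\<close> curves and of the directions
  \<open>d < 2\<close>. Scaling the smallest radius to 2 leaves room to shift the origin by a whole
  cell diameter and stay inside all discs of the cell. Cells are found by binary search in the
  sorted list of pieces, which costs a factor \<open>log n\<close> per level; the levels number
  about \<open>log\<close> of the radius ratio.\<close>

definition runs :: "com \<Rightarrow> store \<Rightarrow> nat \<Rightarrow> (store \<Rightarrow> bool) \<Rightarrow> bool" where
  "runs c \<sigma> T Q \<longleftrightarrow> (\<exists>t m \<tau>. exec c \<sigma> t m \<tau> \<and> t \<le> T \<and> Q \<tau>)"

abbreviation seq :: "com \<Rightarrow> com \<Rightarrow> com" (infixr ";;" 60) where
  "c ;; d \<equiv> Seq c d"

abbreviation skip :: com where "skip \<equiv> Do Skip"

lemma runs_weaken: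
  "runs c \<sigma> T Q \<Longrightarrow> T \<le> T' \<Longrightarrow> (\<And>\<tau>. Q \<tau> \<Longrightarrow> Q' \<tau>) \<Longrightarrow> runs c \<sigma> T' Q'"
  unfolding runs_def by (meson order_trans)

lemma runs_Seq:
  assumes "runs c \<sigma> T R" "\<And>\<tau>. R \<tau> \<Longrightarrow> runs d \<tau> T' Q" "T + T' \<le> U"
  shows "runs (c ;; d) \<sigma> U Q"
proof -
  obtain t m \<sigma>' where 1: "exec c \<sigma> t m \<sigma>'" "t \<le> T" "R \<sigma>'"
    using assms(1) by (auto simp: runs_def)
  obtain t' m' \<tau> where 2: "exec d \<sigma>' t' m' \<tau>" "t' \<le> T'" "Q \<tau>"
    using assms(2)[OF 1(3)] by (auto simp: runs_def)
  show ?thesis unfolding runs_def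
    using exec_Seq[OF 1(1) 2(1)] add_mono[OF 1(2) 2(2)] 2(3) assms(3) order_trans by blast
qed

lemma runs_If:
  assumes "bval b \<sigma> \<Longrightarrow> runs c \<sigma> T Q" "\<not> bval b \<sigma> \<Longrightarrow> runs d \<sigma> T Q" "bcost b + T \<le> U"
  shows "runs (If b c d) \<sigma> U Q"
proof (cases "bval b \<sigma>")
  case True
  then obtain t m \<tau> where "exec c \<sigma> t m \<tau>" "t \<le> T" "Q \<tau>"
    using assms(1) by (auto simp: runs_def)
  then show ?thesis unfolding runs_def
    using exec_IfT[OF True] assms(3) by (meson add_le_cancel_left order_trans)
next
  case False
  then obtain t m \<tau> where "exec d \<sigma> t m \<tau>" "t \<le> T" "Q \<tau>"
    using assms(2) by (auto simp: runs_def)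
  then show ?thesis unfolding runs_def
    using exec_IfF[OF False] assms(3) by (meson add_le_cancel_left order_trans)
qed

lemma bcost_pos: "0 < bcost b"
  by (induction b) auto

text \<open>The first argument of the invariant is a time budget that every iteration has to pay from.\<close>

lemma runs_While:
  assumes step: "\<And>q \<sigma>. I q \<sigma> \<Longrightarrow> bval b \<sigma> \<Longrightarrow>
      \<exists>T. runs c \<sigma> T (\<lambda>\<tau>. \<exists>q'. I q' \<tau> \<and> bcost b + T + q' \<le> q)"
    and exit: "\<And>q \<sigma>. I q \<sigma> \<Longrightarrow> \<not> bval b \<sigma> \<Longrightarrow> bcost b \<le> q"
    and init: "I q \<sigma>"
  shows "runs (While b c) \<sigma> q (\<lambda>\<tau>. (\<exists>q'. I q' \<tau>) \<and> \<not> bval b \<tau>)"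
  using init
proof (induction q arbitrary: \<sigma> rule: less_induct)
  case (less q)
  show ?case
  proof (cases "bval b \<sigma>")
    case False
    then show ?thesis
      unfolding runs_def using exec_WhileF[OF False] exit[OF less.prems False] less.prems by blast
  next
    case True
    obtain T where "runs c \<sigma> T (\<lambda>\<tau>. \<exists>q'. I q' \<tau> \<and> bcost b + T + q' \<le> q)"
      using step[OF less.prems True] by blast
    then obtain t m \<sigma>' q' where 1: "exec c \<sigma> t m \<sigma>'" "t \<le> T" "I q' \<sigma>'" "bcost b + T + q' \<le> q"
      by (auto simp: runs_def)
    have "q' < q"
      using 1(4) bcost_pos[of b] by linarith
    from less.IH[OF this 1(3)] obtain t' m' \<tau> where
      2: "exec (While b c) \<sigma>' t' m' \<tau>" "t' \<le> q'" "\<exists>q'. I q' \<tau>" "\<not> bval b \<tau>"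
      by (auto simp: runs_def)
    have "exec (While b c) \<sigma> (bcost b + t + t') (max m m') \<tau>"
      by (rule exec_WhileT[OF True 1(1) 2(1)])
    moreover have "bcost b + t + t' \<le> q"
      using 1 2 by linarith
    ultimately show ?thesis
      unfolding runs_def using 2 by blast
  qed
qed

section \<open>Loop-free programs\<close>

primrec loopfree :: "com \<Rightarrow> bool" where
  "loopfree (Do i) \<longleftrightarrow> True"
| "loopfree (Seq c d) \<longleftrightarrow> loopfree c \<and> loopfree d"
| "loopfree (If b c d) \<longleftrightarrow> loopfree c \<and> loopfree d"
| "loopfree (While b c) \<longleftrightarrow> False"

text \<open>Symbolic execution by rewriting: on loop-free programs \<open>ev\<close> yields the
  final store and \<open>tm\<close> a bound on the time that holds for every store. The clauses for
  \<open>While\<close> are dummy values, which \<open>exec_ev\<close> excludes.\<close>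

primrec ev :: "com \<Rightarrow> store \<Rightarrow> store" where
  "ev (Do i) \<sigma> = effect i \<sigma>"
| "ev (Seq c d) \<sigma> = ev d (ev c \<sigma>)"
| "ev (If b c d) \<sigma> = (if bval b \<sigma> then ev c \<sigma> else ev d \<sigma>)"
| "ev (While b c) \<sigma> = \<sigma>"

primrec tm :: "com \<Rightarrow> nat" where
  "tm (Do i) = cost i"
| "tm (Seq c d) = tm c + tm d"
| "tm (If b c d) = bcost b + max (tm c) (tm d)"
| "tm (While b c) = 0"

lemma exec_ev: "loopfree c \<Longrightarrow> \<exists>t m. exec c \<sigma> t m (ev c \<sigma>) \<and> t \<le> tm c"
proof (induction c arbitrary: \<sigma>)
  case (Do i)
  then show ?case by (auto intro: exec_Do)
next
  case (Seq c d)
  obtain t m t' m' where 1: "exec c \<sigma> t m (ev c \<sigma>)" "t \<le> tm c"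
    "exec d (ev c \<sigma>) t' m' (ev d (ev c \<sigma>))" "t' \<le> tm d"
    using Seq.IH Seq.prems by (metis loopfree.simps(2))
  from exec_Seq[OF 1(1,3)] 1(2,4) show ?case
    by (metis add_mono ev.simps(2) tm.simps(2))
next
  case (If b c d)
  show ?case
  proof (cases "bval b \<sigma>")
    case True
    obtain t m where "exec c \<sigma> t m (ev c \<sigma>)" "t \<le> tm c"
      using If.IH If.prems by (metis loopfree.simps(3))
    then show ?thesis using exec_IfT[OF True] True
      by (metis add_le_cancel_left ev.simps(3) max.coboundedI1 tm.simps(3))
  next
    case False
    obtain t m where "exec d \<sigma> t m (ev d \<sigma>)" "t \<le> tm d"
      using If.IH If.prems by (metis loopfree.simps(3))
    then show ?thesis using exec_IfF[OF False] False
      by (metis add_le_cancel_left ev.simps(3) max.coboundedI2 tm.simps(3))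
  qed
qed simp

lemma runs_ev: "loopfree c \<Longrightarrow> Q (ev c \<sigma>) \<Longrightarrow> tm c \<le> T \<Longrightarrow> runs c \<sigma> T Q"
  unfolding runs_def using exec_ev[of c \<sigma>] by (meson order_trans)

lemma runs_Seq_ev:
  "loopfree c \<Longrightarrow> runs d (ev c \<sigma>) T Q \<Longrightarrow> tm c + T \<le> U \<Longrightarrow> runs (c ;; d) \<sigma> U Q"
  by (rule runs_Seq[where R = "\<lambda>\<tau>. \<tau> = ev c \<sigma>"]) (auto intro: runs_ev)

section \<open>Frame conditions and memory use\<close>

fun written :: "instr \<Rightarrow> nat set \<times> nat set \<times> nat set \<times> nat set" where
  "written Skip = ({}, {}, {}, {})"
| "written (ISet x e) = ({x}, {}, {}, {})"
| "written (RSet x e) = ({}, {x}, {}, {})"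
| "written (IPut a i e) = ({}, {}, {a}, {})"
| "written (RPut a i e) = ({}, {}, {}, {a})"
| "written (IPush a e) = ({}, {}, {a}, {})"
| "written (RPush a e) = ({}, {}, {}, {a})"
| "written (IClear a) = ({}, {}, {a}, {})"
| "written (RClear a) = ({}, {}, {}, {a})"
| "written (Grid j k x y i) = ({j, k}, {}, {}, {})"

fun writes :: "com \<Rightarrow> nat set \<times> nat set \<times> nat set \<times> nat set" where
  "writes (Do i) = written i"
| "writes (Seq c d) = (case (writes c, writes d) of ((A, B, C, D), (A', B', C', D')) \<Rightarrow>
     (A \<union> A', B \<union> B', C \<union> C', D \<union> D'))"
| "writes (If b c d) = (case (writes c, writes d) of ((A, B, C, D), (A', B', C', D')) \<Rightarrow>
     (A \<union> A', B \<union> B', C \<union> C', D \<union> D'))"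
| "writes (While b c) = writes c"

definition same_outside :: "nat set \<times> nat set \<times> nat set \<times> nat set \<Rightarrow> store \<Rightarrow> store \<Rightarrow> bool" where
  "same_outside W \<sigma> \<tau> \<longleftrightarrow> (case W of (A, B, C, D) \<Rightarrow>
     (\<forall>k. k \<notin> A \<longrightarrow> ireg \<tau> k = ireg \<sigma> k) \<and> (\<forall>k. k \<notin> B \<longrightarrow> rreg \<tau> k = rreg \<sigma> k) \<and>
     (\<forall>k. k \<notin> C \<longrightarrow> iarr \<tau> k = iarr \<sigma> k) \<and> (\<forall>k. k \<notin> D \<longrightarrow> rarr \<tau> k = rarr \<sigma> k))"

text \<open>A syntactic frame rule. Specifications and loop invariants can concentrate on what
  changes; facts about all other names are carried across a loop by this lemma.\<close>

lemma exec_same_outside: "exec c \<sigma> t m \<tau> \<Longrightarrow> same_outside (writes c) \<sigma> \<tau>"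
proof (induction rule: exec.induct)
  case (exec_Do i \<sigma>)
  then show ?case by (cases i) (auto simp: same_outside_def)
next
  case (exec_Seq c \<sigma> t m \<sigma>' d t' m' \<tau>)
  then show ?case
    by (cases "writes c"; cases "writes d") (auto simp: same_outside_def)
next
  case (exec_IfT b \<sigma> c t m \<tau> d)
  then show ?case by (cases "writes c"; cases "writes d") (auto simp: same_outside_def)
next
  case (exec_IfF b \<sigma> d t m \<tau> c)
  then show ?case by (cases "writes c"; cases "writes d") (auto simp: same_outside_def)
next
  case (exec_WhileF b \<sigma> c)
  then show ?case by (cases "writes c") (auto simp: same_outside_def)
next
  case (exec_WhileT b \<sigma> c t m \<sigma>' t' m' \<tau>)
  then show ?case by (cases "writes c") (auto simp: same_outside_def)
qed

lemma runs_same_outside: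
  "runs c \<sigma> T Q \<Longrightarrow> runs c \<sigma> T (\<lambda>\<tau>. Q \<tau> \<and> same_outside (writes c) \<sigma> \<tau>)"
  unfolding runs_def using exec_same_outside by blast

fun allocating :: "instr \<Rightarrow> bool" where
  "allocating (IPush a e) = True"
| "allocating (RPush a e) = True"
| "allocating (IClear a) = True"
| "allocating (RClear a) = True"
| "allocating _ = False"

text \<open>\<open>runs\<close> forgets the memory. A program that neither extends nor clears an
  array keeps the number of cells constant, so its peak is the number of cells at the start. Apart
  from the program of the given oracle, a query has this form, and its space is that of the stored
  data.\<close>

primrec in_place :: "com \<Rightarrow> bool" where
  "in_place (Do i) \<longleftrightarrow> \<not> allocating i"
| "in_place (Seq c d) \<longleftrightarrow> in_place c \<and> in_place d"
| "in_place (If b c d) \<longleftrightarrow> in_place c \<and> in_place d"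
| "in_place (While b c) \<longleftrightarrow> in_place c"

lemma length_put [simp]: "length (put xs i x) = length xs"
  by (simp add: put_def)

lemma cells_cong:
  assumes "\<And>a. length (iarr \<tau> a) = length (iarr \<sigma> a)" "\<And>a. length (rarr \<tau> a) = length (rarr \<sigma> a)"
  shows "cells \<tau> = cells \<sigma>"
proof -
  have "{a. iarr \<tau> a \<noteq> []} = {a. iarr \<sigma> a \<noteq> []}" "{a. rarr \<tau> a \<noteq> []} = {a. rarr \<sigma> a \<noteq> []}"
    using assms by (metis length_0_conv)+
  then show ?thesis
    unfolding cells_def using assms by simp
qed

lemma cells_effect: "\<not> allocating i \<Longrightarrow> cells (effect i \<sigma>) = cells \<sigma>"
  by (rule cells_cong; cases i) auto

lemma exec_in_place: "exec c \<sigma> t m \<tau> \<Longrightarrow> in_place c \<Longrightarrow> m = cells \<sigma> \<and> cells \<tau> = cells \<sigma>"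
  by (induction rule: exec.induct) (auto simp: cells_effect)

lemma finite_store_effect: "finite_store \<sigma> \<Longrightarrow> finite_store (effect i \<sigma>)"
proof -
  have *: "finite {a. (f(x := v)) a \<noteq> []}" if "finite {a. f a \<noteq> []}" for f :: "nat \<Rightarrow> 'x list" and x v
    by (rule finite_subset[of _ "insert x {a. f a \<noteq> []}"]) (use that in auto)
  assume "finite_store \<sigma>"
  then show ?thesis
    by (cases i) (auto simp: finite_store_def simp del: fun_upd_apply intro!: *)
qed

lemma exec_finite_store: "exec c \<sigma> t m \<tau> \<Longrightarrow> finite_store \<sigma> \<Longrightarrow> finite_store \<tau>"
  by (induction rule: exec.induct) (auto simp: finite_store_effect)


section \<open>Programs on one half of a linked store\<close>

primrec ren_iexp :: "(nat \<Rightarrow> nat) \<Rightarrow> iexp \<Rightarrow> iexp" where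
  "ren_iexp f (IConst k) = IConst k"
| "ren_iexp f (IReg x) = IReg (f x)"
| "ren_iexp f (IGet a e) = IGet (f a) (ren_iexp f e)"
| "ren_iexp f (IAdd d e) = IAdd (ren_iexp f d) (ren_iexp f e)"
| "ren_iexp f (ISub d e) = ISub (ren_iexp f d) (ren_iexp f e)"
| "ren_iexp f (IHalf e) = IHalf (ren_iexp f e)"

primrec ren_rexp :: "(nat \<Rightarrow> nat) \<Rightarrow> rexp \<Rightarrow> rexp" where
  "ren_rexp f (RConst k) = RConst k"
| "ren_rexp f (RReg x) = RReg (f x)"
| "ren_rexp f (RGet a e) = RGet (f a) (ren_iexp f e)"
| "ren_rexp f (RAdd d e) = RAdd (ren_rexp f d) (ren_rexp f e)"
| "ren_rexp f (RSub d e) = RSub (ren_rexp f d) (ren_rexp f e)"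
| "ren_rexp f (RMul d e) = RMul (ren_rexp f d) (ren_rexp f e)"
| "ren_rexp f (RDiv d e) = RDiv (ren_rexp f d) (ren_rexp f e)"
| "ren_rexp f (RSqrt e) = RSqrt (ren_rexp f e)"

primrec ren_bexp :: "(nat \<Rightarrow> nat) \<Rightarrow> bexp \<Rightarrow> bexp" where
  "ren_bexp f (ILess d e) = ILess (ren_iexp f d) (ren_iexp f e)"
| "ren_bexp f (RLess d e) = RLess (ren_rexp f d) (ren_rexp f e)"
| "ren_bexp f (BNot b) = BNot (ren_bexp f b)"
| "ren_bexp f (BAnd b c) = BAnd (ren_bexp f b) (ren_bexp f c)"

primrec ren_instr :: "(nat \<Rightarrow> nat) \<Rightarrow> instr \<Rightarrow> instr" where
  "ren_instr f Skip = Skip"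
| "ren_instr f (ISet x e) = ISet (f x) (ren_iexp f e)"
| "ren_instr f (RSet x e) = RSet (f x) (ren_rexp f e)"
| "ren_instr f (IPut a i e) = IPut (f a) (ren_iexp f i) (ren_iexp f e)"
| "ren_instr f (RPut a i e) = RPut (f a) (ren_iexp f i) (ren_rexp f e)"
| "ren_instr f (IPush a e) = IPush (f a) (ren_iexp f e)"
| "ren_instr f (RPush a e) = RPush (f a) (ren_rexp f e)"
| "ren_instr f (IClear a) = IClear (f a)"
| "ren_instr f (RClear a) = RClear (f a)"
| "ren_instr f (Grid j k x y i) = Grid (f j) (f k) (ren_rexp f x) (ren_rexp f y) (ren_iexp f i)"

primrec ren :: "(nat \<Rightarrow> nat) \<Rightarrow> com \<Rightarrow> com" where
  "ren f (Do i) = Do (ren_instr f i)"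
| "ren f (Seq c d) = Seq (ren f c) (ren f d)"
| "ren f (If b c d) = If (ren_bexp f b) (ren f c) (ren f d)"
| "ren f (While b c) = While (ren_bexp f b) (ren f c)"

abbreviation (input) "even_name \<equiv> (\<lambda>k::nat. 2 * k)"
abbreviation (input) "odd_name \<equiv> (\<lambda>k::nat. Suc (2 * k))"

lemma interleave_even [simp]: "interleave f g (2 * k) = f k"
  by (simp add: interleave_def)

lemma interleave_odd [simp]: "interleave f g (Suc (2 * k)) = g k"
  by (simp add: interleave_def)

lemma interleave_upd_even: "interleave (f(k := x)) g = (interleave f g)(2 * k := x)"
  by (auto simp: interleave_def fun_eq_iff)

lemma interleave_upd_odd: "interleave f (g(k := x)) = (interleave f g)(Suc (2 * k) := x)"
  by (auto simp: interleave_def fun_eq_iff)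

lemma ival_even [simp]: "ival (ren_iexp even_name e) (link \<sigma> \<rho>) = ival e \<sigma>"
  by (induction e) (auto simp: link_def)

lemma rval_even [simp]: "rval (ren_rexp even_name e) (link \<sigma> \<rho>) = rval e \<sigma>"
  by (induction e) (simp_all, simp_all add: link_def)

lemma bval_even [simp]: "bval (ren_bexp even_name b) (link \<sigma> \<rho>) = bval b \<sigma>"
  by (induction b) simp_all

lemma ival_odd [simp]: "ival (ren_iexp odd_name e) (link \<sigma> \<rho>) = ival e \<rho>"
  by (induction e) (auto simp: link_def)

lemma rval_odd [simp]: "rval (ren_rexp odd_name e) (link \<sigma> \<rho>) = rval e \<rho>"
  by (induction e) (simp_all, simp_all add: link_def)

lemma bval_odd [simp]: "bval (ren_bexp odd_name b) (link \<sigma> \<rho>) = bval b \<rho>"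
  by (induction b) simp_all

lemma icost_ren [simp]: "icost (ren_iexp f e) = icost e"
  by (induction e) auto

lemma rcost_ren [simp]: "rcost (ren_rexp f e) = rcost e"
  by (induction e) auto

lemma bcost_ren [simp]: "bcost (ren_bexp f b) = bcost b"
  by (induction b) auto

lemma cost_ren [simp]: "cost (ren_instr f i) = cost i"
  by (cases i) auto

lemma effect_even: "effect (ren_instr even_name i) (link \<sigma> \<rho>) = link (effect i \<sigma>) \<rho>"
  by (cases i; simp; simp add: link_def interleave_upd_even)

lemma effect_odd: "effect (ren_instr odd_name i) (link \<sigma> \<rho>) = link \<sigma> (effect i \<rho>)"
  by (cases i; simp; simp add: link_def interleave_upd_odd)

lemma sum_interleave:
  fixes f g :: "nat \<Rightarrow> 'a list"
  assumes "finite {a. f a \<noteq> []}" "finite {a. g a \<noteq> []}"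
  shows "finite {a. interleave f g a \<noteq> []}"
    and "(\<Sum>a | interleave f g a \<noteq> []. length (interleave f g a)) =
      (\<Sum>a | f a \<noteq> []. length (f a)) + (\<Sum>a | g a \<noteq> []. length (g a))"
proof -
  let ?F = "{a. f a \<noteq> []}" and ?G = "{a. g a \<noteq> []}"
  have *: "{a. interleave f g a \<noteq> []} = even_name ` ?F \<union> odd_name ` ?G"
    by (auto simp: interleave_def image_iff split: if_splits)
      (use odd_two_times_div_two_succ even_two_times_div_two in \<open>metis Suc_eq_plus1\<close>)+
  show "finite {a. interleave f g a \<noteq> []}"
    unfolding * using assms by simp
  have "(\<Sum>a\<in>even_name ` ?F \<union> odd_name ` ?G. length (interleave f g a)) =
      (\<Sum>a\<in>even_name ` ?F. length (interleave f g a)) + (\<Sum>a\<in>odd_name ` ?G. length (interleave f g a))"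
    by (rule sum.union_disjoint) (use assms in \<open>auto, presburger\<close>)
  also have "(\<Sum>a\<in>even_name ` ?F. length (interleave f g a)) = (\<Sum>a\<in>?F. length (f a))"
    by (subst sum.reindex) (auto simp: inj_on_def)
  also have "(\<Sum>a\<in>odd_name ` ?G. length (interleave f g a)) = (\<Sum>a\<in>?G. length (g a))"
    by (subst sum.reindex) (auto simp: inj_on_def)
  finally show "(\<Sum>a | interleave f g a \<noteq> []. length (interleave f g a)) =
      (\<Sum>a | f a \<noteq> []. length (f a)) + (\<Sum>a | g a \<noteq> []. length (g a))"
    unfolding * .
qed

lemma finite_store_link: "finite_store \<sigma> \<Longrightarrow> finite_store \<rho> \<Longrightarrow> finite_store (link \<sigma> \<rho>)"
  by (simp add: finite_store_def link_def sum_interleave(1))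

lemma cells_link: "finite_store \<sigma> \<Longrightarrow> finite_store \<rho> \<Longrightarrow> cells (link \<sigma> \<rho>) = cells \<sigma> + cells \<rho>"
  by (simp add: finite_store_def cells_def link_def sum_interleave(2))

text \<open>Effects on one half commute with \<open>link\<close>, so the renamed program simulates
  the original one step by step, and the idle half just adds its cells to the peak. Finiteness is
  carried through the induction because \<open>cells\<close> sums over the non-empty arrays, and
  \<open>cells_link\<close> splits this sum only for finite index sets.\<close>

lemma exec_even:
  "exec c \<sigma> t m \<tau> \<Longrightarrow> finite_store \<sigma> \<Longrightarrow> finite_store \<rho> \<Longrightarrow>
   exec (ren even_name c) (link \<sigma> \<rho>) t (m + cells \<rho>) (link \<tau> \<rho>)"
proof (induction rule: exec.induct)
  case (exec_Do i \<sigma>)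
  have "max (cells \<sigma>) (cells (effect i \<sigma>)) + cells \<rho> =
      max (cells (link \<sigma> \<rho>)) (cells (link (effect i \<sigma>) \<rho>))"
    using exec_Do by (simp add: cells_link finite_store_effect)
  then show ?case
    using exec.exec_Do[of "ren_instr even_name i" "link \<sigma> \<rho>"] by (simp add: effect_even)
next
  case (exec_Seq c \<sigma> t m \<sigma>' d t' m' \<tau>)
  have "finite_store \<sigma>'"
    using exec_Seq exec_finite_store by blast
  then show ?case
    using exec.exec_Seq[OF exec_Seq.IH(1) exec_Seq.IH(2)] exec_Seq.prems
    by (simp add: max_add_distrib_left)
next
  case (exec_IfT b \<sigma> c t m \<tau> d)
  then show ?case using exec.exec_IfT[of "ren_bexp even_name b" "link \<sigma> \<rho>"] by simp
next
  case (exec_IfF b \<sigma> d t m \<tau> c)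
  then show ?case using exec.exec_IfF[of "ren_bexp even_name b" "link \<sigma> \<rho>"] by simp
next
  case (exec_WhileF b \<sigma> c)
  then show ?case
    using exec.exec_WhileF[of "ren_bexp even_name b" "link \<sigma> \<rho>"] by (simp add: cells_link)
next
  case (exec_WhileT b \<sigma> c t m \<sigma>' t' m' \<tau>)
  have "finite_store \<sigma>'"
    using exec_WhileT exec_finite_store by blast
  then show ?case
    using exec.exec_WhileT[of "ren_bexp even_name b" "link \<sigma> \<rho>", OF _ exec_WhileT.IH(1)]
      exec_WhileT.IH(2) exec_WhileT.prems exec_WhileT.hyps(1)
    by (simp add: max_add_distrib_left)
qed

lemma exec_odd:
  "exec c \<rho> t m \<tau> \<Longrightarrow> finite_store \<sigma> \<Longrightarrow> finite_store \<rho> \<Longrightarrow>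
   exec (ren odd_name c) (link \<sigma> \<rho>) t (cells \<sigma> + m) (link \<sigma> \<tau>)"
proof (induction rule: exec.induct)
  case (exec_Do i \<rho>)
  have "cells \<sigma> + max (cells \<rho>) (cells (effect i \<rho>)) =
      max (cells (link \<sigma> \<rho>)) (cells (link \<sigma> (effect i \<rho>)))"
    using exec_Do by (simp add: cells_link finite_store_effect)
  then show ?case
    using exec.exec_Do[of "ren_instr odd_name i" "link \<sigma> \<rho>"] by (simp add: effect_odd)
next
  case (exec_Seq c \<rho> t m \<rho>' d t' m' \<tau>)
  have "finite_store \<rho>'"
    using exec_Seq exec_finite_store by blast
  then show ?case
    using exec.exec_Seq[OF exec_Seq.IH(1) exec_Seq.IH(2)] exec_Seq.prems
    by (simp add: max_add_distrib_right)
next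
  case (exec_IfT b \<rho> c t m \<tau> d)
  then show ?case using exec.exec_IfT[of "ren_bexp odd_name b" "link \<sigma> \<rho>"] by simp
next
  case (exec_IfF b \<rho> d t m \<tau> c)
  then show ?case using exec.exec_IfF[of "ren_bexp odd_name b" "link \<sigma> \<rho>"] by simp
next
  case (exec_WhileF b \<rho> c)
  then show ?case
    using exec.exec_WhileF[of "ren_bexp odd_name b" "link \<sigma> \<rho>"] by (simp add: cells_link)
next
  case (exec_WhileT b \<rho> c t m \<rho>' t' m' \<tau>)
  have "finite_store \<rho>'"
    using exec_WhileT exec_finite_store by blast
  then show ?case
    using exec.exec_WhileT[of "ren_bexp odd_name b" "link \<sigma> \<rho>", OF _ exec_WhileT.IH(1)]
      exec_WhileT.IH(2) exec_WhileT.prems exec_WhileT.hyps(1)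
    by (simp add: max_add_distrib_right)
qed


section \<open>Upper envelopes of curves that cross at most twice\<close>

text \<open>Ties are broken by the index, so of two different curves exactly one beats the other at
  every parameter. Coinciding discs then need no separate treatment.\<close>

definition beats :: "(nat \<Rightarrow> real \<Rightarrow> real) \<Rightarrow> nat \<Rightarrow> nat \<Rightarrow> real \<Rightarrow> bool" where
  "beats F a b t \<longleftrightarrow> F b t < F a t \<or> F b t = F a t \<and> a < b"

lemma beats_trans: "beats F a b t \<Longrightarrow> beats F b c t \<Longrightarrow> beats F a c t"
  by (auto simp: beats_def)

lemma not_beats: "a \<noteq> b \<Longrightarrow> \<not> beats F a b t \<longleftrightarrow> beats F b a t"
  by (auto simp: beats_def)

definition emit :: "(real \<times> nat) list \<Rightarrow> real \<times> nat \<Rightarrow> (real \<times> nat) list" where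
  "emit out p = (if out \<noteq> [] \<and> snd (last out) = snd p then butlast out @ [p] else out @ [p])"

text \<open>Curve \<open>a\<close> lives in the copy of the interval \<open>(-1, 1)\<close> that is named \<open>key a\<close>.  An envelope is
  a list of pieces \<open>(e, a)\<close>: the piece of \<open>a\<close> ends at parameter \<open>e\<close>, and it begins where the
  previous piece ends, or at \<open>-1\<close>.\<close>

locale curves =
  fixes key :: "nat \<Rightarrow> 'k::linorder" and F :: "nat \<Rightarrow> real \<Rightarrow> real"
    and c1 c2 :: "nat \<Rightarrow> nat \<Rightarrow> real" and U :: "nat set"
  assumes uncrossed: "\<And>a b t t'. a \<in> U \<Longrightarrow> b \<in> U \<Longrightarrow> -1 < t \<Longrightarrow> t \<le> t' \<Longrightarrow> t' < 1 \<Longrightarrow>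
      c1 a b \<notin> {t..t'} \<Longrightarrow> c2 a b \<notin> {t..t'} \<Longrightarrow> beats F a b t = beats F a b t'"
    and continuous: "\<And>a. a \<in> U \<Longrightarrow> continuous_on {-1<..<1} (F a)"
begin

definition best :: "nat set \<Rightarrow> nat \<Rightarrow> real \<Rightarrow> bool" where
  "best A v t \<longleftrightarrow> (\<forall>b\<in>A. key b = key v \<longrightarrow> b = v \<or> beats F v b t)"

text \<open>A piece that ends at 1 completes its copy of the interval: the curves of that copy are
  dropped, and the sweep restarts at -1 in the next copy.\<close>

definition rest :: "nat set \<Rightarrow> real \<Rightarrow> nat \<Rightarrow> nat set" where
  "rest A e v = (if e = 1 then {a \<in> A. key v < key a} else A)"

definition next_lo :: "real \<Rightarrow> real" where
  "next_lo e = (if e = 1 then -1 else e)"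

text \<open>The state in the middle of a sweep: the list covers what lies to the right of
  \<open>lo\<close> in the first copy, and all later copies. A piece may fail to be optimal at
  finitely many parameters. Thus the points where pieces are glued, and ties at crossings, need no
  attention while merging; continuity recovers the values there in
  \<open>good_lookup\<close>.\<close>

fun good :: "nat set \<Rightarrow> real \<Rightarrow> (real \<times> nat) list \<Rightarrow> bool" where
  "good A lo [] \<longleftrightarrow> A = {} \<and> lo = -1"
| "good A lo ((e, v) # L) \<longleftrightarrow> v \<in> A \<and> (\<forall>a\<in>A. key v \<le> key a) \<and> -1 \<le> lo \<and> lo < e \<and> e \<le> 1 \<and>
     finite {t. lo < t \<and> t < e \<and> \<not> best A v t} \<and> good (rest A e v) (next_lo e) L"

lemma rest_subset: "rest A e v \<subseteq> A"
  by (auto simp: rest_def)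

lemma good_head_key:
  "good A e L \<Longrightarrow> v \<in> A \<Longrightarrow> \<forall>a\<in>A. key v \<le> key a \<Longrightarrow> L \<noteq> [] \<and> key (snd (hd L)) = key v"
  by (cases L) (auto intro: antisym)

lemma good_raise:
  "good A lo ((e, v) # L) \<Longrightarrow> lo \<le> lo' \<Longrightarrow> lo' < e \<Longrightarrow> good A lo' ((e, v) # L)"
  by (auto elim: finite_subset[rotated])

lemma good_join:
  assumes "good A lo ((e, v) # (e', v) # L)"
  shows "good A lo ((e', v) # L)"
proof -
  \<comment> \<open>A piece ending at 1 would remove every curve with the key of \<open>v\<close>,
    and \<open>v\<close> could not own the next piece.\<close>
  have "e \<noteq> 1"
    using assms by (auto simp: rest_def)
  then have *: "good A e ((e', v) # L)"
    using assms by (auto simp: rest_def next_lo_def)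
  have "{t. lo < t \<and> t < e' \<and> \<not> best A v t} \<subseteq>
      insert e ({t. lo < t \<and> t < e \<and> \<not> best A v t} \<union> {t. e < t \<and> t < e' \<and> \<not> best A v t})"
    by auto
  then have "finite {t. lo < t \<and> t < e' \<and> \<not> best A v t}"
    by (rule finite_subset) (use assms * in auto)
  with assms * show ?thesis by auto
qed

lemma good_join_append:
  "good A lo (L @ (e, v) # (e', v) # L') \<Longrightarrow> good A lo (L @ (e', v) # L')"
proof (induction L arbitrary: A lo)
  case Nil
  from good_join[OF this[unfolded append_Nil]] show ?case by (simp only: append_Nil)
next
  case (Cons p L)
  then show ?case by (cases p) simp
qed

lemma good_emit:
  assumes "good A lo (out @ p # L)"
  shows "good A lo (emit out p @ L)"
proof (cases "out \<noteq> [] \<and> snd (last out) = snd p")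
  case True
  then have "out = butlast out @ [(fst (last out), snd p)]"
    by (metis append_butlast_last_id prod.collapse)
  with assms have "good A lo (butlast out @ (fst (last out), snd p) # (fst p, snd p) # L)"
    by (metis append.assoc append_Cons append_Nil prod.collapse)
  from good_join_append[OF this] show ?thesis
    using True by (simp add: emit_def)
qed (use assms in \<open>auto simp: emit_def\<close>)

text \<open>The view of \<open>good\<close> without recursion: piece \<open>i\<close> owns an open
  interval from \<open>s\<close> to its end, and the earlier pieces of the same copy end at
  \<open>s\<close> or before.\<close>

lemma good_nth:
  assumes "good A lo L" "i < length L"
  shows "snd (L ! i) \<in> A \<and> -1 \<le> fst (L ! i) \<and> fst (L ! i) \<le> 1 \<and>
    (\<exists>s. -1 \<le> s \<and> s < fst (L ! i) \<and> (key (snd (L ! i)) = key (snd (hd L)) \<longrightarrow> lo \<le> s) \<and>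
      finite {t. s < t \<and> t < fst (L ! i) \<and> \<not> best A (snd (L ! i)) t} \<and>
      (\<forall>j<i. key (snd (L ! j)) < key (snd (L ! i)) \<or>
         key (snd (L ! j)) = key (snd (L ! i)) \<and> fst (L ! j) \<le> s))"
  using assms
proof (induction L arbitrary: A lo i)
  case (Cons p L)
  obtain e v where p: "p = (e, v)" by (cases p)
  show ?case
  proof (cases i)
    case 0
    with Cons.prems p show ?thesis by (auto intro!: exI[of _ lo])
  next
    case (Suc k)
    have g: "good (rest A e v) (next_lo e) L" and k: "k < length L"
      and v: "v \<in> A" "\<forall>a\<in>A. key v \<le> key a" "lo < e" "-1 \<le> lo"
      using Cons.prems p Suc by auto
    from Cons.IH[OF g k] obtain s where s: "snd (L ! k) \<in> rest A e v"
      "-1 \<le> fst (L ! k)" "fst (L ! k) \<le> 1" "-1 \<le> s" "s < fst (L ! k)"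
      "key (snd (L ! k)) = key (snd (hd L)) \<longrightarrow> next_lo e \<le> s"
      "finite {t. s < t \<and> t < fst (L ! k) \<and> \<not> best (rest A e v) (snd (L ! k)) t}"
      "\<And>j. j < k \<Longrightarrow> key (snd (L ! j)) < key (snd (L ! k)) \<or>
         key (snd (L ! j)) = key (snd (L ! k)) \<and> fst (L ! j) \<le> s"
      by blast
    have b: "best (rest A e v) (snd (L ! k)) t \<Longrightarrow> best A (snd (L ! k)) t" for t
      using s(1) by (auto simp: best_def rest_def split: if_splits)
    have f: "finite {t. s < t \<and> t < fst (L ! k) \<and> \<not> best A (snd (L ! k)) t}"
      by (rule finite_subset[OF _ s(7)]) (use b in auto)
    have first: "key v < key (snd (L ! k)) \<or> key v = key (snd (L ! k)) \<and> e \<le> s"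
    proof (cases "e = 1")
      case True
      then show ?thesis using s(1) by (auto simp: rest_def)
    next
      case False
      then have gA: "good A e L" using g by (simp add: rest_def next_lo_def)
      have "key (snd (hd L)) = key v"
        using good_head_key[OF gA v(1,2)] by simp
      moreover have "key v \<le> key (snd (L ! k))"
        using s(1) v(2) by (auto simp: rest_def split: if_splits)
      ultimately show ?thesis
        using s(6) False by (auto simp: next_lo_def)
    qed
    have all: "key (snd ((p # L) ! j)) < key (snd (L ! k)) \<or>
         key (snd ((p # L) ! j)) = key (snd (L ! k)) \<and> fst ((p # L) ! j) \<le> s" if "j < Suc k" for j
      using that first s(8) p by (cases j) auto
    have A: "snd (L ! k) \<in> A"
      using s(1) by (auto simp: rest_def split: if_splits)
    have lo: "key (snd (L ! k)) = key v \<longrightarrow> lo \<le> s"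
      using first v(3) by auto
    show ?thesis
      unfolding Suc nth_Cons_Suc
      using A s(2-5) f all lo p by (intro conjI exI[of _ s]) auto
  qed
qed simp

lemma infinite_open_witness:
  fixes s e :: real
  assumes "s < e" "finite X"
  obtains t where "s < t" "t < e" "t \<notin> X"
proof -
  have "infinite {s<..<e}" using assms(1) by simp
  then have "\<exists>t\<in>{s<..<e}. t \<notin> X"
    using assms(2) by (meson finite_subset subsetI)
  then show ?thesis using that by auto
qed

text \<open>Four pieces owned by \<open>a\<close>, \<open>b\<close>, \<open>a\<close>,
  \<open>b\<close> would make the order of the two curves flip three times, in three disjoint open
  intervals. Each flip needs one of the two potential crossings strictly inside its
  interval.\<close>

lemma good_no_alternation:
  assumes "good A lo L" "A \<subseteq> U" "i < j" "j < k" "k < l" "l < length L"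
    "snd (L ! i) = a" "snd (L ! k) = a" "snd (L ! j) = b" "snd (L ! l) = b" "a \<noteq> b"
  shows False
proof -
  define X where "X = {c1 a b, c2 a b}"
  have "key (snd (L ! x)) \<le> key (snd (L ! y))" if "x < y" "y < length L" for x y
    using good_nth[OF assms(1) that(2)] that(1) by fastforce
  then have keq: "key a = key b"
    using assms(3-10) by (metis antisym less_trans)
  \<comment> \<open>An open interval minus finitely many exceptions is not empty. So each piece
    contains a parameter at which its curve is best and which is not a crossing itself.\<close>
  have pick: "\<exists>s t. s < t \<and> t < fst (L ! x) \<and> t < 1 \<and> -1 < t \<and> t \<notin> X \<and> best A (snd (L ! x)) t \<and>
      (\<forall>y<x. snd (L ! y) \<in> {a, b} \<longrightarrow> snd (L ! x) \<in> {a, b} \<longrightarrow> fst (L ! y) \<le> s)" if x: "x < length L" for x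
  proof -
    from good_nth[OF assms(1) x] obtain s where s: "-1 \<le> s" "s < fst (L ! x)" "fst (L ! x) \<le> 1"
      "finite {t. s < t \<and> t < fst (L ! x) \<and> \<not> best A (snd (L ! x)) t}"
      "\<And>y. y < x \<Longrightarrow> key (snd (L ! y)) < key (snd (L ! x)) \<or>
         key (snd (L ! y)) = key (snd (L ! x)) \<and> fst (L ! y) \<le> s"
      by blast
    have "finite (X \<union> {t. s < t \<and> t < fst (L ! x) \<and> \<not> best A (snd (L ! x)) t})"
      using s(4) by (simp add: X_def)
    from infinite_open_witness[OF s(2) this] obtain t where
      "s < t" "t < fst (L ! x)" "t \<notin> X \<union> {t. s < t \<and> t < fst (L ! x) \<and> \<not> best A (snd (L ! x)) t}"
      by blast
    moreover have "fst (L ! y) \<le> s" if "y < x" "snd (L ! y) \<in> {a, b}" "snd (L ! x) \<in> {a, b}" for y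
      using s(5)[OF that(1)] that keq by auto
    ultimately show ?thesis using s by (intro exI[of _ s] exI[of _ t]) auto
  qed
  have ab: "a \<in> A" "b \<in> A"
    using good_nth[OF assms(1), of i] good_nth[OF assms(1), of j] assms by auto
  obtain t1 where t1: "t1 < fst (L ! i)" "-1 < t1" "t1 \<notin> X" "best A a t1"
    using pick[of i] assms by auto
  have "j < length L" using assms(3-6) by auto
  from pick[OF this] obtain s2 t2 where t2': "s2 < t2" "t2 < fst (L ! j)" "t2 \<notin> X"
    "best A (snd (L ! j)) t2" "\<forall>y<j. snd (L ! y) \<in> {a, b} \<longrightarrow> snd (L ! j) \<in> {a, b} \<longrightarrow> fst (L ! y) \<le> s2"
    by blast
  then have t2: "s2 < t2" "t2 < fst (L ! j)" "t2 \<notin> X" "best A b t2" "fst (L ! i) \<le> s2"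
    using assms(3-10) by auto
  have "k < length L" using assms(3-6) by auto
  from pick[OF this] obtain s3 t3 where t3': "s3 < t3" "t3 < fst (L ! k)" "t3 \<notin> X"
    "best A (snd (L ! k)) t3" "\<forall>y<k. snd (L ! y) \<in> {a, b} \<longrightarrow> snd (L ! k) \<in> {a, b} \<longrightarrow> fst (L ! y) \<le> s3"
    by blast
  then have t3: "s3 < t3" "t3 < fst (L ! k)" "t3 \<notin> X" "best A a t3" "fst (L ! j) \<le> s3"
    using assms(3-10) by auto
  have "l < length L" using assms(3-6) by auto
  from pick[OF this] obtain s4 t4 where t4': "s4 < t4" "t4 < 1" "t4 \<notin> X"
    "best A (snd (L ! l)) t4" "\<forall>y<l. snd (L ! y) \<in> {a, b} \<longrightarrow> snd (L ! l) \<in> {a, b} \<longrightarrow> fst (L ! y) \<le> s4"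
    by blast
  then have t4: "s4 < t4" "t4 < 1" "t4 \<notin> X" "best A b t4" "fst (L ! k) \<le> s4"
    using assms(3-10) by auto
  have r: "beats F a b t1" "\<not> beats F a b t2" "beats F a b t3" "\<not> beats F a b t4"
    using t1(4) t2(4) t3(4) t4(4) ab keq \<open>a \<noteq> b\<close> not_beats[OF \<open>a \<noteq> b\<close>, of F]
    by (auto simp: best_def)
  have cross: "\<exists>c\<in>X. t < c \<and> c < t'"
    if "-1 < t" "t \<le> t'" "t' < 1" "beats F a b t \<noteq> beats F a b t'" "t \<notin> X" "t' \<notin> X" for t t'
  proof -
    have "c1 a b \<in> {t..t'} \<or> c2 a b \<in> {t..t'}"
      using uncrossed[of a b t t'] that ab assms(2) by blast
    moreover have "t \<noteq> c1 a b" "t \<noteq> c2 a b" "t' \<noteq> c1 a b" "t' \<noteq> c2 a b"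
      using that by (auto simp: X_def)
    ultimately show ?thesis
      unfolding X_def by force
  qed
  have "\<exists>c\<in>X. t1 < c \<and> c < t2" by (rule cross) (use r t1 t2 t3 t4 in auto)
  moreover have "\<exists>c\<in>X. t2 < c \<and> c < t3" by (rule cross) (use r t1 t2 t3 t4 in auto)
  moreover have "\<exists>c\<in>X. t3 < c \<and> c < t4" by (rule cross) (use r t1 t2 t3 t4 in auto)
  ultimately show False unfolding X_def by auto
qed

end

text \<open>Davenport and Schinzel: if \<open>i\<close> is not the first occurrence of its symbol, then \<open>i - 1\<close> is the
  last occurrence of its own symbol.\<close>

lemma length_no_alternation:
  assumes adj: "\<And>i. Suc i < length w \<Longrightarrow> w ! i \<noteq> w ! Suc i"
    and alt: "\<And>i j k l. i < j \<Longrightarrow> j < k \<Longrightarrow> k < l \<Longrightarrow> l < length w \<Longrightarrow>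
      w ! i = w ! k \<Longrightarrow> w ! j = w ! l \<Longrightarrow> w ! i \<noteq> w ! j \<Longrightarrow> False"
  shows "length w \<le> 2 * card (set w)"
proof -
  define first where "first i \<longleftrightarrow> (\<forall>j<i. w ! j \<noteq> w ! i)" for i
  define last where "last i \<longleftrightarrow> (\<forall>j. i < j \<longrightarrow> j < length w \<longrightarrow> w ! j \<noteq> w ! i)" for i
  let ?I = "{..<length w}"
  have "inj_on ((!) w) {i \<in> ?I. first i}"
    by (rule inj_onI) (metis (mono_tags, lifting) first_def linorder_neqE_nat mem_Collect_eq)
  then have F: "card {i \<in> ?I. first i} \<le> card (set w)"
    by (rule card_inj_on_le) auto
  have "inj_on ((!) w) {i \<in> ?I. last i}"
    by (rule inj_onI) (metis (mono_tags, lifting) last_def lessThan_iff linorder_neqE_nat mem_Collect_eq)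
  then have L: "card {i \<in> ?I. last i} \<le> card (set w)"
    by (rule card_inj_on_le) auto
  have "(\<lambda>i. i - 1) ` {i \<in> ?I. \<not> first i} \<subseteq> {i \<in> ?I. last i}"
  proof (rule image_subsetI)
    fix i assume "i \<in> {i \<in> ?I. \<not> first i}"
    then have i: "i \<in> ?I" "\<not> first i" by auto
    then obtain j where j: "j < i" "w ! j = w ! i" by (auto simp: first_def)
    then obtain k where k: "i = Suc k" by (cases i) auto
    have "w ! k \<noteq> w ! i" using adj[of k] i k by auto
    then have "j < k" using j k by (metis less_SucE)
    have "last k"
      unfolding last_def
    proof (intro allI impI notI)
      fix l assume l: "k < l" "l < length w" "w ! l = w ! k"
      have "l \<noteq> i" using l \<open>w ! k \<noteq> w ! i\<close> by auto
      then have "i < l" using l k by auto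
      then show False
        using alt[of j k i l] \<open>j < k\<close> k l j \<open>w ! k \<noteq> w ! i\<close> by auto
    qed
    then show "i - 1 \<in> {i \<in> ?I. last i}" using k i by auto
  qed
  moreover have "inj_on (\<lambda>i. i - 1) {i \<in> ?I. \<not> first i}"
  proof (rule inj_onI)
    fix x y assume "x \<in> {i \<in> ?I. \<not> first i}" "y \<in> {i \<in> ?I. \<not> first i}" "x - 1 = y - 1"
    moreover have "0 < x" if "\<not> first x" for x
      using that by (cases x) (auto simp: first_def)
    ultimately show "x = y" by (metis (mono_tags, lifting) mem_Collect_eq Suc_pred')
  qed
  ultimately have NF: "card {i \<in> ?I. \<not> first i} \<le> card {i \<in> ?I. last i}"
    by (intro card_inj_on_le[where f = "\<lambda>i. i - 1"]) auto
  have "?I = {i \<in> ?I. first i} \<union> {i \<in> ?I. \<not> first i}" by auto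
  from arg_cong[OF this, of card]
  have "card ?I = card ({i \<in> ?I. first i} \<union> {i \<in> ?I. \<not> first i})" .
  also have "\<dots> \<le> card {i \<in> ?I. first i} + card {i \<in> ?I. \<not> first i}" by (rule card_Un_le)
  finally show ?thesis using F L NF by simp
qed

section \<open>Envelopes whose neighbouring pieces belong to different curves\<close>

definition tight :: "(real \<times> nat) list \<Rightarrow> bool" where
  "tight L \<longleftrightarrow> (\<forall>i. Suc i < length L \<longrightarrow> snd (L ! i) \<noteq> snd (L ! Suc i))"

lemma tight_Nil [simp]: "tight []" and tight_single [simp]: "tight [p]"
  by (auto simp: tight_def)

lemma tight_append1:
  assumes "tight L" "L \<noteq> [] \<Longrightarrow> snd (last L) \<noteq> snd p"
  shows "tight (L @ [p])"
  unfolding tight_def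
proof (intro allI impI)
  fix i assume i: "Suc i < length (L @ [p])"
  show "snd ((L @ [p]) ! i) \<noteq> snd ((L @ [p]) ! Suc i)"
  proof (cases "Suc i < length L")
    case True
    then show ?thesis using assms(1) by (auto simp: tight_def nth_append)
  next
    case False
    then have "Suc i = length L" using i by simp
    then have "L \<noteq> []" by auto
    then have "L ! i = last L" by (simp add: last_conv_nth flip: \<open>Suc i = length L\<close>)
    then show ?thesis
      using assms(2) \<open>L \<noteq> []\<close> \<open>Suc i = length L\<close> by (auto simp: nth_append)
  qed
qed

lemma tight_butlast: "tight L \<Longrightarrow> tight (butlast L)"
  unfolding tight_def by (auto simp: nth_butlast)

lemma tight_emit:
  assumes "tight out"
  shows "tight (emit out p)"
proof (cases "out \<noteq> [] \<and> snd (last out) = snd p")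
  case True
  have "snd (last (butlast out)) \<noteq> snd p" if "butlast out \<noteq> []"
  proof -
    have l: "2 \<le> length out" using that True by (cases out; cases "tl out") auto
    then have "snd (out ! (length out - 2)) \<noteq> snd (out ! Suc (length out - 2))"
      using assms unfolding tight_def by auto
    moreover have "Suc (length out - 2) = length out - 1" using l by auto
    moreover have "last (butlast out) = out ! (length out - 2)"
      using that l by (simp add: last_conv_nth nth_butlast numeral_2_eq_2)
    moreover have "last out = out ! (length out - 1)"
      using True by (simp add: last_conv_nth)
    ultimately show ?thesis
      using True by (metis)
  qed
  then show ?thesis
    using True assms by (auto simp: emit_def intro!: tight_append1 tight_butlast)
next
  case False
  then show ?thesis
    using assms by (auto simp: emit_def intro!: tight_append1)
qed

section \<open>Size of an envelope and lookup in it\<close>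

context curves
begin

lemma good_length:
  assumes "good A lo L" "A \<subseteq> U" "finite A" "tight L"
  shows "length L \<le> 2 * card A"
proof -
  have "length (map snd L) \<le> 2 * card (set (map snd L))"
  proof (rule length_no_alternation)
    fix i assume "Suc i < length (map snd L)"
    then show "map snd L ! i \<noteq> map snd L ! Suc i"
      using assms(4) by (simp add: tight_def)
  next
    fix i j k l
    assume *: "i < j" "j < k" "k < l" "l < length (map snd L)"
      "map snd L ! i = map snd L ! k" "map snd L ! j = map snd L ! l" "map snd L ! i \<noteq> map snd L ! j"
    then have "i < length L" "j < length L" "k < length L" "l < length L" by auto
    note n = this[THEN nth_map, of snd]
    show False
      by (rule good_no_alternation[OF assms(1,2) *(1-3) \<open>l < length L\<close> refl _ refl])
        (use *(5-7) n in metis)+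
  qed
  moreover have "set (map snd L) \<subseteq> A"
    unfolding set_conv_nth using good_nth[OF assms(1)] by fastforce
  then have "card (set (map snd L)) \<le> card A"
    using assms(3) card_mono by blast
  ultimately show ?thesis by simp
qed

text \<open>The first piece of the copy of \<open>a\<close> that ends at \<open>s\<close> or later
  is optimal at \<open>s\<close>: its curve is best at all but finitely many parameters just left of
  \<open>s\<close>, and a strict violation at \<open>s\<close> would, by continuity, persist on an
  interval left of \<open>s\<close>. The case \<open>s = 1\<close> lies outside the domain of the
  curves; it serves to hit some piece of a given copy when no direction is known yet.\<close>

lemma good_lookup:
  assumes "good A lo L" "a \<in> A" "A \<subseteq> U" "-1 < s" "s \<le> 1"
    "key a = key (snd (hd L)) \<Longrightarrow> lo < s"
  shows "\<exists>i<length L. key (snd (L ! i)) = key a \<and> snd (L ! i) \<in> A \<and> s \<le> fst (L ! i) \<and>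
    (\<forall>j<i. key (snd (L ! j)) < key a \<or> key (snd (L ! j)) = key a \<and> fst (L ! j) < s) \<and>
    (s < 1 \<longrightarrow> (\<forall>b\<in>A. key b = key a \<longrightarrow> F b s \<le> F (snd (L ! i)) s))"
  using assms
proof (induction L arbitrary: A lo)
  case (Cons p L)
  obtain e v where p: "p = (e, v)" by (cases p)
  have g: "good (rest A e v) (next_lo e) L"
    and v: "v \<in> A" "\<forall>a\<in>A. key v \<le> key a" "lo < e" "-1 \<le> lo" "e \<le> 1"
    and fin: "finite {t. lo < t \<and> t < e \<and> \<not> best A v t}"
    using Cons.prems p by auto
  show ?case
  proof (cases "key a = key v \<and> s \<le> e")
    case True
    then have "lo < s" using Cons.prems(6) p by simp
    have "F b s \<le> F v s" if b: "b \<in> A" "key b = key a" and "s < 1" for b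
    proof (rule ccontr)
      assume "\<not> F b s \<le> F v s"
      then have less: "F v s < F b s" by simp
      have "continuous_on {-1<..<1} (F b)" "continuous_on {-1<..<1} (F v)"
        using continuous b v Cons.prems(3) by auto
      then have "continuous_on {-1<..<1} (\<lambda>t. F b t - F v t)"
        by (intro continuous_intros)
      then have "open ((\<lambda>t. F b t - F v t) -` {0<..} \<inter> {-1<..<1})"
        by (simp add: continuous_on_open_vimage)
      moreover have "s \<in> (\<lambda>t. F b t - F v t) -` {0<..} \<inter> {-1<..<1}"
        using less \<open>s < 1\<close> Cons.prems(4) by auto
      ultimately obtain d where d: "0 < d" "\<And>t. \<bar>t - s\<bar> < d \<Longrightarrow> F v t < F b t"
        unfolding open_dist by (force simp: dist_real_def)
      have "max lo (s - d) < s" using d \<open>lo < s\<close> by simp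
      from infinite_open_witness[OF this fin] obtain t where
        t: "max lo (s - d) < t" "t < s" "t \<notin> {t. lo < t \<and> t < e \<and> \<not> best A v t}" by blast
      then have "best A v t" using True by auto
      then have "b = v \<or> beats F v b t" using b True by (auto simp: best_def)
      moreover have "F v t < F b t" using d(2)[of t] t by auto
      ultimately show False by (auto simp: beats_def)
    qed
    then show ?thesis using True p v by (intro exI[of _ 0]) auto
  next
    case False
    have "key v \<le> key a" using v Cons.prems by auto
    have a: "a \<in> rest A e v" "key a = key (snd (hd L)) \<Longrightarrow> next_lo e < s"
      "key v < key a \<or> key v = key a \<and> e < s"
    proof -
      \<comment> \<open>If \<open>e = 1\<close>, then \<open>s \<le> e\<close>, so a curve with the
        key of \<open>v\<close> would have been treated in the first case.\<close>
      have ne: "e \<noteq> 1" if "\<not> key v < key a"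
        using False that \<open>key v \<le> key a\<close> Cons.prems(5) by auto
      then show "a \<in> rest A e v"
        using Cons.prems(2) by (auto simp: rest_def)
      show *: "key v < key a \<or> key v = key a \<and> e < s"
        using False \<open>key v \<le> key a\<close> by auto
      show "next_lo e < s" if "key a = key (snd (hd L))"
      proof (cases "e = 1")
        case True
        then show ?thesis using Cons.prems(4) by (simp add: next_lo_def)
      next
        case False
        then have "good A e L" using g by (simp add: rest_def next_lo_def)
        from good_head_key[OF this v(1,2)] show ?thesis
          using that * False by (auto simp: next_lo_def)
      qed
    qed
    have sub: "rest A e v \<subseteq> A" by (auto simp: rest_def)
    from Cons.IH[OF g a(1) order_trans[OF sub Cons.prems(3)] Cons.prems(4,5) a(2)] obtain i where
      i: "i < length L" "key (snd (L ! i)) = key a" "snd (L ! i) \<in> rest A e v" "s \<le> fst (L ! i)"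
      "\<forall>j<i. key (snd (L ! j)) < key a \<or> key (snd (L ! j)) = key a \<and> fst (L ! j) < s"
      "s < 1 \<longrightarrow> (\<forall>b\<in>rest A e v. key b = key a \<longrightarrow> F b s \<le> F (snd (L ! i)) s)"
      by blast
    have "b \<in> rest A e v" if "b \<in> A" "key b = key a" for b
      using a(1) that by (auto simp: rest_def split: if_splits)
    moreover have "\<forall>j<Suc i. key (snd ((p # L) ! j)) < key a \<or>
        key (snd ((p # L) ! j)) = key a \<and> fst ((p # L) ! j) < s"
      using i(5) a(3) p by (auto simp: less_Suc_eq_0_disj)
    ultimately show ?thesis
      using i sub by (intro exI[of _ "Suc i"]) auto
  qed
qed simp

lemma good_sorted:
  assumes "good A lo L" "j < i" "i < length L"
  shows "key (snd (L ! j)) < key (snd (L ! i)) \<or>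
    key (snd (L ! j)) = key (snd (L ! i)) \<and> fst (L ! j) < fst (L ! i)"
  using good_nth[OF assms(1,3)] assms(2) by force

section \<open>Merging two envelopes, as a function on lists\<close>

definition winner :: "nat \<Rightarrow> nat \<Rightarrow> real \<Rightarrow> nat" where
  "winner v w t = (if F v t < F w t \<or> \<not> F w t < F v t \<and> w < v then w else v)"

text \<open>The next event of the sweep: the smallest among \<open>h\<close> and those potential
  crossings that lie to the right of \<open>lo\<close>. The two successive tests have the form in
  which the program performs them.\<close>

definition stop :: "nat \<Rightarrow> nat \<Rightarrow> real \<Rightarrow> real \<Rightarrow> real" where
  "stop v w lo h = (let h1 = if lo < c1 v w \<and> c1 v w < h then c1 v w else h in
     if lo < c2 v w \<and> c2 v w < h1 then c2 v w else h1)"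

text \<open>The copy at the head of \<open>xs\<close> comes strictly before everything in
  \<open>ys\<close>, so the head of \<open>xs\<close> can be output unchanged.\<close>

definition front :: "(real \<times> nat) list \<Rightarrow> (real \<times> nat) list \<Rightarrow> bool" where
  "front xs ys \<longleftrightarrow> xs \<noteq> [] \<and> (ys = [] \<or> key (snd (hd xs)) < key (snd (hd ys)))"

text \<open>If both heads lie in the same copy, the sweep advances to the next event
  \<open>h\<close>. No crossing lies strictly between \<open>lo\<close> and \<open>h\<close>, so the
  comparison at the midpoint decides for the whole interval.\<close>

definition merge_step ::
    "(real \<times> nat) list \<Rightarrow> (real \<times> nat) list \<Rightarrow> real \<Rightarrow>
     (real \<times> nat) \<times> (real \<times> nat) list \<times> (real \<times> nat) list" where
  "merge_step xs ys lo =
     (if front xs ys then (hd xs, tl xs, ys)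
      else if front ys xs then (hd ys, xs, tl ys)
      else (let e = fst (hd xs); e' = fst (hd ys); v = snd (hd xs); w = snd (hd ys);
                h = stop v w lo (if e' < e then e' else e)
            in ((h, winner v w ((lo + h) / 2)), if h < e then xs else tl xs, if h < e' then ys else tl ys)))"

text \<open>\<open>lo\<close> is the position of the sweep in the foremost copy. A list that has not
  yet reached this copy is still at the left end -1 of its own first copy.\<close>

definition merging :: "nat set \<Rightarrow> nat set \<Rightarrow> (real \<times> nat) list \<Rightarrow> (real \<times> nat) list \<Rightarrow> real \<Rightarrow> bool" where
  "merging A B xs ys lo \<longleftrightarrow> A \<subseteq> U \<and> B \<subseteq> U \<and>
     good A (if front ys xs then -1 else lo) xs \<and> good B (if front xs ys then -1 else lo) ys"

text \<open>The potential of the merge: a step either consumes a piece or passes a crossing of the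
  two current heads. Consuming a piece changes the pair of heads and may bring up two new crossings,
  so a piece has to weigh 3.\<close>

definition effort :: "(real \<times> nat) list \<Rightarrow> (real \<times> nat) list \<Rightarrow> real \<Rightarrow> nat" where
  "effort xs ys lo = 3 * (length xs + length ys) + (if xs = [] \<or> ys = [] then 0
     else card {c \<in> {c1 (snd (hd xs)) (snd (hd ys)), c2 (snd (hd xs)) (snd (hd ys))}. lo < c})"

lemma effort_le: "effort xs ys lo \<le> 3 * (length xs + length ys) + 2"
proof -
  have "card {c \<in> {x, y :: real}. lo < c} \<le> 2" for x y
    using card_mono[of "{x, y}" "{c \<in> {x, y}. lo < c}"] card_insert_le_m1[of 2 "{y}" x]
    by (auto intro: order_trans)
  then show ?thesis by (auto simp: effort_def)
qed

lemma effort_less: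
  assumes "length xs' + length ys' < length xs + length ys"
  shows "effort xs' ys' lo' < effort xs ys lo"
  using effort_le[of xs' ys' lo'] assms by (simp add: effort_def)

lemma good_copy:
  assumes "front xs ys" "good A lo xs" "good B (-1) ys" "A \<subseteq> U" "B \<subseteq> U" "hd xs = (e, v)"
  shows "merging (rest A e v) B (tl xs) ys (next_lo e) \<and>
    (\<forall>L. good (rest A e v \<union> B) (next_lo e) L \<longrightarrow> good (A \<union> B) lo (hd xs # L))"
proof -
  have xs: "xs = (e, v) # tl xs" using assms(1,6) by (cases xs) (auto simp: front_def)
  have g: "v \<in> A" "\<forall>a\<in>A. key v \<le> key a" "-1 \<le> lo" "lo < e" "e \<le> 1"
    "finite {t. lo < t \<and> t < e \<and> \<not> best A v t}" "good (rest A e v) (next_lo e) (tl xs)"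
    using assms(2) by (subst (asm) xs; simp)+
  have B: "key v < key b" if "b \<in> B" for b
  proof (cases ys)
    case Nil
    then show ?thesis using assms(3) that by simp
  next
    case (Cons q ys')
    then have "key (snd q) \<le> key b" using assms(3) that by (cases q) auto
    then show ?thesis using assms(1,6) Cons by (auto simp: front_def)
  qed
  have fr: "\<not> front ys (tl xs)" "front (tl xs) ys" if "e \<noteq> 1"
  proof -
    have "good A e (tl xs)" using g(7) that by (simp add: rest_def next_lo_def)
    from good_head_key[OF this g(1,2)] have
      *: "tl xs \<noteq> []" "key (snd (hd (tl xs))) = key v" by auto
    then show "\<not> front ys (tl xs)" "front (tl xs) ys"
      using assms(1,6) by (auto simp: front_def)
  qed
  have "merging (rest A e v) B (tl xs) ys (next_lo e)"
  \<comment> \<open>At \<open>e = 1\<close> the next position is -1 for both lists, whichever of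
    them is in front. Otherwise \<open>xs\<close> continues in the same copy and stays in
    front.\<close>
  proof (cases "e = 1")
    case True
    then have n: "next_lo e = -1" by (simp add: next_lo_def)
    show ?thesis
      unfolding merging_def n if_cancel
      using g(7)[unfolded n] assms(3-5) rest_subset by blast
  next
    case False
    show ?thesis
      unfolding merging_def using fr[OF False] g(7) assms(3-5) rest_subset by (simp; blast)
  qed
  moreover have "good (A \<union> B) lo (hd xs # L)" if L: "good (rest A e v \<union> B) (next_lo e) L" for L
  proof -
    have "rest (A \<union> B) e v = rest A e v \<union> B" using B by (auto simp: rest_def)
    moreover have "best (A \<union> B) v t = best A v t" for t
      unfolding best_def using B by (metis Un_iff less_irrefl)
    ultimately show ?thesis using L g B assms(6) by (auto simp: less_imp_le)
  qed
  ultimately show ?thesis by blast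
qed

lemma merging_sym: "merging A B xs ys lo \<longleftrightarrow> merging B A ys xs lo"
  by (auto simp: merging_def)

lemma stop_props:
  assumes "lo < h" "h \<le> 1"
  shows "lo < stop v w lo h" "stop v w lo h \<le> h"
    "lo < c1 v w \<Longrightarrow> \<not> c1 v w < stop v w lo h" "lo < c2 v w \<Longrightarrow> \<not> c2 v w < stop v w lo h"
    "stop v w lo h < h \<Longrightarrow> stop v w lo h \<in> {c1 v w, c2 v w}"
  using assms by (auto simp: stop_def Let_def split: if_splits)

lemma good_advance:
  assumes "good A lo ((e, v) # xs)" "lo < h" "h \<le> e"
  shows "good (rest A h v) (next_lo h) (if h < e then (e, v) # xs else xs)"
proof (cases "h < e")
  case True
  then have "h \<noteq> 1" using assms by auto
  then show ?thesis
    using good_raise[of A lo e v xs h] True assms by (simp add: rest_def next_lo_def)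
next
  case False
  then show ?thesis using assms by auto
qed

text \<open>Each input is optimal for its own curves up to finitely many parameters, and one of the
  two heads beats the other throughout the interval from \<open>lo\<close> to \<open>h\<close>. By
  transitivity this head beats the curves of both sets, except at the finitely many exceptions of
  either input.\<close>

lemma good_both:
  assumes "good A lo ((e, v) # xs)" "good B lo ((e', w) # ys)" "A \<subseteq> U" "B \<subseteq> U" "key v = key w"
    and h: "h = stop v w lo (if e' < e then e' else e)" and u: "u = winner v w ((lo + h) / 2)"
  shows "merging (rest A h v) (rest B h w)
      (if h < e then (e, v) # xs else xs) (if h < e' then (e', w) # ys else ys) (next_lo h)"
    and "good (rest A h v \<union> rest B h w) (next_lo h) L \<Longrightarrow> good (A \<union> B) lo ((h, u) # L)"
proof -
  let ?xs = "if h < e then (e, v) # xs else xs" and ?ys = "if h < e' then (e', w) # ys else ys"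
  have g: "v \<in> A" "\<forall>a\<in>A. key v \<le> key a" "-1 \<le> lo" "lo < e" "e \<le> 1"
    "finite {t. lo < t \<and> t < e \<and> \<not> best A v t}"
    "w \<in> B" "\<forall>a\<in>B. key w \<le> key a" "lo < e'" "e' \<le> 1"
    "finite {t. lo < t \<and> t < e' \<and> \<not> best B w t}"
    using assms(1,2) by auto
  define m where "m = (if e' < e then e' else e)"
  have m: "lo < m" "m \<le> 1" "m \<le> e" "m \<le> e'" using g by (auto simp: m_def)
  note st = stop_props[OF m(1,2), of v w, folded m_def h[folded m_def]]
  have he: "h \<le> e" "h \<le> e'" "lo < h" "h \<le> 1" using st m by auto
  have G: "good (rest A h v) (next_lo h) ?xs" "good (rest B h w) (next_lo h) ?ys"
    using good_advance assms(1,2) he by blast+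
  have fr: "\<not> front ?xs ?ys" "\<not> front ?ys ?xs" if "h \<noteq> 1"
  proof -
    have "good A h ?xs" "good B h ?ys"
      using G that by (simp_all add: rest_def next_lo_def)
    then have "?xs \<noteq> [] \<and> key (snd (hd ?xs)) = key v" "?ys \<noteq> [] \<and> key (snd (hd ?ys)) = key w"
      using good_head_key g by blast+
    then show "\<not> front ?xs ?ys" "\<not> front ?ys ?xs"
      unfolding front_def using assms(5) by force+
  qed
  show "merging (rest A h v) (rest B h w) ?xs ?ys (next_lo h)"
  proof (cases "h = 1")
    case True
    then have n: "next_lo h = -1" by (simp add: next_lo_def)
    show ?thesis
      unfolding merging_def n if_cancel
      using G[unfolded n] assms(3,4) rest_subset by blast
  next
    case False
    from fr[OF this] show ?thesis
      unfolding merging_def using G assms(3,4) rest_subset by (simp; blast)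
  qed
  assume L: "good (rest A h v \<union> rest B h w) (next_lo h) L"
  \<comment> \<open>\<open>x\<close> is the head that loses; every curve of the copy is a head or
    beaten by one, and \<open>x\<close> itself is \<open>u\<close> or beaten by
    \<open>u\<close>.\<close>
  define x where "x = (if u = v then w else v)"
  have uv: "u = v \<and> x = w \<or> u = w \<and> x = v" by (auto simp: u winner_def x_def)
  have uk: "key u = key v" "key x = key v" using uv assms(5) by auto
  have win: "u = x \<or> beats F u x t" if t: "lo < t" "t < h" for t
  proof (cases "v = w")
    case True
    then show ?thesis using uv by auto
  next
    case False
    define mm where "mm = (lo + h) / 2"
    have mm: "lo < mm" "mm < h" using he by (auto simp: mm_def)
    have no: "c1 v w \<notin> {p..q}" "c2 v w \<notin> {p..q}" if "lo < p" "q < h" for p q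
      using st(3,4) that by auto
    have "beats F v w t = beats F v w mm"
    proof (cases "t \<le> mm")
      case True
      show ?thesis
        by (rule uncrossed) (use assms(3,4) g True t mm he no[of t mm] in auto)
    next
      case False
      show ?thesis
        by (rule uncrossed[symmetric]) (use assms(3,4) g False t mm he no[of mm t] in auto)
    qed
    moreover have "u = (if beats F v w mm then v else w)"
      using False unfolding u winner_def beats_def mm_def by auto
    ultimately show ?thesis
      using not_beats[OF False] not_beats[OF False[symmetric]] uv by auto
  qed
  have "best (A \<union> B) u t" if t: "lo < t" "t < h" "best A v t" "best B w t" for t
    unfolding best_def
  proof (intro ballI impI)
    fix b assume b: "b \<in> A \<union> B" "key b = key u"
    then have "b = u \<or> beats F u b t \<or> b = x \<or> beats F x b t"
      using t(3,4) uv assms(5) by (auto simp: best_def)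
    then show "b = u \<or> beats F u b t"
      using win[OF t(1,2)] beats_trans by metis
  qed
  then have "{t. lo < t \<and> t < h \<and> \<not> best (A \<union> B) u t} \<subseteq>
      {t. lo < t \<and> t < e \<and> \<not> best A v t} \<union> {t. lo < t \<and> t < e' \<and> \<not> best B w t}"
    using he by auto
  then have "finite {t. lo < t \<and> t < h \<and> \<not> best (A \<union> B) u t}"
    by (rule finite_subset) (use g in auto)
  moreover have "rest (A \<union> B) h u = rest A h v \<union> rest B h w"
    using uk assms(5) by (auto simp: rest_def)
  moreover have "u \<in> A \<union> B" using uv g by auto
  ultimately show "good (A \<union> B) lo ((h, u) # L)"
    using L uk g he assms(5) by auto
qed

text \<open>The tail \<open>L\<close> is arbitrary so that a loop invariant can say: the output so
  far, followed by any envelope of what remains, is an envelope of the whole. \<open>A'\<close> and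
  \<open>B'\<close> are the curves that still matter after the piece \<open>p\<close>.\<close>

lemma merge_step:
  assumes "merging A B xs ys lo" "xs \<noteq> [] \<or> ys \<noteq> []" "merge_step xs ys lo = (p, xs', ys')"
  obtains A' B' where "merging A' B' xs' ys' (next_lo (fst p))"
    "\<And>L. good (A' \<union> B') (next_lo (fst p)) L \<Longrightarrow> good (A \<union> B) lo (p # L)"
    "effort xs' ys' (next_lo (fst p)) < effort xs ys lo"
proof -
  consider (x) "front xs ys" | (y) "front ys xs" "\<not> front xs ys" | (b) "\<not> front xs ys" "\<not> front ys xs"
    by blast
  then show thesis
  proof cases
    case x
    then have *: "p = hd xs" "xs' = tl xs" "ys' = ys" using assms(3) by (auto simp: merge_step_def)
    have "\<not> front ys xs" using x by (auto simp: front_def)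
    then have "good A lo xs" "good B (-1) ys" "A \<subseteq> U" "B \<subseteq> U"
      using assms(1) x by (auto simp: merging_def)
    moreover have "length xs' + length ys' < length xs + length ys"
      using * x by (cases xs) (auto simp: front_def)
    ultimately show ?thesis
      using that[of "rest A (fst p) (snd p)" B] good_copy[OF x, of A lo B "fst p" "snd p"] *
      by (simp add: effort_less)
  next
    case y
    then have *: "p = hd ys" "xs' = xs" "ys' = tl ys" using assms(3) by (auto simp: merge_step_def)
    have "good B lo ys" "good A (-1) xs" "A \<subseteq> U" "B \<subseteq> U"
      using assms(1) y by (auto simp: merging_def)
    moreover have "length xs' + length ys' < length xs + length ys"
      using * y by (cases ys) (auto simp: front_def)
    ultimately show ?thesis
      using that[of A "rest B (fst p) (snd p)"] good_copy[OF y(1), of B lo A "fst p" "snd p"] *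
      by (simp add: effort_less merging_sym[of A] Un_commute[of A])
  next
    case b
    then have ne: "xs \<noteq> []" "ys \<noteq> []" using assms(2) by (auto simp: front_def)
    obtain e v xt where xs: "xs = (e, v) # xt" using ne by (metis list.exhaust prod.exhaust)
    obtain e' w yt where ys: "ys = (e', w) # yt" using ne by (metis list.exhaust prod.exhaust)
    have k: "key v = key w" using b by (auto simp: front_def xs ys)
    have G: "good A lo ((e, v) # xt)" "good B lo ((e', w) # yt)" and AB: "A \<subseteq> U" "B \<subseteq> U"
      using assms(1) b by (auto simp: merging_def xs ys)
    define h where "h = stop v w lo (if e' < e then e' else e)"
    define u where "u = winner v w ((lo + h) / 2)"
    have *: "p = (h, u)" "xs' = (if h < e then xs else xt)" "ys' = (if h < e' then ys else yt)"
      using assms(3) b by (auto simp: merge_step_def h_def u_def xs ys Let_def)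
    note gb = good_both[OF G AB k h_def u_def]
    have m: "lo < (if e' < e then e' else e)" "(if e' < e then e' else e) \<le> 1"
      using G by auto
    note st = stop_props[OF m, of v w, folded h_def]
    have "effort xs' ys' (next_lo h) < effort xs ys lo"
    proof (cases "h < e \<and> h < e'")
      case True
      \<comment> \<open>No piece is consumed, so the sweep stopped at a crossing, and this crossing
        drops out of the count.\<close>
      then have hc: "h \<in> {c1 v w, c2 v w}" using st(5) by auto
      have "h \<noteq> 1" using True G by auto
      then have n: "next_lo h = h" by (simp add: next_lo_def)
      have "card {c \<in> {c1 v w, c2 v w}. h < c} < card {c \<in> {c1 v w, c2 v w}. lo < c}"
        by (rule psubset_card_mono) (use hc st(1) in auto)
      then show ?thesis using True * n by (simp add: effort_def xs ys)
    next
      case False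
      then have "length xs' + length ys' < length xs + length ys"
        using * xs ys by auto
      then show ?thesis by (rule effort_less)
    qed
    then show ?thesis
      using that[of "rest A h v" "rest B h w"] gb * xs ys by auto
  qed
qed

lemma good_single: "good {v} (-1) [(1, v)]"
  by (auto simp: rest_def next_lo_def best_def)

end


section \<open>Discs around a common point in polar coordinates\<close>

text \<open>For a disc with center \<open>(x, y)\<close> and radius \<open>r\<close> that contains the origin in its interior, and for
  \<open>w = r\<^sup>2 - x\<^sup>2 - y\<^sup>2\<close>, the ray in direction \<open>(s, sqrt (1 - s\<^sup>2))\<close> leaves the disc at distance
  \<open>extent x y w s\<close>.\<close>

definition extent :: "real \<Rightarrow> real \<Rightarrow> real \<Rightarrow> real \<Rightarrow> real" where
  "extent x y w s = s * x + sqrt (1 - s * s) * y +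
     sqrt ((s * x + sqrt (1 - s * s) * y) * (s * x + sqrt (1 - s * s) * y) + w)"

text \<open>With \<open>b\<close> the scalar product of direction and center, the ray meets the
  circle at the roots of \<open>m * m - 2 * m * b - w\<close>. Their product is \<open>- w\<close>,
  so exactly one of them is positive, and it is the one with the plus sign.\<close>

lemma extent_quadratic:
  assumes "0 < w" "b = s * x + sqrt (1 - s * s) * y"
  shows "extent x y w s * extent x y w s = 2 * extent x y w s * b + w" "0 < extent x y w s"
proof -
  have p: "0 \<le> b * b + w" using assms(1) by (simp add: add_nonneg_nonneg less_imp_le)
  then have q: "sqrt (b * b + w) * sqrt (b * b + w) = b * b + w" by simp
  have e: "extent x y w s = b + sqrt (b * b + w)"
    by (simp add: extent_def assms(2))
  show "extent x y w s * extent x y w s = 2 * extent x y w s * b + w"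
    unfolding e using q by algebra
  have "\<bar>b\<bar> < sqrt (b * b + w)"
    using assms(1) by (intro real_less_rsqrt) (simp add: power2_eq_square)
  then show "0 < extent x y w s"
    unfolding e by linarith
qed

text \<open>Squared distance minus squared radius, at distance \<open>d\<close> along the ray,
  factors over the two roots as \<open>(d - m) * (d + m - 2 * b)\<close>. The second root
  \<open>2 * b - m\<close> is negative, so only the sign of \<open>d - m\<close> counts.\<close>

lemma in_disc_iff_extent:
  assumes w: "0 < w" "w = r * r - x * x - y * y" and s: "s * s \<le> 1" and d: "0 \<le> d"
  shows "(d * s - x) * (d * s - x) + (d * sqrt (1 - s * s) - y) * (d * sqrt (1 - s * s) - y) \<le> r * r
    \<longleftrightarrow> d \<le> extent x y w s"
proof -
  define c where "c = sqrt (1 - s * s)"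
  define b where "b = s * x + c * y"
  define m where "m = extent x y w s"
  have c: "c * c = 1 - s * s" using s by (simp add: c_def)
  have m: "m * m = 2 * m * b + w" "0 < m"
    using extent_quadratic[OF w(1), of b s x y] by (auto simp: m_def b_def c_def)
  have "(d * s - x) * (d * s - x) + (d * c - y) * (d * c - y) - r * r = d * d * (s * s + c * c) - 2 * d * b - w"
    by (simp add: w(2) b_def algebra_simps)
  also have "\<dots> = d * d - 2 * d * b - w" using c by simp
  also have "w = m * m - 2 * m * b" using m by simp
  also have "d * d - 2 * d * b - (m * m - 2 * m * b) = (d - m) * (d + m - 2 * b)"
    by (simp add: algebra_simps)
  finally have e: "(d * s - x) * (d * s - x) + (d * c - y) * (d * c - y) - r * r = (d - m) * (d + m - 2 * b)" .
  have "m * (m - 2 * b) = w" using m(1) by (simp add: algebra_simps)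
  then have "0 < m - 2 * b" using w(1) m(2) by (metis zero_less_mult_pos)
  then have "0 < d + m - 2 * b" using d by simp
  then have "(d - m) * (d + m - 2 * b) \<le> 0 \<longleftrightarrow> d \<le> m"
    by (simp add: mult_le_0_iff)
  then have "(d * s - x) * (d * s - x) + (d * c - y) * (d * c - y) - r * r \<le> 0 \<longleftrightarrow> d \<le> m"
    unfolding e .
  then show ?thesis unfolding c_def m_def by linarith
qed

text \<open>Put \<open>d = w - w'\<close>, \<open>b = s * x + c * y\<close> and
  \<open>e = s * (x - x') + c * (y - y')\<close>. Then \<open>qa\<close>, \<open>qb\<close>,
  \<open>qc\<close> are the coefficients of \<open>s * s\<close>, \<open>s * c\<close>,
  \<open>c * c\<close> in the quadratic form
  \<open>d * d * (s * s + c * c) + 4 * d * e * b - 4 * w * e * e\<close>, which vanishes where the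
  two extents agree.\<close>

definition qa :: "real \<Rightarrow> real \<Rightarrow> real \<Rightarrow> real \<Rightarrow> real \<Rightarrow> real \<Rightarrow> real" where
  "qa x y w x' y' w' = (w - w') * (w - w') + 4 * ((w - w') * (x - x') * x - w * (x - x') * (x - x'))"

definition qb :: "real \<Rightarrow> real \<Rightarrow> real \<Rightarrow> real \<Rightarrow> real \<Rightarrow> real \<Rightarrow> real" where
  "qb x y w x' y' w' = 4 * ((w - w') * ((x - x') * y + (y - y') * x) - 2 * w * (x - x') * (y - y'))"

definition qc :: "real \<Rightarrow> real \<Rightarrow> real \<Rightarrow> real \<Rightarrow> real \<Rightarrow> real \<Rightarrow> real" where
  "qc x y w x' y' w' = (w - w') * (w - w') + 4 * ((w - w') * (y - y') * y - w * (y - y') * (y - y'))"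

text \<open>The common extent \<open>m\<close> satisfies \<open>m * m = 2 * m * b + w\<close> and
  the same equation for the other disc. Their difference is linear in \<open>m\<close>, namely
  \<open>2 * m * e = - d\<close>; eliminating \<open>m\<close> leaves a condition on the direction
  alone. Having degree 2, it admits at most two directions with positive \<open>c\<close>, unless it
  vanishes identically.\<close>

lemma extent_eq_imp_root:
  assumes "0 < w" "0 < w'" "s * s \<le> 1" "extent x y w s = extent x' y' w' s" "c = sqrt (1 - s * s)"
  shows "qa x y w x' y' w' * (s * s) + qb x y w x' y' w' * (s * c) + qc x y w x' y' w' * (c * c) = 0"
proof -
  define b where "b = s * x + c * y"
  define b' where "b' = s * x' + c * y'"
  define m where "m = extent x y w s"
  have 1: "m * m = 2 * m * b + w" "m * m = 2 * m * b' + w'"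
    using extent_quadratic[OF assms(1), of b s x y] extent_quadratic[OF assms(2), of b' s x' y'] assms(4,5)
    by (auto simp: m_def b_def b'_def)
  define e where "e = b - b'"
  define d where "d = w - w'"
  have 2: "2 * m * e = - d" using 1 by (simp add: e_def d_def algebra_simps)
  have cc: "s * s + c * c = 1" using assms(3,5) by simp
  have "d * d * (s * s + c * c) + 4 * d * e * b - 4 * w * e * e =
      (2 * m * e) * (2 * m * e) - 4 * (2 * m * e) * e * b - 4 * w * e * e"
    by (simp add: 2 cc)
  also have "\<dots> = 4 * e * e * (m * m - 2 * m * b - w)"
    by (simp add: algebra_simps)
  also have "\<dots> = 0" using 1 by simp
  finally have "d * d * (s * s + c * c) + 4 * d * e * b - 4 * w * e * e = 0" .
  moreover have "e = s * (x - x') + c * (y - y')" by (simp add: e_def b_def b'_def algebra_simps)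
  moreover have "d * d * (s * s + c * c) + 4 * d * (s * (x - x') + c * (y - y')) * (s * x + c * y) -
      4 * w * (s * (x - x') + c * (y - y')) * (s * (x - x') + c * (y - y')) =
    qa x y w x' y' w' * (s * s) + qb x y w x' y' w' * (s * c) + qc x y w x' y' w' * (c * c)"
    unfolding qa_def qb_def qc_def d_def by algebra
  ultimately show ?thesis by (simp add: b_def)
qed

text \<open>The degenerate case: if the form vanishes identically, it yields no cuts, but then the
  two discs coincide and so do the curves.\<close>

lemma no_quadratic_imp_same:
  assumes "0 < w" "qa x y w x' y' w' = 0" "qb x y w x' y' w' = 0" "qc x y w x' y' w' = 0"
  shows "x = x' \<and> y = y' \<and> w = w'"
proof -
  define a b d where "a = x - x'" and "b = y - y'" and "d = w - w'"
  have 1: "d * d + 4 * (d * a * x - w * a * a) = 0" "d * (a * y + b * x) - 2 * w * a * b = 0"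
    "d * d + 4 * (d * b * y - w * b * b) = 0"
    using assms(2-4) by (simp_all add: qa_def qb_def qc_def a_def b_def d_def)
  \<comment> \<open>\<open>b * b\<close> times the first equation plus \<open>a * a\<close> times
    the third, minus \<open>4 * a * b\<close> times the second.\<close>
  have "d * d * (a * a + b * b) = 0"
    using 1 by algebra
  then have "d = 0 \<or> a = 0 \<and> b = 0"
    by (simp add: sum_squares_eq_zero_iff)
  then have "d = 0" using 1(1) by auto
  then have "w * (a * a) = 0" "w * (b * b) = 0" using 1(1,3) by (auto simp: algebra_simps)
  then show ?thesis using assms(1) \<open>d = 0\<close> by (simp add: a_def b_def d_def)
qed

text \<open>In \<open>root1\<close> and \<open>root2\<close>, division by 0 and roots of negative numbers yield junk values, which do no
  harm, because superfluous cuts are harmless.\<close>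

definition root1 :: "real \<Rightarrow> real \<Rightarrow> real \<Rightarrow> real" where
  "root1 a b c = (if a = 0 then (0 - c) / b else (sqrt (b * b - 4 * (a * c)) - b) / (2 * a))"

definition root2 :: "real \<Rightarrow> real \<Rightarrow> real \<Rightarrow> real" where
  "root2 a b c = (if a = 0 then (0 - c) / b else (0 - sqrt (b * b - 4 * (a * c)) - b) / (2 * a))"

text \<open>The sine of the angle with tangent \<open>t\<close>. Division by \<open>c * c\<close>
  turns the homogeneous form into a quadratic polynomial in the tangent \<open>t = s / c\<close>,
  and this function goes back to the parameter of the curves.\<close>

definition sine_of :: "real \<Rightarrow> real" where
  "sine_of t = t / sqrt (1 + t * t)"

lemma quadratic_root:
  assumes "a * (t * t) + b * t + c = 0" "a \<noteq> 0 \<or> b \<noteq> 0 \<or> c \<noteq> 0"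
  shows "t = root1 a b c \<or> t = root2 a b c"
proof (cases "a = 0")
  case True
  then have "b \<noteq> 0" using assms by auto
  then show ?thesis using assms True by (simp add: root1_def field_simps add_eq_0_iff)
next
  case False
  have "(2 * a * t + b) * (2 * a * t + b) = b * b - 4 * (a * c)"
    using assms(1) by algebra
  then have "\<bar>2 * a * t + b\<bar> = sqrt (b * b - 4 * (a * c))"
    by (metis real_sqrt_mult_self real_sqrt_mult)
  then have "2 * a * t + b = sqrt (b * b - 4 * (a * c)) \<or> 2 * a * t + b = - sqrt (b * b - 4 * (a * c))"
    by linarith
  then show ?thesis
    using False by (auto simp: root1_def root2_def field_simps)
qed

lemma homogeneous_root:
  assumes "a * (s * s) + b * (s * c) + d * (c * c) = 0" "c = sqrt (1 - s * s)" "s * s < 1"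
    "a \<noteq> 0 \<or> b \<noteq> 0 \<or> d \<noteq> 0"
  shows "s = sine_of (root1 a b d) \<or> s = sine_of (root2 a b d)"
proof -
  define t where "t = s / c"
  have c: "0 < c" "c * c = 1 - s * s" using assms(2,3) by auto
  have s: "s = t * c" using c by (simp add: t_def)
  have "(a * (t * t) + b * t + d) * (c * c) = 0"
    using assms(1) unfolding s by algebra
  then have "a * (t * t) + b * t + d = 0" using c(1) by simp
  from quadratic_root[OF this assms(4)] have "t = root1 a b d \<or> t = root2 a b d" .
  moreover have "s = sine_of t"
  proof -
    have "(1 + t * t) * (c * c) = 1" using c(2) s by algebra
    then have "1 + t * t = 1 / (c * c)" using c(1) by (simp add: field_simps)
    then have "sqrt (1 + t * t) = 1 / c" using c(1) by (simp add: real_sqrt_divide)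
    then show ?thesis using c(1) s by (simp add: sine_of_def)
  qed
  ultimately show ?thesis by blast
qed

definition cut1 :: "real \<Rightarrow> real \<Rightarrow> real \<Rightarrow> real \<Rightarrow> real \<Rightarrow> real \<Rightarrow> real" where
  "cut1 x y w x' y' w' = sine_of (root1 (qa x y w x' y' w') (qb x y w x' y' w') (qc x y w x' y' w'))"

definition cut2 :: "real \<Rightarrow> real \<Rightarrow> real \<Rightarrow> real \<Rightarrow> real \<Rightarrow> real \<Rightarrow> real" where
  "cut2 x y w x' y' w' = sine_of (root2 (qa x y w x' y' w') (qb x y w x' y' w') (qc x y w x' y' w'))"

lemma continuous_on_extent: "continuous_on S (extent x y w)"
  unfolding extent_def by (intro continuous_intros)

text \<open>If the order of two curves changed between \<open>t\<close> and \<open>t'\<close>, their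
  difference would have a zero in between by the intermediate value theorem, and every zero is one
  of the two cuts. For coinciding discs the order is decided by the index and never changes.\<close>

lemma curves_extent:
  fixes key :: "nat \<Rightarrow> 'k::linorder"
  assumes "\<And>v. v \<in> U \<Longrightarrow> 0 < w v"
  shows "curves (\<lambda>v. extent (x v) (y v) (w v))
    (\<lambda>u v. cut1 (x u) (y u) (w u) (x v) (y v) (w v))
    (\<lambda>u v. cut2 (x u) (y u) (w u) (x v) (y v) (w v)) U"
proof
  fix a assume "a \<in> U"
  show "continuous_on {-1<..<1} (extent (x a) (y a) (w a))" by (rule continuous_on_extent)
next
  fix a b t t' assume ab: "a \<in> U" "b \<in> U" and t: "-1 < t" "t \<le> t'" "t' < (1::real)"
    and no: "cut1 (x a) (y a) (w a) (x b) (y b) (w b) \<notin> {t..t'}" "cut2 (x a) (y a) (w a) (x b) (y b) (w b) \<notin> {t..t'}"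
  define f where "f s = extent (x a) (y a) (w a) s - extent (x b) (y b) (w b) s" for s
  show "beats (\<lambda>v. extent (x v) (y v) (w v)) a b t = beats (\<lambda>v. extent (x v) (y v) (w v)) a b t'"
  proof (cases "x a = x b \<and> y a = y b \<and> w a = w b")
    case True
    then show ?thesis by (simp add: beats_def)
  next
    case False
    have nz: "f s \<noteq> 0" if "s \<in> {t..t'}" for s
    proof
      assume "f s = 0"
      have "\<bar>s\<bar> < 1" using that t by auto
      then have s: "s * s < 1" by (simp add: abs_square_less_1 flip: power2_eq_square)
      from extent_eq_imp_root[OF assms[OF ab(1)] assms[OF ab(2)] less_imp_le[OF s] _ refl] \<open>f s = 0\<close>
      have "qa (x a) (y a) (w a) (x b) (y b) (w b) * (s * s) + qb (x a) (y a) (w a) (x b) (y b) (w b) *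
          (s * sqrt (1 - s * s)) + qc (x a) (y a) (w a) (x b) (y b) (w b) * (sqrt (1 - s * s) * sqrt (1 - s * s)) = 0"
        by (simp add: f_def)
      from homogeneous_root[OF this refl s] no_quadratic_imp_same[OF assms[OF ab(1)]] False
      have "s = cut1 (x a) (y a) (w a) (x b) (y b) (w b) \<or> s = cut2 (x a) (y a) (w a) (x b) (y b) (w b)"
        unfolding cut1_def cut2_def by blast
      then show False using no that by auto
    qed
    have cont: "continuous_on {t..t'} f"
      unfolding f_def by (intro continuous_intros continuous_on_extent)
    have "0 < f t \<longleftrightarrow> 0 < f t'"
    proof (rule ccontr)
      assume "(0 < f t) \<noteq> (0 < f t')"
      then have "f t \<le> 0 \<and> 0 \<le> f t' \<or> f t' \<le> 0 \<and> 0 \<le> f t" by auto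
      then have "\<exists>s. t \<le> s \<and> s \<le> t' \<and> f s = 0"
        using IVT'[of f t 0 t'] IVT2'[of f t' 0 t] t(2) cont by auto
      then show False using nz by auto
    qed
    moreover have "f t \<noteq> 0" "f t' \<noteq> 0" using nz t(2) by auto
    ultimately show ?thesis by (auto simp: beats_def f_def)
  qed
qed


section \<open>Merging two envelopes by a program\<close>

text \<open>Names of the programs below, before renaming to even names.  Real arrays: 0--2 input, 3--6 scaled
  coordinates, radii and cell diameters, 7--9 curves (center and weight), 10 piece ends of the
  finished envelope, 11 piece ends of the runs.  Integer arrays: 0--2 cells, 3 and 4 the curves
  of the pieces in 10 and 11, 5 offsets of the runs.  Integer registers: 0 and 31 number of sites, 1 number of
  curves, 2 highest level, 3 length of the finished envelope, 4 loop counter, 5 length of array 11, 6 number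
  of runs, 7 first run in the queue, 8 merges left in this pass, 9--12 bounds of the two runs being
  merged, 13 last emitted curve, 14 curve to emit, 15 and 16 curves to compare, 17--19 binary
  search, 20--22 cell to search for, 23 level, 27 curve found, 28 candidate site, 29 answer, 30 source
  of the query.\<close>

datatype cell = Cell (level: int) (column: int) (row: int)

instantiation cell :: linorder
begin

definition less_cell :: "cell \<Rightarrow> cell \<Rightarrow> bool" where
  "less_cell c d \<longleftrightarrow> level c < level d \<or> level c = level d \<and>
     (column c < column d \<or> column c = column d \<and> row c < row d)"

definition less_eq_cell :: "cell \<Rightarrow> cell \<Rightarrow> bool" where
  "less_eq_cell c d \<longleftrightarrow> c < d \<or> c = d"

instance
  by standard (auto simp: less_cell_def less_eq_cell_def intro: cell.expand)

end

section \<open>Program text of one merge step\<close>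

abbreviation iset :: "nat \<Rightarrow> iexp \<Rightarrow> com" where "iset x e \<equiv> Do (ISet x e)"
abbreviation rset :: "nat \<Rightarrow> rexp \<Rightarrow> com" where "rset x e \<equiv> Do (RSet x e)"

definition BOr :: "bexp \<Rightarrow> bexp \<Rightarrow> bexp" where
  "BOr b c = BNot (BAnd (BNot b) (BNot c))"

definition REq :: "rexp \<Rightarrow> rexp \<Rightarrow> bexp" where
  "REq d e = BAnd (BNot (RLess d e)) (BNot (RLess e d))"

definition IEq :: "iexp \<Rightarrow> iexp \<Rightarrow> bexp" where
  "IEq d e = BAnd (BNot (ILess d e)) (BNot (ILess e d))"

lemma bval_BOr [simp]: "bval (BOr b c) \<sigma> \<longleftrightarrow> bval b \<sigma> \<or> bval c \<sigma>"
  by (simp add: BOr_def)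

lemma bval_REq [simp]: "bval (REq d e) \<sigma> \<longleftrightarrow> rval d \<sigma> = rval e \<sigma>"
  by (auto simp: REq_def)

lemma bval_IEq [simp]: "bval (IEq d e) \<sigma> \<longleftrightarrow> ival d \<sigma> = ival e \<sigma>"
  by (auto simp: IEq_def)

definition lex_less :: "iexp \<Rightarrow> iexp \<Rightarrow> iexp \<Rightarrow> iexp \<Rightarrow> iexp \<Rightarrow> iexp \<Rightarrow> bexp" where
  "lex_less a b c a' b' c' = BOr (ILess a a') (BAnd (IEq a a')
     (BOr (ILess b b') (BAnd (IEq b b') (ILess c c'))))"

lemma bval_lex_less [simp]:
  "bval (lex_less a b c a' b' c') \<sigma> \<longleftrightarrow>
   Cell (ival a \<sigma>) (ival b \<sigma>) (ival c \<sigma>) < Cell (ival a' \<sigma>) (ival b' \<sigma>) (ival c' \<sigma>)"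
  by (auto simp: lex_less_def less_cell_def)

definition key_less :: "iexp \<Rightarrow> iexp \<Rightarrow> bexp" where
  "key_less u v = lex_less (IGet 0 u) (IGet 1 u) (IGet 2 u) (IGet 0 v) (IGet 1 v) (IGet 2 v)"

definition extent_exp :: "nat \<Rightarrow> nat \<Rightarrow> rexp" where
  "extent_exp v s = (let x = RGet 7 (IReg v); y = RGet 8 (IReg v); w = RGet 9 (IReg v);
     b = RAdd (RMul (RReg s) x) (RMul (RSqrt (RSub (RConst 1) (RMul (RReg s) (RReg s)))) y)
     in RAdd b (RSqrt (RAdd (RMul b b) w)))"

definition cut_coeffs :: com where
  "cut_coeffs = (let x = RGet 7 (IReg 15); y = RGet 8 (IReg 15); w = RGet 9 (IReg 15);
     x' = RGet 7 (IReg 16); y' = RGet 8 (IReg 16); w' = RGet 9 (IReg 16);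
     a = RSub x x'; b = RSub y y'; d = RSub w w' in
     rset 7 (RAdd (RMul d d) (RMul (RConst 4) (RSub (RMul (RMul d a) x) (RMul (RMul w a) a)))) ;;
     rset 8 (RMul (RConst 4) (RSub (RMul d (RAdd (RMul a y) (RMul b x)))
       (RMul (RMul (RMul (RConst 2) w) a) b))) ;;
     rset 9 (RAdd (RMul d d) (RMul (RConst 4) (RSub (RMul (RMul d b) y) (RMul (RMul w b) b)))))"

definition discriminant_exp :: rexp where
  "discriminant_exp = RSqrt (RSub (RMul (RReg 8) (RReg 8)) (RMul (RConst 4) (RMul (RReg 7) (RReg 9))))"

definition cut_roots :: com where
  "cut_roots =
     If (REq (RReg 7) (RConst 0))
       (rset 5 (RDiv (RSub (RConst 0) (RReg 9)) (RReg 8)) ;; rset 6 (RReg 5))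
       (rset 5 (RDiv (RSub discriminant_exp (RReg 8)) (RMul (RConst 2) (RReg 7))) ;;
        rset 6 (RDiv (RSub (RSub (RConst 0) discriminant_exp) (RReg 8)) (RMul (RConst 2) (RReg 7)))) ;;
     rset 5 (RDiv (RReg 5) (RSqrt (RAdd (RConst 1) (RMul (RReg 5) (RReg 5))))) ;;
     rset 6 (RDiv (RReg 6) (RSqrt (RAdd (RConst 1) (RMul (RReg 6) (RReg 6)))))"

lemma ev_cuts:
  fixes \<sigma> :: store
  defines "x \<equiv> \<lambda>r. get (rarr \<sigma> 7) (ireg \<sigma> r)" and "y \<equiv> \<lambda>r. get (rarr \<sigma> 8) (ireg \<sigma> r)"
    and "w \<equiv> \<lambda>r. get (rarr \<sigma> 9) (ireg \<sigma> r)" and "\<tau> \<equiv> ev (cut_coeffs ;; cut_roots) \<sigma>"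
  shows "rreg \<tau> 5 = cut1 (x 15) (y 15) (w 15) (x 16) (y 16) (w 16)"
    "rreg \<tau> 6 = cut2 (x 15) (y 15) (w 15) (x 16) (y 16) (w 16)"
    "same_outside ({}, {5..9}, {}, {}) \<sigma> \<tau>"
proof -
  define \<sigma>' where "\<sigma>' = ev cut_coeffs \<sigma>"
  have \<sigma>': "rreg \<sigma>' 7 = qa (x 15) (y 15) (w 15) (x 16) (y 16) (w 16)"
    "rreg \<sigma>' 8 = qb (x 15) (y 15) (w 15) (x 16) (y 16) (w 16)"
    "rreg \<sigma>' 9 = qc (x 15) (y 15) (w 15) (x 16) (y 16) (w 16)"
    by (simp_all add: \<sigma>'_def cut_coeffs_def Let_def x_def y_def w_def qa_def qb_def qc_def)
  have s: "same_outside ({}, {5..9}, {}, {}) \<sigma> \<sigma>'"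
    by (simp add: same_outside_def \<sigma>'_def cut_coeffs_def Let_def)
  have t: "\<tau> = ev cut_roots \<sigma>'"
    by (simp add: \<tau>_def \<sigma>'_def)
  show "rreg \<tau> 5 = cut1 (x 15) (y 15) (w 15) (x 16) (y 16) (w 16)"
    "rreg \<tau> 6 = cut2 (x 15) (y 15) (w 15) (x 16) (y 16) (w 16)"
    unfolding t by (simp_all add: cut_roots_def \<sigma>' cut1_def cut2_def root1_def root2_def
        sine_of_def discriminant_exp_def)
  show "same_outside ({}, {5..9}, {}, {}) \<sigma> \<tau>"
    using s unfolding t by (simp add: same_outside_def cut_roots_def)
qed

definition before_exp :: "nat \<Rightarrow> nat \<Rightarrow> nat \<Rightarrow> nat \<Rightarrow> bexp" where
  "before_exp a ae b be = BAnd (ILess (IReg a) (IReg ae))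
     (BNot (BAnd (ILess (IReg b) (IReg be))
        (BNot (key_less (IGet 4 (IReg a)) (IGet 4 (IReg b))))))"

definition take_one :: "nat \<Rightarrow> com" where
  "take_one a = iset 14 (IGet 4 (IReg a)) ;; rset 4 (RGet 11 (IReg a)) ;; iset a (IAdd (IReg a) (IConst 1))"

definition lower_to :: "rexp \<Rightarrow> com" where
  "lower_to e = If (BAnd (RLess (RReg 3) e) (RLess e (RReg 4))) (rset 4 e) skip"

definition find_stop :: com where
  "find_stop = rset 4 (RGet 11 (IReg 9)) ;;
     If (RLess (RGet 11 (IReg 11)) (RReg 4)) (rset 4 (RGet 11 (IReg 11))) skip ;;
     lower_to (RReg 5) ;; lower_to (RReg 6)"

definition find_winner :: com where
  "find_winner = rset 10 (RDiv (RAdd (RReg 3) (RReg 4)) (RConst 2)) ;;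
     If (BOr (RLess (extent_exp 15 10) (extent_exp 16 10))
         (BAnd (BNot (RLess (extent_exp 16 10) (extent_exp 15 10))) (ILess (IReg 16) (IReg 15))))
       (iset 14 (IReg 16)) (iset 14 (IReg 15))"

definition advance :: "nat \<Rightarrow> com" where
  "advance a = If (RLess (RReg 4) (RGet 11 (IReg a))) skip (iset a (IAdd (IReg a) (IConst 1)))"

definition take_both :: com where
  "take_both = iset 15 (IGet 4 (IReg 9)) ;; iset 16 (IGet 4 (IReg 11)) ;;
     (cut_coeffs ;; cut_roots) ;; find_stop ;; find_winner ;; advance 9 ;; advance 11"

definition emit_piece :: com where
  "emit_piece = If (IEq (IReg 14) (IReg 13))
       (Do (RPut 11 (ISub (IReg 5) (IConst 1)) (RReg 4)))
       (Do (RPush 11 (RReg 4)) ;; Do (IPush 4 (IReg 14)) ;;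
        iset 5 (IAdd (IReg 5) (IConst 1)) ;; iset 13 (IReg 14)) ;;
     If (REq (RReg 4) (RConst 1)) (rset 3 (RConst (-1))) (rset 3 (RReg 4))"

definition step :: com where
  "step = If (before_exp 9 10 11 12) (take_one 9)
     (If (before_exp 11 12 9 10) (take_one 11) take_both) ;; emit_piece"

text \<open>A program has only constantly many arrays, so all runs of the merge sort lie one after
  the other in a single array, and a run is a segment of it.\<close>

definition seg :: "'a list \<Rightarrow> nat \<Rightarrow> nat \<Rightarrow> 'a list" where
  "seg G i j = take (j - i) (drop i G)"

lemma seg_Cons: "i < j \<Longrightarrow> j \<le> length G \<Longrightarrow> seg G i j = G ! i # seg G (Suc i) j"
  by (simp add: seg_def Suc_diff_Suc[symmetric] Cons_nth_drop_Suc[symmetric])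

lemma seg_empty [simp]: "j \<le> i \<Longrightarrow> seg G i j = []"
  by (simp add: seg_def)

lemma seg_eq_Nil: "j \<le> length G \<Longrightarrow> seg G i j = [] \<longleftrightarrow> j \<le> i"
  by (auto simp: seg_def)

lemma hd_tl_seg: "i < j \<Longrightarrow> j \<le> length G \<Longrightarrow> hd (seg G i j) = G ! i \<and> tl (seg G i j) = seg G (Suc i) j"
  by (simp add: seg_Cons)

lemma seg_append: "j \<le> length G \<Longrightarrow> seg (G @ H) i j = seg G i j"
  by (auto simp: seg_def)

lemma seg_append2: "seg (G @ H) (length G) (length G + length H) = H"
  by (simp add: seg_def)

lemma length_seg: "j \<le> length G \<Longrightarrow> length (seg G i j) = j - i"
  by (auto simp: seg_def)

lemma get_nth [simp]: "i < length xs \<Longrightarrow> get xs (int i) = xs ! i"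
  by (simp add: get_def)

text \<open>Used twice with the same cells \<open>K1\<close>, \<open>K2\<close>, \<open>K3\<close>:
  with identical curves, where building the envelope merely sorts by cells, and with the curves of
  the discs.\<close>

locale site_data =
  fixes K1 K2 K3 :: "int list" and PX PY W :: "real list" and N :: nat
  assumes weights_pos: "v < N \<Longrightarrow> 0 < get W (int v)"
begin

definition key :: "nat \<Rightarrow> cell" where
  "key v = Cell (get K1 (int v)) (get K2 (int v)) (get K3 (int v))"

abbreviation "px v \<equiv> get PX (int v)"
abbreviation "py v \<equiv> get PY (int v)"
abbreviation "wt v \<equiv> get W (int v)"

abbreviation F :: "nat \<Rightarrow> real \<Rightarrow> real" where "F v \<equiv> extent (px v) (py v) (wt v)"

sublocale curves key F
  "\<lambda>u v. cut1 (px u) (py u) (wt u) (px v) (py v) (wt v)"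
  "\<lambda>u v. cut2 (px u) (py u) (wt u) (px v) (py v) (wt v)" "{..<N}"
  by (rule curves_extent) (simp add: weights_pos)

definition holds_data :: "store \<Rightarrow> bool" where
  "holds_data \<sigma> \<longleftrightarrow> iarr \<sigma> 0 = K1 \<and> iarr \<sigma> 1 = K2 \<and> iarr \<sigma> 2 = K3 \<and>
     rarr \<sigma> 7 = PX \<and> rarr \<sigma> 8 = PY \<and> rarr \<sigma> 9 = W"

text \<open>\<open>G\<close> contains all runs made so far, among them the two inputs
  \<open>xs\<close> and \<open>ys\<close>, which are never overwritten; the run under construction,
  \<open>out\<close>, grows behind it. Before the first piece, register 13 holds -1, which is no
  curve, so that no piece of an earlier run is extended.\<close>

definition merge_state :: "(real \<times> nat) list \<Rightarrow> (real \<times> nat) list \<Rightarrow> (real \<times> nat) list \<Rightarrow>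
    real \<Rightarrow> (real \<times> nat) list \<Rightarrow> store \<Rightarrow> bool" where
  "merge_state G xs ys lo out \<sigma> \<longleftrightarrow> holds_data \<sigma> \<and>
     rarr \<sigma> 11 = map fst (G @ out) \<and> iarr \<sigma> 4 = map (\<lambda>p. int (snd p)) (G @ out) \<and>
     ireg \<sigma> 5 = int (length G + length out) \<and>
     ireg \<sigma> 13 = (if out = [] then -1 else int (snd (last out))) \<and> rreg \<sigma> 3 = lo \<and>
     (\<exists>a ae b be. ireg \<sigma> 9 = int a \<and> ireg \<sigma> 10 = int ae \<and> ireg \<sigma> 11 = int b \<and> ireg \<sigma> 12 = int be \<and>
        ae \<le> length G \<and> be \<le> length G \<and> xs = seg G a ae \<and> ys = seg G b be)"

lemma bval_key_less:
  "holds_data \<sigma> \<Longrightarrow> ival u \<sigma> = int i \<Longrightarrow> ival v \<sigma> = int j \<Longrightarrow>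
   bval (key_less u v) \<sigma> \<longleftrightarrow> key i < key j"
  by (simp add: key_less_def holds_data_def key_def)

lemma rval_extent_exp:
  "holds_data \<sigma> \<Longrightarrow> ireg \<sigma> r = int v \<Longrightarrow> rval (extent_exp r s) \<sigma> = F v (rreg \<sigma> s)"
  by (simp add: extent_exp_def extent_def holds_data_def Let_def)

lemma bval_before_exp:
  assumes "holds_data \<sigma>" "rarr \<sigma> 11 = map fst (G @ out)" "iarr \<sigma> 4 = map (\<lambda>p. int (snd p)) (G @ out)"
    "ireg \<sigma> r1 = int a" "ireg \<sigma> r2 = int ae" "ireg \<sigma> r3 = int b" "ireg \<sigma> r4 = int be"
    "ae \<le> length G" "be \<le> length G"
  shows "bval (before_exp r1 r2 r3 r4) \<sigma> \<longleftrightarrow> front (seg G a ae) (seg G b be)"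
proof (cases "a < ae")
  case True
  then have a: "get (iarr \<sigma> 4) (int a) = int (snd (G ! a))" "seg G a ae \<noteq> []" "hd (seg G a ae) = G ! a"
    using assms by (auto simp: nth_append seg_Cons)
  show ?thesis
  proof (cases "b < be")
    case b: True
    then have "get (iarr \<sigma> 4) (int b) = int (snd (G ! b))" "seg G b be \<noteq> []" "hd (seg G b be) = G ! b"
      using assms by (auto simp: nth_append seg_Cons)
    then show ?thesis
      using a True b assms by (simp add: before_exp_def front_def bval_key_less)
  next
    case False
    then show ?thesis using a True assms by (simp add: before_exp_def front_def)
  qed
next
  case False
  then show ?thesis using assms by (simp add: before_exp_def front_def)
qed

lemma ev_take_both:
  assumes data: "holds_data \<sigma>"
    and E: "rarr \<sigma> 11 = map fst (G @ out)" and V: "iarr \<sigma> 4 = map (\<lambda>p. int (snd p)) (G @ out)"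
    and ab: "ireg \<sigma> 9 = int a" "ireg \<sigma> 11 = int b" "a < length G" "b < length G"
    and G: "G ! a = (e, v)" "G ! b = (e', w)"
    and h: "h = stop v w (rreg \<sigma> 3) (if e' < e then e' else e)"
  shows "rreg (ev take_both \<sigma>) 4 = h"
    "ireg (ev take_both \<sigma>) 14 = int (winner v w ((rreg \<sigma> 3 + h) / 2))"
    "ireg (ev take_both \<sigma>) 9 = int (if h < e then a else Suc a)"
    "ireg (ev take_both \<sigma>) 11 = int (if h < e' then b else Suc b)"
    "same_outside ({9, 11, 14, 15, 16}, {4..10}, {}, {}) \<sigma> (ev take_both \<sigma>)"
proof -
  define \<sigma>1 where "\<sigma>1 = ev (iset 15 (IGet 4 (IReg 9)) ;; iset 16 (IGet 4 (IReg 11))) \<sigma>"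
  define \<sigma>2 where "\<sigma>2 = ev (cut_coeffs ;; cut_roots) \<sigma>1"
  define \<sigma>3 where "\<sigma>3 = ev find_stop \<sigma>2"
  define \<sigma>4 where "\<sigma>4 = ev find_winner \<sigma>3"
  have all: "ev take_both \<sigma> = ev (advance 11) (ev (advance 9) \<sigma>4)"
    by (simp add: take_both_def \<sigma>4_def \<sigma>3_def \<sigma>2_def \<sigma>1_def)
  have 1: "ireg \<sigma>1 15 = int v" "ireg \<sigma>1 16 = int w" "same_outside ({15, 16}, {}, {}, {}) \<sigma> \<sigma>1"
    using ab V G by (simp_all add: \<sigma>1_def nth_append same_outside_def)
  then have d1: "holds_data \<sigma>1"
    using data by (simp add: holds_data_def same_outside_def)
  note c = ev_cuts[of \<sigma>1, folded \<sigma>2_def]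
  have s2: "same_outside ({15, 16}, {5..9}, {}, {}) \<sigma> \<sigma>2" and v2: "ireg \<sigma>2 15 = int v" "ireg \<sigma>2 16 = int w"
    using 1 c(3) by (simp_all add: same_outside_def)
  have c12: "rreg \<sigma>2 5 = cut1 (px v) (py v) (wt v) (px w) (py w) (wt w)"
    "rreg \<sigma>2 6 = cut2 (px v) (py v) (wt v) (px w) (py w) (wt w)"
    using c(1,2) 1 d1 by (simp_all add: holds_data_def)
  have e2: "get (rarr \<sigma>2 11) (ireg \<sigma>2 9) = e" "get (rarr \<sigma>2 11) (ireg \<sigma>2 11) = e'"
    using s2 ab E G by (simp_all add: same_outside_def nth_append)
  have lo2: "rreg \<sigma>2 3 = rreg \<sigma> 3" using s2 by (simp add: same_outside_def)
  have s3: "same_outside ({}, {4}, {}, {}) \<sigma>2 \<sigma>3"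
    by (simp add: \<sigma>3_def find_stop_def lower_to_def same_outside_def)
  have h3: "rreg \<sigma>3 4 = h"
    by (simp add: \<sigma>3_def find_stop_def lower_to_def e2 c12 lo2 h stop_def Let_def)
  have s03: "same_outside ({15, 16}, {4..9}, {}, {}) \<sigma> \<sigma>3"
    using s2 s3 by (auto simp: same_outside_def)
  then have d3: "holds_data \<sigma>3"
    using data by (simp add: holds_data_def same_outside_def)
  have v3: "ireg \<sigma>3 15 = int v" "ireg \<sigma>3 16 = int w"
    using v2 s3 by (simp_all add: same_outside_def)
  have lo3: "rreg \<sigma>3 3 = rreg \<sigma> 3" using s03 by (simp add: same_outside_def)
  define \<sigma>3' where "\<sigma>3' = ev (rset 10 (RDiv (RAdd (RReg 3) (RReg 4)) (RConst 2))) \<sigma>3"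
  have 3: "holds_data \<sigma>3'" "ireg \<sigma>3' 15 = int v" "ireg \<sigma>3' 16 = int w"
    "rreg \<sigma>3' 10 = (rreg \<sigma> 3 + h) / 2" "same_outside ({}, {10}, {}, {}) \<sigma>3 \<sigma>3'"
    using d3 v3 h3 lo3 by (simp_all add: \<sigma>3'_def holds_data_def same_outside_def)
  have 4: "\<sigma>4 = \<sigma>3'\<lparr>ireg := (ireg \<sigma>3')(14 := int (winner v w ((rreg \<sigma> 3 + h) / 2)))\<rparr>"
    using rval_extent_exp[OF 3(1,2), of 10] rval_extent_exp[OF 3(1,3), of 10] 3(2-4)
    by (simp add: \<sigma>4_def find_winner_def winner_def flip: \<sigma>3'_def) (auto simp: \<sigma>3'_def)
  have s4: "same_outside ({14, 15, 16}, {4..10}, {}, {}) \<sigma> \<sigma>4"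
    using s03 3(5) by (auto simp: 4 same_outside_def)
  have 5: "ireg \<sigma>4 9 = int a" "ireg \<sigma>4 11 = int b" "rreg \<sigma>4 4 = h"
    "rarr \<sigma>4 11 = map fst (G @ out)"
    using s4 ab E h3 3(5) by (simp_all add: same_outside_def) (simp add: 4)
  have ga: "get (rarr \<sigma>4 11) (int a) = e" "get (rarr \<sigma>4 11) (int b) = e'"
    using 5(4) ab G by (simp_all add: nth_append)
  show "rreg (ev take_both \<sigma>) 4 = h"
    "ireg (ev take_both \<sigma>) 9 = int (if h < e then a else Suc a)"
    "ireg (ev take_both \<sigma>) 11 = int (if h < e' then b else Suc b)"
    unfolding all using 5 ga by (simp_all add: advance_def)
  show "ireg (ev take_both \<sigma>) 14 = int (winner v w ((rreg \<sigma> 3 + h) / 2))"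
    unfolding all by (simp add: advance_def) (simp add: 4)
  show "same_outside ({9, 11, 14, 15, 16}, {4..10}, {}, {}) \<sigma> (ev take_both \<sigma>)"
    unfolding all using s4 by (simp add: advance_def same_outside_def)
qed

lemma ev_emit_piece:
  assumes "rarr \<sigma> 11 = map fst (G @ out)" "iarr \<sigma> 4 = map (\<lambda>p. int (snd p)) (G @ out)"
    "ireg \<sigma> 5 = int (length G + length out)"
    "ireg \<sigma> 13 = (if out = [] then -1 else int (snd (last out)))"
    "rreg \<sigma> 4 = fst p" "ireg \<sigma> 14 = int (snd p)"
  shows "rarr (ev emit_piece \<sigma>) 11 = map fst (G @ emit out p)"
    "iarr (ev emit_piece \<sigma>) 4 = map (\<lambda>p. int (snd p)) (G @ emit out p)"
    "ireg (ev emit_piece \<sigma>) 5 = int (length G + length (emit out p))"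
    "ireg (ev emit_piece \<sigma>) 13 = (if emit out p = [] then -1 else int (snd (last (emit out p))))"
    "rreg (ev emit_piece \<sigma>) 3 = next_lo (fst p)"
    "same_outside ({5, 13}, {3}, {4}, {11}) \<sigma> (ev emit_piece \<sigma>)"
proof -
  have "rarr (ev emit_piece \<sigma>) 11 = map fst (G @ emit out p) \<and>
    iarr (ev emit_piece \<sigma>) 4 = map (\<lambda>p. int (snd p)) (G @ emit out p) \<and>
    ireg (ev emit_piece \<sigma>) 5 = int (length G + length (emit out p)) \<and>
    ireg (ev emit_piece \<sigma>) 13 = (if emit out p = [] then -1 else int (snd (last (emit out p)))) \<and>
    rreg (ev emit_piece \<sigma>) 3 = next_lo (fst p)"
  proof (cases "out \<noteq> [] \<and> snd (last out) = snd p")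
    case True
    then obtain o' q where o: "out = o' @ [q]" by (cases out rule: rev_cases) auto
    have "put (map fst G @ map fst o' @ [fst q]) (int (length G) + int (length o')) (fst p) =
        map fst G @ map fst o' @ [fst p]"
      by (simp add: put_def list_update_append nat_add_distrib flip: of_nat_add)
    with True o assms show ?thesis
      by (simp add: emit_piece_def emit_def next_lo_def)
  next
    case False
    then show ?thesis
      using assms by (auto simp: emit_piece_def emit_def next_lo_def)
  qed
  then show "rarr (ev emit_piece \<sigma>) 11 = map fst (G @ emit out p)"
    "iarr (ev emit_piece \<sigma>) 4 = map (\<lambda>p. int (snd p)) (G @ emit out p)"
    "ireg (ev emit_piece \<sigma>) 5 = int (length G + length (emit out p))"
    "ireg (ev emit_piece \<sigma>) 13 = (if emit out p = [] then -1 else int (snd (last (emit out p))))"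
    "rreg (ev emit_piece \<sigma>) 3 = next_lo (fst p)" by blast+
  show "same_outside ({5, 13}, {3}, {4}, {11}) \<sigma> (ev emit_piece \<sigma>)"
    by (simp add: emit_piece_def same_outside_def)
qed

lemma ev_step:
  assumes "merge_state G xs ys lo out \<sigma>" "xs \<noteq> [] \<or> ys \<noteq> []" "merge_step xs ys lo = (p, xs', ys')"
  shows "merge_state G xs' ys' (next_lo (fst p)) (emit out p) (ev step \<sigma>)"
proof -
  from assms(1) obtain a ae b be where
    data: "holds_data \<sigma>" and E: "rarr \<sigma> 11 = map fst (G @ out)"
    and V: "iarr \<sigma> 4 = map (\<lambda>p. int (snd p)) (G @ out)"
    and len: "ireg \<sigma> 5 = int (length G + length out)"
    and lst: "ireg \<sigma> 13 = (if out = [] then -1 else int (snd (last out)))" and lo: "rreg \<sigma> 3 = lo"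
    and reg: "ireg \<sigma> 9 = int a" "ireg \<sigma> 10 = int ae" "ireg \<sigma> 11 = int b" "ireg \<sigma> 12 = int be"
    and le: "ae \<le> length G" "be \<le> length G" and xs: "xs = seg G a ae" and ys: "ys = seg G b be"
    unfolding merge_state_def by blast
  note fr = bval_before_exp[OF data E V reg le] bval_before_exp[OF data E V reg(3,4,1,2) le(2,1)]
  define c where "c = If (before_exp 9 10 11 12) (take_one 9)
     (If (before_exp 11 12 9 10) (take_one 11) take_both)"
  define \<tau> where "\<tau> = ev c \<sigma>"
  have "\<exists>a' b'. ireg \<tau> 9 = int a' \<and> ireg \<tau> 11 = int b' \<and> xs' = seg G a' ae \<and> ys' = seg G b' be \<and>
      rreg \<tau> 4 = fst p \<and> ireg \<tau> 14 = int (snd p) \<and>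
      same_outside ({9, 11, 14, 15, 16}, {4..10}, {}, {}) \<sigma> \<tau>"
  proof -
    consider (x) "front xs ys" | (y) "front ys xs" "\<not> front xs ys" | (b) "\<not> front xs ys" "\<not> front ys xs"
      by blast
    then show ?thesis
    proof cases
      case x
      then have *: "p = hd xs" "xs' = tl xs" "ys' = ys" using assms(3) by (auto simp: merge_step_def)
      have a: "a < ae" using x xs by (auto simp: front_def not_less seg_eq_Nil le intro: ccontr)
      have t: "\<tau> = ev (take_one 9) \<sigma>" using x fr xs ys by (simp add: \<tau>_def c_def)
      show ?thesis
        unfolding t using * a hd_tl_seg[OF a le(1)] le E V reg xs ys
        by (intro exI[of _ "Suc a"] exI[of _ b]) (simp add: take_one_def nth_append same_outside_def)
    next
      case y
      then have *: "p = hd ys" "xs' = xs" "ys' = tl ys" using assms(3) by (auto simp: merge_step_def)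
      have b: "b < be" using y ys by (auto simp: front_def not_less seg_eq_Nil le intro: ccontr)
      have t: "\<tau> = ev (take_one 11) \<sigma>" using y fr xs ys by (simp add: \<tau>_def c_def)
      show ?thesis
        unfolding t using * b hd_tl_seg[OF b le(2)] le E V reg xs ys
        by (intro exI[of _ a] exI[of _ "Suc b"]) (simp add: take_one_def nth_append same_outside_def)
    next
      case b
      then have ne: "xs \<noteq> []" "ys \<noteq> []" using assms(2) by (auto simp: front_def)
      then have ab: "a < ae" "b < be"
        using xs ys by (metis not_less seg_empty)+
      obtain e v where Ga: "G ! a = (e, v)" by (cases "G ! a")
      obtain e' w where Gb: "G ! b = (e', w)" by (cases "G ! b")
      define h where "h = stop v w lo (if e' < e then e' else e)"
      have hx: "hd xs = (e, v)" "tl xs = seg G (Suc a) ae" "hd ys = (e', w)" "tl ys = seg G (Suc b) be"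
        using hd_tl_seg[OF ab(1) le(1)] hd_tl_seg[OF ab(2) le(2)] xs ys Ga Gb by auto
      have *: "p = (h, winner v w ((lo + h) / 2))" "xs' = (if h < e then xs else tl xs)"
        "ys' = (if h < e' then ys else tl ys)"
        using assms(3) b by (auto simp: merge_step_def hx h_def Let_def)
      have t: "\<tau> = ev take_both \<sigma>" using b fr xs ys by (simp add: \<tau>_def c_def)
      have "a < length G" "b < length G" using ab le by auto
      note tb = ev_take_both[OF data E V reg(1,3) this Ga Gb, unfolded lo, OF h_def]
      show ?thesis
        unfolding t using * tb hx xs ys
        by (intro exI[of _ "if h < e then a else Suc a"] exI[of _ "if h < e' then b else Suc b"]) auto
    qed
  qed
  then obtain a' b' where t: "ireg \<tau> 9 = int a'" "ireg \<tau> 11 = int b'" "xs' = seg G a' ae" "ys' = seg G b' be"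
    "rreg \<tau> 4 = fst p" "ireg \<tau> 14 = int (snd p)"
    "same_outside ({9, 11, 14, 15, 16}, {4..10}, {}, {}) \<sigma> \<tau>" by blast
  have t': "rarr \<tau> 11 = map fst (G @ out)" "iarr \<tau> 4 = map (\<lambda>p. int (snd p)) (G @ out)"
    "ireg \<tau> 5 = int (length G + length out)"
    "ireg \<tau> 13 = (if out = [] then -1 else int (snd (last out)))"
    using t(7) E V len lst by (simp_all add: same_outside_def)
  note em = ev_emit_piece[OF t' t(5,6)]
  have "ev step \<sigma> = ev emit_piece \<tau>"
    by (simp add: step_def \<tau>_def c_def)
  moreover have "holds_data (ev emit_piece \<tau>)"
    using data t(7) em(6) by (simp add: holds_data_def same_outside_def)
  moreover have "ireg (ev emit_piece \<tau>) 9 = int a'" "ireg (ev emit_piece \<tau>) 11 = int b'"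
    "ireg (ev emit_piece \<tau>) 10 = int ae" "ireg (ev emit_piece \<tau>) 12 = int be"
    using t(1,2,7) em(6) reg by (simp_all add: same_outside_def)
  ultimately show ?thesis
    unfolding merge_state_def using em t(3,4) le by simp
qed

end


section \<open>Building the envelope of all sites\<close>

definition merge_loop :: com where
  "merge_loop = While (BOr (ILess (IReg 9) (IReg 10)) (ILess (IReg 11) (IReg 12))) step"

definition merge_guard :: bexp where
  "merge_guard = BOr (ILess (IReg 9) (IReg 10)) (ILess (IReg 11) (IReg 12))"

definition merge_unit :: nat where
  "merge_unit = bcost merge_guard + tm step"

definition start_merge :: com where
  "start_merge = iset 9 (IGet 5 (IReg 7)) ;; iset 10 (IGet 5 (IAdd (IReg 7) (IConst 1))) ;;
     iset 11 (IReg 10) ;; iset 12 (IGet 5 (IAdd (IReg 7) (IConst 2))) ;;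
     iset 7 (IAdd (IReg 7) (IConst 2)) ;; iset 13 (IConst (-1)) ;; rset 3 (RConst (-1))"

definition end_merge :: com where
  "end_merge = Do (IPush 5 (IReg 5)) ;; iset 8 (ISub (IReg 8) (IConst 1))"

definition front_unit :: nat where
  "front_unit = merge_unit * 9 + tm start_merge + tm end_merge"

definition pass_unit :: nat where
  "pass_unit = (front_unit + bcost (ILess (IConst 0) (IReg 8))) * 2 + tm (iset 8 (IHalf (IReg 6))) +
     tm (iset 6 (ISub (IReg 6) (IReg 8))) + bcost (ILess (IConst 0) (IReg 8))"

definition merge_front :: com where
  "merge_front = start_merge ;; merge_loop ;; end_merge"

text \<open>The runs form a queue: the two at the head are merged and the result is appended. Of
  \<open>k\<close> runs, \<open>k div 2\<close> pairs are merged in a pass, and with an odd number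
  the last one just waits in the queue for the next pass.\<close>

definition merge_pass :: com where
  "merge_pass = iset 8 (IHalf (IReg 6)) ;; iset 6 (ISub (IReg 6) (IReg 8)) ;;
     While (ILess (IConst 0) (IReg 8)) merge_front"

definition merge_all :: com where
  "merge_all = While (ILess (IConst 1) (IReg 6)) merge_pass"

definition init_queue :: com where
  "init_queue = Do (RClear 11) ;; Do (IClear 4) ;; Do (IClear 5) ;; Do (IPush 5 (IConst 0)) ;;
     iset 4 (IConst 0) ;; iset 5 (IReg 1) ;; iset 6 (IReg 1) ;; iset 7 (IConst 0)"

definition init_body :: com where
  "init_body = Do (RPush 11 (RConst 1)) ;; Do (IPush 4 (IReg 4)) ;;
     iset 4 (IAdd (IReg 4) (IConst 1)) ;; Do (IPush 5 (IReg 4))"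

definition init_runs :: com where
  "init_runs = init_queue ;; While (ILess (IReg 4) (IReg 1)) init_body"

definition copy_start :: com where
  "copy_start = Do (RClear 10) ;; Do (IClear 3) ;; iset 4 (IGet 5 (IReg 7)) ;;
     iset 5 (IGet 5 (IAdd (IReg 7) (IConst 1))) ;; iset 3 (ISub (IReg 5) (IReg 4))"

definition copy_body :: com where
  "copy_body = Do (RPush 10 (RGet 11 (IReg 4))) ;; Do (IPush 3 (IGet 4 (IReg 4))) ;;
     iset 4 (IAdd (IReg 4) (IConst 1))"

definition copy_end :: com where
  "copy_end = Do (RClear 11) ;; Do (IClear 4) ;; Do (IClear 5)"

text \<open>Consumed runs stay in the array, which therefore grows throughout all passes. Moving the
  final run to an array of its own and clearing the rest brings the space back to linear.\<close>

definition copy_run :: com where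
  "copy_run = copy_start ;; While (ILess (IReg 4) (IReg 5)) copy_body ;; copy_end"

definition build :: com where
  "build = init_runs ;; merge_all ;; copy_run"

lemma loopfree_step: "loopfree step"
  by (simp add: step_def take_one_def take_both_def cut_coeffs_def cut_roots_def find_stop_def
      lower_to_def find_winner_def advance_def emit_piece_def Let_def)

lemma loopfree_merge_parts: "loopfree start_merge" "loopfree end_merge"
  by (simp_all add: start_merge_def end_merge_def)

lemma writes_step: "writes step = ({5, 9, 11, 13, 14, 15, 16}, {3, 4, 5, 6, 7, 8, 9, 10}, {4}, {11})"
  by (auto simp: step_def take_one_def take_both_def cut_coeffs_def cut_roots_def find_stop_def
      lower_to_def find_winner_def advance_def emit_piece_def Let_def)

lemma writes_merge_front: "writes merge_front = ({5, 7, 8, 9, 10, 11, 12, 13, 14, 15, 16}, {3, 4, 5, 6, 7, 8, 9, 10}, {4, 5}, {11})"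
  by (auto simp: merge_front_def merge_loop_def start_merge_def end_merge_def writes_step)

lemma writes_build: "writes build = ({3, 4, 5, 6, 7, 8, 9, 10, 11, 12, 13, 14, 15, 16}, {3, 4, 5, 6, 7, 8, 9, 10}, {3, 4, 5}, {10, 11})"
  by (auto simp: build_def init_runs_def init_queue_def init_body_def merge_all_def merge_pass_def
      writes_merge_front copy_run_def copy_start_def copy_body_def copy_end_def)

lemma runs_ev_pay:
  assumes "loopfree c" "I q' (ev c \<tau>)" "x + tm c + q' \<le> q"
  shows "\<exists>T. runs c \<tau> T (\<lambda>\<tau>. \<exists>q'. I q' \<tau> \<and> x + T + q' \<le> q)"
  using assms by (intro exI[of _ "tm c"] runs_ev exI[of _ q']) auto

lemma runs_seq_assoc:
  assumes "runs ((c ;; d) ;; e) \<sigma> T Q"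
  shows "runs (c ;; d ;; e) \<sigma> T Q"
proof -
  obtain t m \<tau> where x: "exec ((c ;; d) ;; e) \<sigma> t m \<tau>" "t \<le> T" "Q \<tau>"
    using assms by (auto simp: runs_def)
  from x(1) obtain t1 m1 \<sigma>1 t2 m2 where 1: "exec (c ;; d) \<sigma> t1 m1 \<sigma>1" "exec e \<sigma>1 t2 m2 \<tau>" "t = t1 + t2"
    by (auto elim: exec_SeqE)
  from 1(1) obtain t3 m3 \<sigma>3 t4 m4 where 2: "exec c \<sigma> t3 m3 \<sigma>3" "exec d \<sigma>3 t4 m4 \<sigma>1" "t1 = t3 + t4"
    by (auto elim: exec_SeqE)
  from exec_Seq[OF 2(1) exec_Seq[OF 2(2) 1(2)]] show ?thesis
    unfolding runs_def using 1(3) 2(3) x(2,3) by (auto simp: add.assoc)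
qed

context site_data
begin

lemma runs_merge_loop:
  assumes "merge_state G xs ys (-1) [] \<sigma>" "good A (-1) xs" "good B (-1) ys" "A \<subseteq> {..<N}" "B \<subseteq> {..<N}"
  shows "runs merge_loop \<sigma> (merge_unit * (3 * (length xs + length ys) + 3))
    (\<lambda>\<tau>. \<exists>out. merge_state G [] [] (-1) out \<tau> \<and> good (A \<union> B) (-1) out \<and> tight out)"
proof -
  \<comment> \<open>\<open>A'\<close> and \<open>B'\<close> are the curves that remain. The budget
    is the remaining effort plus one unit for the last test of the guard.\<close>
  define I where "I q \<tau> \<longleftrightarrow> (\<exists>xs ys lo out A' B'. merge_state G xs ys lo out \<tau> \<and> merging A' B' xs ys lo \<and>
      (\<forall>L. good (A' \<union> B') lo L \<longrightarrow> good (A \<union> B) (-1) (out @ L)) \<and> tight out \<and>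
      q = merge_unit * (effort xs ys lo + 1))" for q \<tau>
  have guard: "bval merge_guard \<tau> \<longleftrightarrow> xs \<noteq> [] \<or> ys \<noteq> []"
    if "merge_state G xs ys lo out \<tau>" for G xs ys lo out \<tau>
    using that by (auto simp: merge_guard_def merge_state_def seg_eq_Nil)
  have "runs (While merge_guard step) \<sigma> (merge_unit * (effort xs ys (-1) + 1))
      (\<lambda>\<tau>. (\<exists>q. I q \<tau>) \<and> \<not> bval merge_guard \<tau>)"
  proof (rule runs_While)
    fix q \<tau> assume "I q \<tau>" and g: "bval merge_guard \<tau>"
    then obtain xs ys lo out A' B' where s: "merge_state G xs ys lo out \<tau>" "merging A' B' xs ys lo"
      "\<And>L. good (A' \<union> B') lo L \<Longrightarrow> good (A \<union> B) (-1) (out @ L)" "tight out"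
      "q = merge_unit * (effort xs ys lo + 1)"
      unfolding I_def by blast
    have ne: "xs \<noteq> [] \<or> ys \<noteq> []" using guard s(1) g by blast
    obtain p xs' ys' where m: "merge_step xs ys lo = (p, xs', ys')" by (cases "merge_step xs ys lo") auto
    from merge_step[OF s(2) ne m] obtain A'' B'' where
      n: "merging A'' B'' xs' ys' (next_lo (fst p))"
        "\<And>L. good (A'' \<union> B'') (next_lo (fst p)) L \<Longrightarrow> good (A' \<union> B') lo (p # L)"
        "effort xs' ys' (next_lo (fst p)) < effort xs ys lo" by blast
    let ?q = "merge_unit * (effort xs' ys' (next_lo (fst p)) + 1)"
    have "I ?q (ev step \<tau>)"
      unfolding I_def using ev_step[OF s(1) ne m] n(1) good_emit[OF s(3)[OF n(2)]] tight_emit[OF s(4)]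
      by blast
    moreover have "bcost merge_guard + tm step + ?q \<le> q"
    proof -
      have "?q + merge_unit \<le> q"
        using mult_le_mono2[of "effort xs' ys' (next_lo (fst p)) + 2" "effort xs ys lo + 1" merge_unit] n(3)
        unfolding s(5) by (simp add: algebra_simps)
      then show ?thesis by (simp add: merge_unit_def)
    qed
    ultimately show "\<exists>T. runs step \<tau> T (\<lambda>\<tau>. \<exists>q'. I q' \<tau> \<and> bcost merge_guard + T + q' \<le> q)"
      by (rule runs_ev_pay[OF loopfree_step])
  next
    fix q \<tau> assume "I q \<tau>"
    then show "bcost merge_guard \<le> q"
      by (auto simp: I_def merge_unit_def)
  next
    have "merging A B xs ys (-1)"
      using assms by (simp add: merging_def)
    with assms show "I (merge_unit * (effort xs ys (-1) + 1)) \<sigma>"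
      unfolding I_def by (intro exI[of _ xs] exI[of _ ys] exI[of _ "-1"] exI[of _ "[]"] exI[of _ A] exI[of _ B]) auto
  qed
  then show ?thesis
    unfolding merge_loop_def merge_guard_def[symmetric]
  proof (rule runs_weaken)
    show "merge_unit * (effort xs ys (-1) + 1) \<le> merge_unit * (3 * (length xs + length ys) + 3)"
      using effort_le[of xs ys "-1"] by (intro mult_le_mono2) simp
  next
    fix \<tau> assume "(\<exists>q. I q \<tau>) \<and> \<not> bval merge_guard \<tau>"
    then obtain xs ys lo out A' B' where s: "merge_state G xs ys lo out \<tau>" "merging A' B' xs ys lo"
      "\<And>L. good (A' \<union> B') lo L \<Longrightarrow> good (A \<union> B) (-1) (out @ L)" "tight out" and ng: "\<not> bval merge_guard \<tau>"
      unfolding I_def by blast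
    then have "xs = []" "ys = []" using guard by auto
    then have "A' = {}" "B' = {}" "lo = -1" using s(2) by (auto simp: merging_def front_def)
    then show "\<exists>out. merge_state G [] [] (-1) out \<tau> \<and> good (A \<union> B) (-1) out \<and> tight out"
      using s(1,4) s(3)[of "[]"] \<open>xs = []\<close> \<open>ys = []\<close> by (intro exI[of _ out]) auto
  qed
qed

section \<open>The queue of runs and one pass over it\<close>

definition run_of :: "(real \<times> nat) list \<Rightarrow> nat list \<Rightarrow> nat \<Rightarrow> (real \<times> nat) list" where
  "run_of G es i = seg G (es ! i) (es ! Suc i)"

text \<open>Consecutive entries of \<open>es\<close> delimit the runs, and the run numbered
  \<open>f\<close> is the head of the queue; \<open>As\<close> lists the sets of curves whose
  envelopes are waiting.\<close>

definition queue :: "(real \<times> nat) list \<Rightarrow> nat list \<Rightarrow> nat \<Rightarrow> nat set list \<Rightarrow> store \<Rightarrow> bool" where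
  "queue G es f As \<sigma> \<longleftrightarrow> holds_data \<sigma> \<and> rarr \<sigma> 11 = map fst G \<and> iarr \<sigma> 4 = map (\<lambda>p. int (snd p)) G \<and>
     iarr \<sigma> 5 = map int es \<and> ireg \<sigma> 5 = int (length G) \<and> ireg \<sigma> 7 = int f \<and>
     length es = f + length As + 1 \<and> last es = length G \<and> (\<forall>e\<in>set es. e \<le> length G) \<and>
     (\<forall>i<length As. As ! i \<subseteq> {..<N} \<and> good (As ! i) (-1) (run_of G es (f + i)) \<and> tight (run_of G es (f + i)))"

lemma runs_merge_front:
  assumes q: "queue G es f (A # B # As) \<sigma>"
  shows "runs merge_front \<sigma> (front_unit * (card A + card B + 1))
    (\<lambda>\<tau>. \<exists>G es. queue G es (f + 2) (As @ [A \<union> B]) \<tau> \<and> ireg \<tau> 8 = ireg \<sigma> 8 - 1 \<and> ireg \<tau> 6 = ireg \<sigma> 6)"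
proof -
  let ?xs = "run_of G es f" and ?ys = "run_of G es (Suc f)"
  have len: "length es = f + length As + 3" using q by (simp add: queue_def)
  have all: "(A # B # As) ! i \<subseteq> {..<N} \<and> good ((A # B # As) ! i) (-1) (run_of G es (f + i)) \<and>
      tight (run_of G es (f + i))" if "i < Suc (Suc (length As))" for i
    using q that by (simp add: queue_def)
  have A: "A \<subseteq> {..<N}" "good A (-1) ?xs" "tight ?xs" and B: "B \<subseteq> {..<N}" "good B (-1) ?ys" "tight ?ys"
    using all[of 0] all[of 1] by auto
  have "last es = length G" using q by (simp add: queue_def)
  have As: "As ! i \<subseteq> {..<N}" "good (As ! i) (-1) (run_of G es (f + 2 + i))" "tight (run_of G es (f + 2 + i))"
    if "i < length As" for i
    using all[of "Suc (Suc i)"] that by auto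
  have le: "es ! i \<le> length G" if "i < length es" for i
    using q that by (auto simp: queue_def)
  define \<sigma>1 where "\<sigma>1 = ev start_merge \<sigma>"
  have s1: "same_outside ({7, 9, 10, 11, 12, 13}, {3}, {}, {}) \<sigma> \<sigma>1"
    by (simp add: \<sigma>1_def start_merge_def same_outside_def)
  have g: "get (iarr \<sigma> 5) (int i) = int (es ! i)" if "i < length es" for i
    using q that by (simp add: queue_def)
  have r1: "ireg \<sigma>1 7 = int (f + 2)" "ireg \<sigma>1 9 = int (es ! f)" "ireg \<sigma>1 10 = int (es ! Suc f)"
    "ireg \<sigma>1 11 = int (es ! Suc f)" "ireg \<sigma>1 12 = int (es ! Suc (Suc f))" "ireg \<sigma>1 13 = -1" "rreg \<sigma>1 3 = -1"
    using q g[of f] g[of "Suc f"] g[of "Suc (Suc f)"] len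
    by (simp_all add: \<sigma>1_def start_merge_def queue_def algebra_simps)
  have m1: "merge_state G ?xs ?ys (-1) [] \<sigma>1"
    unfolding merge_state_def
    using s1 r1 q le[of "Suc f"] le[of "Suc (Suc f)"] len
    by (auto simp: same_outside_def queue_def holds_data_def run_of_def intro!: exI)
  have fin: "finite A" "finite B" using A B finite_subset by auto
  have lens: "length ?xs \<le> 2 * card A" "length ?ys \<le> 2 * card B"
    using good_length A B fin by auto
  let ?M = "merge_unit * (3 * (length ?xs + length ?ys) + 3)"
  have loop: "runs merge_loop \<sigma>1 ?M (\<lambda>\<tau>. (\<exists>out. merge_state G [] [] (-1) out \<tau> \<and> good (A \<union> B) (-1) out \<and>
      tight out) \<and> same_outside ({5, 9, 11, 13, 14, 15, 16}, {3, 4, 5, 6, 7, 8, 9, 10}, {4}, {11}) \<sigma>1 \<tau>)"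
    using runs_same_outside[OF runs_merge_loop[OF m1 A(2) B(2) A(1) B(1)]]
    by (simp add: merge_loop_def writes_step)
  have "runs (merge_loop ;; end_merge) \<sigma>1 (?M + tm end_merge) (\<lambda>\<tau>. \<exists>G es. queue G es (f + 2) (As @ [A \<union> B]) \<tau> \<and>
      ireg \<tau> 8 = ireg \<sigma> 8 - 1 \<and> ireg \<tau> 6 = ireg \<sigma> 6)"
  proof (rule runs_Seq[OF loop _ order_refl])
    fix \<tau> assume "(\<exists>out. merge_state G [] [] (-1) out \<tau> \<and> good (A \<union> B) (-1) out \<and> tight out) \<and>
      same_outside ({5, 9, 11, 13, 14, 15, 16}, {3, 4, 5, 6, 7, 8, 9, 10}, {4}, {11}) \<sigma>1 \<tau>"
    then obtain out where out: "merge_state G [] [] (-1) out \<tau>" "good (A \<union> B) (-1) out" "tight out"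
      and s: "same_outside ({5, 9, 11, 13, 14, 15, 16}, {3, 4, 5, 6, 7, 8, 9, 10}, {4}, {11}) \<sigma>1 \<tau>" by blast
    have \<tau>: "iarr \<tau> 5 = map int es" "ireg \<tau> 7 = int (f + 2)" "ireg \<tau> 8 = ireg \<sigma> 8" "ireg \<tau> 6 = ireg \<sigma> 6"
      using s s1 r1 q by (simp_all add: same_outside_def queue_def)
    let ?\<tau> = "ev end_merge \<tau>" and ?es = "es @ [length G + length out]"
    have run: "run_of (G @ out) ?es i = run_of G es i" if "Suc i < length es" for i
      using that le by (simp add: run_of_def nth_append seg_append)
    have last: "run_of (G @ out) ?es (f + 2 + length As) = out"
    proof -
      have "es ! (f + 2 + length As) = length G"
        using last_conv_nth[of es] len \<open>last es = length G\<close> by (cases es) (auto simp: numeral_3_eq_3)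
      then show ?thesis
        using len by (simp add: run_of_def nth_append seg_append2)
    qed
    have "queue (G @ out) ?es (f + 2) (As @ [A \<union> B]) ?\<tau>"
      unfolding queue_def
    proof (intro conjI allI impI)
      show "holds_data ?\<tau>" "rarr ?\<tau> 11 = map fst (G @ out)" "iarr ?\<tau> 4 = map (\<lambda>p. int (snd p)) (G @ out)"
        "iarr ?\<tau> 5 = map int ?es" "ireg ?\<tau> 5 = int (length (G @ out))" "ireg ?\<tau> 7 = int (f + 2)"
        using out(1) \<tau> by (auto simp: merge_state_def end_merge_def holds_data_def)
      show "length ?es = f + 2 + length (As @ [A \<union> B]) + 1" using len by simp
      show "last ?es = length (G @ out)" by simp
      show "\<forall>e\<in>set ?es. e \<le> length (G @ out)"
        using q by (auto simp: queue_def)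
      fix i assume i: "i < length (As @ [A \<union> B])"
      consider (old) "i < length As" | (new) "i = length As" using i by fastforce
      then have "(As @ [A \<union> B]) ! i \<subseteq> {..<N} \<and>
          good ((As @ [A \<union> B]) ! i) (-1) (run_of (G @ out) ?es (f + 2 + i)) \<and>
          tight (run_of (G @ out) ?es (f + 2 + i))"
      proof cases
        case old
        then have "run_of (G @ out) ?es (f + 2 + i) = run_of G es (f + 2 + i)"
          using len by (intro run) simp
        then show ?thesis using As[OF old] old by (simp only: nth_append if_True)
      next
        case new
        then have "(As @ [A \<union> B]) ! i = A \<union> B" "run_of (G @ out) ?es (f + 2 + i) = out"
          using last by simp_all
        then show ?thesis using A(1) B(1) out(2,3) by (simp only: Un_subset_iff)
      qed
      then show "(As @ [A \<union> B]) ! i \<subseteq> {..<N}"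
        "good ((As @ [A \<union> B]) ! i) (-1) (run_of (G @ out) ?es (f + 2 + i))"
        "tight (run_of (G @ out) ?es (f + 2 + i))" by blast+
    qed
    then show "runs end_merge \<tau> (tm end_merge) (\<lambda>\<tau>. \<exists>G es. queue G es (f + 2) (As @ [A \<union> B]) \<tau> \<and>
      ireg \<tau> 8 = ireg \<sigma> 8 - 1 \<and> ireg \<tau> 6 = ireg \<sigma> 6)"
      using \<tau> by (intro runs_ev loopfree_merge_parts) (auto simp: end_merge_def)
  qed
  then show ?thesis
    unfolding merge_front_def \<sigma>1_def
  proof (rule runs_Seq_ev[OF loopfree_merge_parts(1)])
    \<comment> \<open>Envelopes have at most twice as many pieces as curves. So the effort plus
      slack is at most \<open>6 * (card A + card B) + 3\<close>, and 9 units per curve, with one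
      extra share of 9, suffice.\<close>
    have "?M \<le> merge_unit * (9 * (card A + card B + 1))"
      using lens by (intro mult_le_mono2) simp
    then show "tm start_merge + (?M + tm end_merge) \<le> front_unit * (card A + card B + 1)"
      by (simp add: front_unit_def algebra_simps)
  qed
qed

text \<open>The bound on the sum of the cardinalities stands in for disjointness: it survives
  unions, and it is what the time of a pass is charged to.\<close>

definition sites_of :: "nat set list \<Rightarrow> bool" where
  "sites_of As \<longleftrightarrow> \<Union> (set As) = {..<N} \<and> sum_list (map card As) \<le> N \<and> length As \<le> N"

lemma runs_merge_pass:
  assumes q: "queue G es f As \<sigma>" and As: "sites_of As" and k: "ireg \<sigma> 6 = int (length As)" and N: "0 < N"
  shows "runs merge_pass \<sigma> (pass_unit * N)
    (\<lambda>\<tau>. \<exists>G es f As'. queue G es f As' \<tau> \<and> sites_of As' \<and> ireg \<tau> 6 = int (length As') \<and>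
       length As' = length As - length As div 2)"
proof -
  let ?j = "length As div 2" and ?b = "ILess (IConst 0) (IReg 8)"
  let ?c = "iset 8 (IHalf (IReg 6)) ;; iset 6 (ISub (IReg 6) (IReg 8))"
  define \<sigma>1 where "\<sigma>1 = ev ?c \<sigma>"
  define u where "u = front_unit + bcost ?b"
  have s1: "ireg \<sigma>1 8 = int ?j" "ireg \<sigma>1 6 = int (length As - ?j)" "queue G es f As \<sigma>1"
    using k q by (simp_all add: \<sigma>1_def queue_def holds_data_def zdiv_int)
  define I where "I q \<tau> \<longleftrightarrow> (\<exists>G es f As' j. queue G es f As' \<tau> \<and> \<Union> (set As') = {..<N} \<and>
      sum_list (map card As') \<le> N \<and> ireg \<tau> 8 = int j \<and> 2 * j \<le> length As' \<and> length As' = length As - ?j + j \<and>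
      ireg \<tau> 6 = int (length As - ?j) \<and>
      q = u * (sum_list (map card (take (2 * j) As')) + j) + bcost ?b)" for q \<tau>
  have "runs (While ?b merge_front) \<sigma>1 (u * (sum_list (map card (take (2 * ?j) As)) + ?j) + bcost ?b)
      (\<lambda>\<tau>. (\<exists>q. I q \<tau>) \<and> \<not> bval ?b \<tau>)"
  proof (rule runs_While)
    fix q \<tau> assume "I q \<tau>" "bval ?b \<tau>"
    then obtain G es f As' j where I: "queue G es f As' \<tau>" "\<Union> (set As') = {..<N}"
      "sum_list (map card As') \<le> N" "ireg \<tau> 8 = int j" "2 * j \<le> length As'" "length As' = length As - ?j + j"
      "ireg \<tau> 6 = int (length As - ?j)"
      "q = u * (sum_list (map card (take (2 * j) As')) + j) + bcost ?b" and "0 < j"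
      unfolding I_def by auto
    then obtain i where j: "j = Suc i" by (cases j) auto
    then obtain A B Bs where A: "As' = A # B # Bs"
      using I(5) by (cases As'; cases "tl As'") auto
    have AB: "card (A \<union> B) \<le> card A + card B" by (rule card_Un_le)
    have "runs merge_front \<tau> (front_unit * (card A + card B + 1)) (\<lambda>\<tau>'. \<exists>G es. queue G es (f + 2) (Bs @ [A \<union> B]) \<tau>' \<and>
        ireg \<tau>' 8 = ireg \<tau> 8 - 1 \<and> ireg \<tau>' 6 = ireg \<tau> 6)"
      using runs_merge_front I(1) unfolding A by blast
    then have "runs merge_front \<tau> (front_unit * (card A + card B + 1))
        (\<lambda>\<tau>'. \<exists>q'. I q' \<tau>' \<and> bcost ?b + front_unit * (card A + card B + 1) + q' \<le> q)"
    proof (rule runs_weaken[OF _ order_refl])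
      fix \<tau>' assume "\<exists>G es. queue G es (f + 2) (Bs @ [A \<union> B]) \<tau>' \<and> ireg \<tau>' 8 = ireg \<tau> 8 - 1 \<and> ireg \<tau>' 6 = ireg \<tau> 6"
      then obtain G es where n: "queue G es (f + 2) (Bs @ [A \<union> B]) \<tau>'" "ireg \<tau>' 8 = int i"
        "ireg \<tau>' 6 = ireg \<tau> 6"
        using I(4) j by auto
      let ?q = "u * (sum_list (map card (take (2 * i) (Bs @ [A \<union> B]))) + i) + bcost ?b"
      have "I ?q \<tau>'"
        unfolding I_def
      proof (intro exI conjI)
        show "queue G es (f + 2) (Bs @ [A \<union> B]) \<tau>'" "ireg \<tau>' 8 = int i" by fact+
        show "\<Union> (set (Bs @ [A \<union> B])) = {..<N}" using I(2) A by auto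
        show "sum_list (map card (Bs @ [A \<union> B])) \<le> N" using I(3) AB A by simp
        show "2 * i \<le> length (Bs @ [A \<union> B])" "length (Bs @ [A \<union> B]) = length As - ?j + i"
          using I(5,6) A j by auto
        show "ireg \<tau>' 6 = int (length As - ?j)" using n(3) I(7) by simp
      qed simp
      \<comment> \<open>The new run is not merged again in this pass: the \<open>2 * i\<close> runs
        still to be merged are all in \<open>Bs\<close>. So each curve is paid for at most once per
        pass.\<close>
      moreover have "take (2 * i) (Bs @ [A \<union> B]) = take (2 * i) Bs"
        using I(5) A j by simp
      then have "bcost ?b + front_unit * (card A + card B + 1) + ?q \<le> q"
        unfolding I(8) j A u_def by (simp add: algebra_simps)
      ultimately show "\<exists>q'. I q' \<tau>' \<and> bcost ?b + front_unit * (card A + card B + 1) + q' \<le> q" by blast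
    qed
    then show "\<exists>T. runs merge_front \<tau> T (\<lambda>\<tau>'. \<exists>q'. I q' \<tau>' \<and> bcost ?b + T + q' \<le> q)" by blast
  next
    fix q \<tau> assume "I q \<tau>"
    then show "bcost ?b \<le> q" by (auto simp: I_def)
  next
    show "I (u * (sum_list (map card (take (2 * ?j) As)) + ?j) + bcost ?b) \<sigma>1"
      unfolding I_def
    proof (intro exI conjI)
      show "queue G es f As \<sigma>1" "ireg \<sigma>1 8 = int ?j" "ireg \<sigma>1 6 = int (length As - ?j)" by fact+
      show "\<Union> (set As) = {..<N}" "sum_list (map card As) \<le> N" using As by (auto simp: sites_of_def)
    qed auto
  qed
  then have "runs (While ?b merge_front) \<sigma>1 (u * (sum_list (map card (take (2 * ?j) As)) + ?j) + bcost ?b)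
      (\<lambda>\<tau>. \<exists>G es f As'. queue G es f As' \<tau> \<and> sites_of As' \<and> ireg \<tau> 6 = int (length As') \<and>
       length As' = length As - length As div 2)"
  proof (rule runs_weaken[OF _ order_refl])
    fix \<tau> assume "(\<exists>q. I q \<tau>) \<and> \<not> bval ?b \<tau>"
    then obtain G es f As' where I: "queue G es f As' \<tau>" "\<Union> (set As') = {..<N}"
      "sum_list (map card As') \<le> N" "length As' = length As - ?j"
      "ireg \<tau> 6 = int (length As - ?j)"
      unfolding I_def by auto
    then show "\<exists>G es f As'. queue G es f As' \<tau> \<and> sites_of As' \<and> ireg \<tau> 6 = int (length As') \<and>
       length As' = length As - length As div 2"
      using As unfolding sites_of_def by (metis diff_le_self order_trans)
  qed
  then have "runs (?c ;; While ?b merge_front) \<sigma> (pass_unit * N)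
      (\<lambda>\<tau>. \<exists>G es f As'. queue G es f As' \<tau> \<and> sites_of As' \<and> ireg \<tau> 6 = int (length As') \<and>
       length As' = length As - length As div 2)"
    unfolding \<sigma>1_def
  proof (rule runs_Seq_ev[rotated])
    have "sum_list (map card (take (2 * ?j) As)) \<le> sum_list (map card As)"
      by (metis append_take_drop_id le_add1 map_append sum_list_append)
    \<comment> \<open>At most \<open>N\<close> curves and at most \<open>N\<close> merges share the
      cost, whence the factor 2 in \<open>pass_unit\<close>.\<close>
    then have "u * (sum_list (map card (take (2 * ?j) As)) + ?j) \<le> u * (2 * N)"
      using As by (intro mult_le_mono2) (auto simp: sites_of_def)
    moreover have "x \<le> x * N" for x using N by simp
    from this[of "tm ?c + bcost ?b"] have "tm ?c + bcost ?b \<le> (tm ?c + bcost ?b) * N" .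
    ultimately have "tm ?c + (u * (sum_list (map card (take (2 * ?j) As)) + ?j) + bcost ?b) \<le>
        u * (2 * N) + (tm ?c + bcost ?b) * N" by linarith
    also have "\<dots> = pass_unit * N"
      by (simp add: pass_unit_def u_def algebra_simps)
    finally show "tm ?c + (u * (sum_list (map card (take (2 * ?j) As)) + ?j) + bcost ?b) \<le> pass_unit * N" .
  qed simp
  then show ?thesis
    unfolding merge_pass_def by (elim runs_seq_assoc)
qed

end


lemma seg_snoc: "i \<le> j \<Longrightarrow> j < length G \<Longrightarrow> seg G i (Suc j) = seg G i j @ [G ! j]"
  by (simp add: seg_def Suc_diff_le take_Suc_conv_app_nth)

definition search_less :: bexp where
  "search_less = BOr
     (lex_less (IGet 0 (IGet 3 (IReg 19))) (IGet 1 (IGet 3 (IReg 19))) (IGet 2 (IGet 3 (IReg 19)))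
        (IReg 20) (IReg 21) (IReg 22))
     (BAnd (BNot (lex_less (IReg 20) (IReg 21) (IReg 22)
        (IGet 0 (IGet 3 (IReg 19))) (IGet 1 (IGet 3 (IReg 19))) (IGet 2 (IGet 3 (IReg 19)))))
      (RLess (RGet 10 (IReg 19)) (RReg 19)))"

definition search_body :: com where
  "search_body = iset 19 (IHalf (IAdd (IReg 17) (IReg 18))) ;;
     If search_less (iset 17 (IAdd (IReg 19) (IConst 1))) (iset 18 (IReg 19))"

definition search :: com where
  "search = (iset 17 (IConst 0) ;; iset 18 (IReg 3)) ;; While (ILess (IReg 17) (IReg 18)) search_body"

definition search_unit :: nat where
  "search_unit = bcost (ILess (IReg 17) (IReg 18)) + tm search_body + tm (iset 17 (IConst 0) ;; iset 18 (IReg 3))"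

definition init_unit :: nat where
  "init_unit = tm init_queue + 2 * bcost (ILess (IReg 4) (IReg 1)) + tm init_body"

definition all_unit :: nat where
  "all_unit = pass_unit + 2 * bcost (ILess (IConst 1) (IReg 6))"

definition copy_unit :: nat where
  "copy_unit = tm copy_start + tm copy_end + 3 * bcost (ILess (IReg 4) (IReg 5)) + 2 * tm copy_body"

definition build_unit :: nat where
  "build_unit = init_unit + all_unit + copy_unit"

context site_data
begin

lemma runs_init_runs:
  assumes "holds_data \<sigma>" "ireg \<sigma> 1 = int N" "0 < N"
  shows "runs init_runs \<sigma> (init_unit * N)
    (\<lambda>\<tau>. \<exists>G es As. queue G es 0 As \<tau> \<and> sites_of As \<and> ireg \<tau> 6 = int (length As) \<and> length As = N)"
proof -
  let ?b = "ILess (IReg 4) (IReg 1)"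
  define I where "I q \<tau> \<longleftrightarrow> (\<exists>i. holds_data \<tau> \<and> rarr \<tau> 11 = map (\<lambda>_. 1) [0..<i] \<and>
      iarr \<tau> 4 = map int [0..<i] \<and> iarr \<tau> 5 = map int [0..<Suc i] \<and>
      ireg \<tau> 4 = int i \<and> ireg \<tau> 1 = int N \<and> ireg \<tau> 5 = int N \<and> ireg \<tau> 6 = int N \<and> ireg \<tau> 7 = 0 \<and> i \<le> N \<and>
      q = (bcost ?b + tm init_body) * (N - i) + bcost ?b)" for q \<tau>
  have "runs (While ?b init_body) (ev init_queue \<sigma>) ((bcost ?b + tm init_body) * N + bcost ?b)
      (\<lambda>\<tau>. (\<exists>q. I q \<tau>) \<and> \<not> bval ?b \<tau>)"
  proof (rule runs_While)
    fix q \<tau> assume "I q \<tau>" and b: "bval ?b \<tau>"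
    then obtain i where I: "holds_data \<tau>" "rarr \<tau> 11 = map (\<lambda>_. 1) [0..<i]"
      "iarr \<tau> 4 = map int [0..<i]" "iarr \<tau> 5 = map int [0..<Suc i]"
      "ireg \<tau> 4 = int i" "ireg \<tau> 1 = int N" "ireg \<tau> 5 = int N" "ireg \<tau> 6 = int N" "ireg \<tau> 7 = 0"
      "q = (bcost ?b + tm init_body) * (N - i) + bcost ?b"
      unfolding I_def by blast
    have i: "i < N" using b I by simp
    let ?q = "(bcost ?b + tm init_body) * (N - Suc i) + bcost ?b"
    have "I ?q (ev init_body \<tau>)"
      unfolding I_def using I(1-9) i
      by (intro exI[of _ "Suc i"]) (simp add: init_body_def holds_data_def map_replicate_const replicate_append_same)
    moreover have "bcost ?b + tm init_body + ?q \<le> q"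
      unfolding I(10) using i by (simp add: Suc_diff_Suc[symmetric])
    moreover have "loopfree init_body" by (simp add: init_body_def)
    ultimately show "\<exists>T. runs init_body \<tau> T (\<lambda>\<tau>. \<exists>q'. I q' \<tau> \<and> bcost ?b + T + q' \<le> q)"
      using runs_ev_pay by blast
  next
    fix q \<tau> assume "I q \<tau>" then show "bcost ?b \<le> q" by (auto simp: I_def)
  next
    show "I ((bcost ?b + tm init_body) * N + bcost ?b) (ev init_queue \<sigma>)"
      unfolding I_def using assms
      by (intro exI[of _ 0]) (simp add: init_queue_def holds_data_def)
  qed
  then have "runs (While ?b init_body) (ev init_queue \<sigma>) ((bcost ?b + tm init_body) * N + bcost ?b)
    (\<lambda>\<tau>. \<exists>G es As. queue G es 0 As \<tau> \<and> sites_of As \<and> ireg \<tau> 6 = int (length As) \<and> length As = N)"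
  proof (rule runs_weaken[OF _ order_refl])
    fix \<tau> assume "(\<exists>q. I q \<tau>) \<and> \<not> bval ?b \<tau>"
    then obtain i where I: "holds_data \<tau>" "rarr \<tau> 11 = map (\<lambda>_. 1) [0..<i]"
      "iarr \<tau> 4 = map int [0..<i]" "iarr \<tau> 5 = map int [0..<Suc i]"
      "ireg \<tau> 5 = int N" "ireg \<tau> 6 = int N" "ireg \<tau> 7 = 0" "i = N"
      unfolding I_def by force
    \<comment> \<open>A single curve is its own envelope, with one piece that extends over the whole
      copy.\<close>
    let ?G = "map (\<lambda>v. (1::real, v)) [0..<N]" and ?es = "[0..<Suc N]" and ?As = "map (\<lambda>v. {v}) [0..<N]"
    have "run_of ?G ?es i = [(1, i)]" if "i < N" for i
      using that by (simp add: run_of_def seg_Cons del: upt_Suc)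
    then have "queue ?G ?es 0 ?As \<tau>"
      unfolding queue_def using I by (auto simp: comp_def good_single simp del: good.simps)
    moreover have "sites_of ?As"
      by (auto simp: sites_of_def comp_def sum_list_triv)
    ultimately show "\<exists>G es As. queue G es 0 As \<tau> \<and> sites_of As \<and> ireg \<tau> 6 = int (length As) \<and> length As = N"
      using I(6) by (intro exI[of _ ?G] exI[of _ ?es] exI[of _ ?As]) auto
  qed
  then show ?thesis
    unfolding init_runs_def
  proof (rule runs_Seq_ev[rotated])
    have "x \<le> x * N" for x using assms(3) by simp
    from this[of "tm init_queue + bcost ?b"]
    show "tm init_queue + ((bcost ?b + tm init_body) * N + bcost ?b) \<le> init_unit * N"
      by (simp add: init_unit_def algebra_simps)
  qed (simp add: init_queue_def)
qed

lemma runs_merge_all: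
  assumes "queue G es f As \<sigma>" "sites_of As" "ireg \<sigma> 6 = int (length As)" "length As \<le> 2 ^ p" "0 < N"
  shows "runs merge_all \<sigma> (all_unit * (N * (p + 1))) (\<lambda>\<tau>. \<exists>G es f. queue G es f [{..<N}] \<tau>)"
proof -
  let ?b = "ILess (IConst 1) (IReg 6)"
  define I where "I q \<tau> \<longleftrightarrow> (\<exists>G es f As p. queue G es f As \<tau> \<and> sites_of As \<and> ireg \<tau> 6 = int (length As) \<and>
      length As \<le> 2 ^ p \<and> q = (bcost ?b + pass_unit * N) * p + bcost ?b)" for q \<tau>
  have "runs (While ?b merge_pass) \<sigma> ((bcost ?b + pass_unit * N) * p + bcost ?b)
      (\<lambda>\<tau>. (\<exists>q. I q \<tau>) \<and> \<not> bval ?b \<tau>)"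
  proof (rule runs_While)
    fix q \<tau> assume "I q \<tau>" and b: "bval ?b \<tau>"
    then obtain G es f As p where I: "queue G es f As \<tau>" "sites_of As" "ireg \<tau> 6 = int (length As)"
      "length As \<le> 2 ^ p" "q = (bcost ?b + pass_unit * N) * p + bcost ?b"
      unfolding I_def by blast
    have "1 < length As" using b I(3) by simp
    then obtain p' where p: "p = Suc p'" using I(4) by (cases p) auto
    have "runs merge_pass \<tau> (pass_unit * N) (\<lambda>\<tau>. \<exists>q'. I q' \<tau> \<and> bcost ?b + pass_unit * N + q' \<le> q)"
      using runs_merge_pass[OF I(1-3) assms(5)]
    proof (rule runs_weaken[OF _ order_refl])
      fix \<tau>' assume "\<exists>G es f As'. queue G es f As' \<tau>' \<and> sites_of As' \<and> ireg \<tau>' 6 = int (length As') \<and>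
        length As' = length As - length As div 2"
      then obtain G es f As' where n: "queue G es f As' \<tau>'" "sites_of As'" "ireg \<tau>' 6 = int (length As')"
        "length As' = length As - length As div 2" by blast
      have "length As' \<le> 2 ^ p'" using n(4) I(4) p by simp
      then have "I ((bcost ?b + pass_unit * N) * p' + bcost ?b) \<tau>'"
        unfolding I_def using n by blast
      then show "\<exists>q'. I q' \<tau>' \<and> bcost ?b + pass_unit * N + q' \<le> q"
        unfolding I(5) p by (intro exI[of _ "(bcost ?b + pass_unit * N) * p' + bcost ?b"]) simp
    qed
    then show "\<exists>T. runs merge_pass \<tau> T (\<lambda>\<tau>. \<exists>q'. I q' \<tau> \<and> bcost ?b + T + q' \<le> q)" by blast
  next
    fix q \<tau> assume "I q \<tau>" then show "bcost ?b \<le> q" by (auto simp: I_def)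
  next
    show "I ((bcost ?b + pass_unit * N) * p + bcost ?b) \<sigma>"
      unfolding I_def using assms by blast
  qed
  then show ?thesis
    unfolding merge_all_def
  proof (rule runs_weaken)
    have N: "x \<le> x * N" for x using assms(5) by simp
    have "(bcost ?b + pass_unit * N) * p + bcost ?b \<le> (bcost ?b + pass_unit * N + bcost ?b) * (p + 1)"
      by (simp add: algebra_simps)
    also have "\<dots> \<le> (all_unit * N) * (p + 1)"
      using N[of "2 * bcost ?b"] by (intro mult_le_mono1) (simp add: all_unit_def algebra_simps)
    finally show "(bcost ?b + pass_unit * N) * p + bcost ?b \<le> all_unit * (N * (p + 1))"
      by (simp only: mult.assoc)
  next
    fix \<tau> assume "(\<exists>q. I q \<tau>) \<and> \<not> bval ?b \<tau>"
    then obtain G es f As where I: "queue G es f As \<tau>" "sites_of As" "length As \<le> 1"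
      unfolding I_def by force
    then obtain A where "As = [A]" using assms(5) by (cases As) (auto simp: sites_of_def)
    then show "\<exists>G es f. queue G es f [{..<N}] \<tau>" using I(1,2) by (auto simp: sites_of_def)
  qed
qed

definition holds_envelope :: "(real \<times> nat) list \<Rightarrow> store \<Rightarrow> bool" where
  "holds_envelope L \<sigma> \<longleftrightarrow> rarr \<sigma> 10 = map fst L \<and> iarr \<sigma> 3 = map (\<lambda>p. int (snd p)) L \<and>
     ireg \<sigma> 3 = int (length L) \<and> good {..<N} (-1) L \<and> length L \<le> 2 * N"

lemma runs_copy_run:
  assumes q: "queue G es f [{..<N}] \<sigma>" and N: "0 < N"
  shows "runs copy_run \<sigma> (copy_unit * N) (\<lambda>\<tau>. \<exists>L. holds_envelope L \<tau> \<and>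
    rarr \<tau> 11 = [] \<and> iarr \<tau> 4 = [] \<and> iarr \<tau> 5 = [])"
proof -
  let ?b = "ILess (IReg 4) (IReg 5)"
  define s where "s = es ! f"
  define n where "n = length G"
  define L where "L = seg G s n"
  have es: "length es = f + 2" "last es = n" "es ! f \<le> n"
    using q by (auto simp: queue_def n_def)
  then have e: "es ! Suc f = n" using last_conv_nth[of es] by (cases es) auto
  have g: "good {..<N} (-1) L" "tight L"
    using q e by (auto simp: queue_def run_of_def L_def s_def n_def)
  have len: "length L \<le> 2 * N" using good_length[OF g(1) _ _ g(2)] by simp
  have sn: "s \<le> n" using es by (simp add: s_def)
  have lL: "length L = n - s" by (simp add: L_def length_seg n_def)
  let ?\<sigma> = "ev copy_start \<sigma>"
  define I where "I q \<tau> \<longleftrightarrow> (\<exists>i. rarr \<tau> 11 = map fst G \<and> iarr \<tau> 4 = map (\<lambda>p. int (snd p)) G \<and>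
      rarr \<tau> 10 = map fst (seg G s i) \<and> iarr \<tau> 3 = map (\<lambda>p. int (snd p)) (seg G s i) \<and>
      ireg \<tau> 4 = int i \<and> ireg \<tau> 5 = int n \<and> ireg \<tau> 3 = int (length L) \<and> s \<le> i \<and> i \<le> n \<and>
      q = (bcost ?b + tm copy_body) * (n - i) + bcost ?b)" for q and \<tau> :: store
  have "runs (While ?b copy_body) ?\<sigma> ((bcost ?b + tm copy_body) * (n - s) + bcost ?b)
      (\<lambda>\<tau>. (\<exists>q. I q \<tau>) \<and> \<not> bval ?b \<tau>)"
  proof (rule runs_While)
    fix q \<tau> assume "I q \<tau>" and b: "bval ?b \<tau>"
    then obtain i where I: "rarr \<tau> 11 = map fst G" "iarr \<tau> 4 = map (\<lambda>p. int (snd p)) G"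
      "rarr \<tau> 10 = map fst (seg G s i)" "iarr \<tau> 3 = map (\<lambda>p. int (snd p)) (seg G s i)"
      "ireg \<tau> 4 = int i" "ireg \<tau> 5 = int n" "ireg \<tau> 3 = int (length L)" "s \<le> i"
      "q = (bcost ?b + tm copy_body) * (n - i) + bcost ?b"
      unfolding I_def by blast
    have i: "i < n" using b I by simp
    let ?q = "(bcost ?b + tm copy_body) * (n - Suc i) + bcost ?b"
    have "I ?q (ev copy_body \<tau>)"
      unfolding I_def using I(1-8) i
      by (intro exI[of _ "Suc i"]) (simp add: copy_body_def seg_snoc n_def)
    moreover have "bcost ?b + tm copy_body + ?q \<le> q"
      unfolding I(9) using i by (simp add: Suc_diff_Suc[symmetric])
    moreover have "loopfree copy_body" by (simp add: copy_body_def)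
    ultimately show "\<exists>T. runs copy_body \<tau> T (\<lambda>\<tau>. \<exists>q'. I q' \<tau> \<and> bcost ?b + T + q' \<le> q)"
      using runs_ev_pay by blast
  next
    fix q \<tau> assume "I q \<tau>" then show "bcost ?b \<le> q" by (auto simp: I_def)
  next
    have g: "get (iarr \<sigma> 5) (int i) = int (es ! i)" if "i < length es" for i
      using q that by (simp add: queue_def)
    have "rarr \<sigma> 11 = map fst G" "iarr \<sigma> 4 = map (\<lambda>p. int (snd p)) G" "ireg \<sigma> 7 = int f"
      using q by (simp_all add: queue_def)
    then show "I ((bcost ?b + tm copy_body) * (n - s) + bcost ?b) ?\<sigma>"
      unfolding I_def using g[of f] g[of "Suc f"] es e sn lL
      by (intro exI[of _ s]) (simp add: copy_start_def s_def add.commute)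
  qed
  then have loop: "runs (While ?b copy_body) ?\<sigma> ((bcost ?b + tm copy_body) * (n - s) + bcost ?b)
      (\<lambda>\<tau>. rarr \<tau> 10 = map fst L \<and> iarr \<tau> 3 = map (\<lambda>p. int (snd p)) L \<and> ireg \<tau> 3 = int (length L))"
  proof (rule runs_weaken[OF _ order_refl])
    fix \<tau> assume "(\<exists>q. I q \<tau>) \<and> \<not> bval ?b \<tau>"
    then obtain i where "rarr \<tau> 10 = map fst (seg G s i)" "iarr \<tau> 3 = map (\<lambda>p. int (snd p)) (seg G s i)"
      "ireg \<tau> 3 = int (length L)" "i = n"
      unfolding I_def by force
    then show "rarr \<tau> 10 = map fst L \<and> iarr \<tau> 3 = map (\<lambda>p. int (snd p)) L \<and> ireg \<tau> 3 = int (length L)"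
      by (simp add: L_def)
  qed
  have "runs (While ?b copy_body ;; copy_end) ?\<sigma> ((bcost ?b + tm copy_body) * (n - s) + bcost ?b + tm copy_end)
      (\<lambda>\<tau>. \<exists>L. holds_envelope L \<tau> \<and> rarr \<tau> 11 = [] \<and> iarr \<tau> 4 = [] \<and> iarr \<tau> 5 = [])"
  proof (rule runs_Seq[OF loop _ order_refl])
    fix \<tau> :: store assume "rarr \<tau> 10 = map fst L \<and> iarr \<tau> 3 = map (\<lambda>p. int (snd p)) L \<and> ireg \<tau> 3 = int (length L)"
    then show "runs copy_end \<tau> (tm copy_end)
        (\<lambda>\<tau>. \<exists>L. holds_envelope L \<tau> \<and> rarr \<tau> 11 = [] \<and> iarr \<tau> 4 = [] \<and> iarr \<tau> 5 = [])"
      using g(1) len by (intro runs_ev exI[of _ L]) (simp_all add: copy_end_def holds_envelope_def)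
  qed
  then show ?thesis
    unfolding copy_run_def
  proof (rule runs_Seq_ev[rotated])
    have x: "x \<le> x * N" for x using N by simp
    have "(bcost ?b + tm copy_body) * (n - s) \<le> (bcost ?b + tm copy_body) * (2 * N)"
      using len lL by (intro mult_le_mono2) simp
    then show "tm copy_start + ((bcost ?b + tm copy_body) * (n - s) + bcost ?b + tm copy_end) \<le> copy_unit * N"
      using x[of "tm copy_start + bcost ?b + tm copy_end"] unfolding copy_unit_def add_mult_distrib
      by (simp add: algebra_simps)
  qed (simp add: copy_start_def)
qed

lemma runs_build:
  assumes "holds_data \<sigma>" "ireg \<sigma> 1 = int N" "0 < N" "N \<le> 2 ^ p"
  shows "runs build \<sigma> (build_unit * (N * (p + 1)))
    (\<lambda>\<tau>. (\<exists>L. holds_envelope L \<tau>) \<and> rarr \<tau> 11 = [] \<and> iarr \<tau> 4 = [] \<and> iarr \<tau> 5 = [] \<and>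
      same_outside ({3, 4, 5, 6, 7, 8, 9, 10, 11, 12, 13, 14, 15, 16},
        {3, 4, 5, 6, 7, 8, 9, 10}, {3, 4, 5}, {10, 11}) \<sigma> \<tau>)"
proof -
  have "runs build \<sigma> (init_unit * N + (all_unit * (N * (p + 1)) + copy_unit * N))
    (\<lambda>\<tau>. \<exists>L. holds_envelope L \<tau> \<and> rarr \<tau> 11 = [] \<and> iarr \<tau> 4 = [] \<and> iarr \<tau> 5 = [])"
    unfolding build_def
  proof (rule runs_Seq[OF runs_init_runs[OF assms(1-3)] _ order_refl])
    fix \<tau> assume "\<exists>G es As. queue G es 0 As \<tau> \<and> sites_of As \<and> ireg \<tau> 6 = int (length As) \<and> length As = N"
    then obtain G es As where q: "queue G es 0 As \<tau>" "sites_of As" "ireg \<tau> 6 = int (length As)" "length As = N"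
      by blast
    then have "length As \<le> 2 ^ p" using assms(4) by simp
    from runs_merge_all[OF q(1-3) this assms(3)]
    show "runs (merge_all ;; copy_run) \<tau> (all_unit * (N * (p + 1)) + copy_unit * N)
      (\<lambda>\<tau>. \<exists>L. holds_envelope L \<tau> \<and> rarr \<tau> 11 = [] \<and> iarr \<tau> 4 = [] \<and> iarr \<tau> 5 = [])"
      by (rule runs_Seq) (use runs_copy_run[OF _ assms(3)] in auto)
  qed
  from runs_same_outside[OF this] show ?thesis
  proof (rule runs_weaken)
    have "x * N \<le> x * (N * (p + 1))" for x by simp
    from add_mono[OF this[of init_unit] this[of copy_unit]]
    show "init_unit * N + (all_unit * (N * (p + 1)) + copy_unit * N) \<le> build_unit * (N * (p + 1))"
      unfolding build_unit_def add_mult_distrib by linarith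
  qed (auto simp: writes_build)
qed

section \<open>Binary search in an envelope\<close>

definition piece_less :: "cell \<Rightarrow> real \<Rightarrow> real \<times> nat \<Rightarrow> bool" where
  "piece_less z s p \<longleftrightarrow> key (snd p) < z \<or> key (snd p) = z \<and> fst p < s"

definition locate :: "(real \<times> nat) list \<Rightarrow> cell \<Rightarrow> real \<Rightarrow> nat" where
  "locate L z s = length (takeWhile (piece_less z s) L)"

lemma locate_le: "locate L z s \<le> length L"
  by (simp add: locate_def length_takeWhile_le)

text \<open>By \<open>good_sorted\<close> the pieces are ordered lexicographically by key and end,
  so the pieces before the target form a prefix, and testing one piece tells on which side of the
  boundary it lies.\<close>

lemma piece_less_iff:
  assumes "good A lo L" "i < length L"
  shows "piece_less z s (L ! i) \<longleftrightarrow> i < locate L z s"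
proof
  assume "i < locate L z s"
  then show "piece_less z s (L ! i)"
    unfolding locate_def by (metis nth_mem set_takeWhileD takeWhile_nth)
next
  assume l: "piece_less z s (L ! i)"
  show "i < locate L z s"
  proof (rule ccontr)
    assume n: "\<not> i < locate L z s"
    then have "\<not> piece_less z s (L ! locate L z s)"
      using assms(2) unfolding locate_def by (intro nth_length_takeWhile) auto
    moreover have "locate L z s < i \<Longrightarrow> piece_less z s (L ! locate L z s)"
      using good_sorted[OF assms(1) _ assms(2), of "locate L z s"] l by (auto simp: piece_less_def)
    ultimately show False using n l by (cases "locate L z s = i") auto
  qed
qed

lemma locate_found:
  assumes "good {..<N} (-1) L" "a < N" "-1 < s" "s \<le> 1"
  shows "locate L (key a) s < length L" "key (snd (L ! locate L (key a) s)) = key a"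
    "snd (L ! locate L (key a) s) < N"
    "s < 1 \<Longrightarrow> b < N \<Longrightarrow> key b = key a \<Longrightarrow> F b s \<le> F (snd (L ! locate L (key a) s)) s"
proof -
  from good_lookup[OF assms(1) _ _ assms(3,4), of a] assms(2,3) obtain i where
    i: "i < length L" "key (snd (L ! i)) = key a" "snd (L ! i) < N" "s \<le> fst (L ! i)"
    "\<forall>j<i. key (snd (L ! j)) < key a \<or> key (snd (L ! j)) = key a \<and> fst (L ! j) < s"
    "s < 1 \<longrightarrow> (\<forall>b\<in>{..<N}. key b = key a \<longrightarrow> F b s \<le> F (snd (L ! i)) s)" by auto
  have "\<not> piece_less (key a) s (L ! i)" using i by (simp add: piece_less_def)
  then have "locate L (key a) s \<le> i" using piece_less_iff[OF assms(1) i(1)] by simp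
  moreover have "j < locate L (key a) s" if "j < i" for j
    using piece_less_iff[OF assms(1), of j "key a" s] i(1,5) that by (simp add: piece_less_def)
  ultimately have l: "locate L (key a) s = i" by (meson le_neq_implies_less less_irrefl)
  then show "locate L (key a) s < length L" "key (snd (L ! locate L (key a) s)) = key a"
    "snd (L ! locate L (key a) s) < N"
    "s < 1 \<Longrightarrow> b < N \<Longrightarrow> key b = key a \<Longrightarrow> F b s \<le> F (snd (L ! locate L (key a) s)) s"
    using i by auto
qed

lemma runs_search:
  assumes "holds_envelope L \<sigma>" "iarr \<sigma> 0 = K1" "iarr \<sigma> 1 = K2" "iarr \<sigma> 2 = K3" "N \<le> 2 ^ p"
  shows "runs search \<sigma> (search_unit * (p + 3))
    (\<lambda>\<tau>. ireg \<tau> 17 = int (locate L (Cell (ireg \<sigma> 20) (ireg \<sigma> 21) (ireg \<sigma> 22)) (rreg \<sigma> 19)) \<and>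
      same_outside ({17, 18, 19}, {}, {}, {}) \<sigma> \<tau>)"
proof -
  let ?b = "ILess (IReg 17) (IReg 18)"
  define z s where "z = Cell (ireg \<sigma> 20) (ireg \<sigma> 21) (ireg \<sigma> 22)" and "s = rreg \<sigma> 19"
  have g: "good {..<N} (-1) L" "length L \<le> 2 * N" using assms(1) by (auto simp: holds_envelope_def)
  define I where "I q \<tau> \<longleftrightarrow> (\<exists>lo hi k. same_outside ({17, 18, 19}, {}, {}, {}) \<sigma> \<tau> \<and>
      ireg \<tau> 17 = int lo \<and> ireg \<tau> 18 = int hi \<and> lo \<le> locate L z s \<and> locate L z s \<le> hi \<and> hi \<le> length L \<and>
      hi - lo < 2 ^ k \<and> q = (bcost ?b + tm search_body) * k + bcost ?b)" for q \<tau>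
  let ?\<sigma> = "ev (iset 17 (IConst 0) ;; iset 18 (IReg 3)) \<sigma>"
  have "runs (While ?b search_body) ?\<sigma> ((bcost ?b + tm search_body) * (p + 2) + bcost ?b)
      (\<lambda>\<tau>. (\<exists>q. I q \<tau>) \<and> \<not> bval ?b \<tau>)"
  proof (rule runs_While)
    fix q \<tau> assume "I q \<tau>" and b: "bval ?b \<tau>"
    then obtain lo hi k where I: "same_outside ({17, 18, 19}, {}, {}, {}) \<sigma> \<tau>"
      "ireg \<tau> 17 = int lo" "ireg \<tau> 18 = int hi" "lo \<le> locate L z s" "locate L z s \<le> hi" "hi \<le> length L"
      "hi - lo < 2 ^ k" "q = (bcost ?b + tm search_body) * k + bcost ?b"
      unfolding I_def by blast
    have lh: "lo < hi" using b I by simp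
    then obtain k' where k: "k = Suc k'" using I(7) by (cases k) auto
    let ?m = "(lo + hi) div 2"
    have m: "lo \<le> ?m" "?m < hi" "?m < length L" using lh I(6) by auto
    let ?\<tau> = "ev (iset 19 (IHalf (IAdd (IReg 17) (IReg 18)))) \<tau>"
    have \<tau>: "ireg ?\<tau> 19 = int ?m" using I(2,3) by (simp add: zdiv_int)
    have d: "iarr \<tau> a = iarr \<sigma> a" "rarr \<tau> a = rarr \<sigma> a" for a
      using I(1) by (simp_all add: same_outside_def)
    have "bval search_less ?\<tau> \<longleftrightarrow> piece_less z s (L ! ?m)"
    proof -
      have v: "get (iarr \<sigma> 3) (int ?m) = int (snd (L ! ?m))" "get (rarr \<sigma> 10) (int ?m) = fst (L ! ?m)"
        using assms(1) m by (simp_all add: holds_envelope_def)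
      have z: "Cell (ireg \<tau> 20) (ireg \<tau> 21) (ireg \<tau> 22) = z" "rreg \<tau> 19 = s"
        using I(1) by (simp_all add: same_outside_def z_def s_def)
      have kk: "Cell (get (iarr \<sigma> 0) (int (snd (L ! ?m)))) (get (iarr \<sigma> 1) (int (snd (L ! ?m))))
          (get (iarr \<sigma> 2) (int (snd (L ! ?m)))) = key (snd (L ! ?m))"
        using assms(2-4) by (simp add: key_def)
      have "bval search_less ?\<tau> \<longleftrightarrow> key (snd (L ! ?m)) < z \<or> \<not> z < key (snd (L ! ?m)) \<and> fst (L ! ?m) < s"
        unfolding search_less_def bval_BOr bval.simps bval_lex_less ival.simps rval.simps \<tau>
        using v z kk by (simp add: d)
      then show ?thesis by (auto simp: piece_less_def not_less_iff_gr_or_eq)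
    qed
    then have c: "bval search_less ?\<tau> \<longleftrightarrow> ?m < locate L z s"
      using piece_less_iff[OF g(1) m(3)] by simp
    let ?q = "(bcost ?b + tm search_body) * k' + bcost ?b"
    have "I ?q (ev search_body \<tau>)"
    proof (cases "?m < locate L z s")
      case True
      then have "ev search_body \<tau> = ev (iset 17 (IAdd (IReg 19) (IConst 1))) ?\<tau>"
        using c by (simp add: search_body_def)
      moreover have "hi - Suc ?m < 2 ^ k'" using I(7) k by (simp; linarith)
      ultimately show ?thesis
        unfolding I_def using I(1,3,5,6) True \<tau>
        by (intro exI[of _ "Suc ?m"] exI[of _ hi] exI[of _ k']) (simp add: same_outside_def)
    next
      case False
      then have "ev search_body \<tau> = ev (iset 18 (IReg 19)) ?\<tau>"
        using c by (simp add: search_body_def)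
      moreover have "?m - lo < 2 ^ k'" using I(7) k by (simp; linarith)
      ultimately show ?thesis
        unfolding I_def using I(1,2,4,6) False \<tau> m
        by (intro exI[of _ lo] exI[of _ ?m] exI[of _ k']) (simp add: same_outside_def)
    qed
    moreover have "bcost ?b + tm search_body + ?q \<le> q" unfolding I(8) k by simp
    moreover have "loopfree search_body" by (simp add: search_body_def)
    ultimately show "\<exists>T. runs search_body \<tau> T (\<lambda>\<tau>. \<exists>q'. I q' \<tau> \<and> bcost ?b + T + q' \<le> q)"
      using runs_ev_pay by blast
  next
    fix q \<tau> assume "I q \<tau>" then show "bcost ?b \<le> q" by (auto simp: I_def)
  next
    \<comment> \<open>There are at most \<open>2 * N\<close> pieces and
      \<open>N \<le> 2 ^ p\<close>. The strict bound makes the interval empty after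
      \<open>p + 2\<close> halvings.\<close>
    have "length L < 2 ^ (p + 2)"
      using g(2) assms(5) zero_less_power[of "2::nat" p] by (simp; linarith)
    then show "I ((bcost ?b + tm search_body) * (p + 2) + bcost ?b) ?\<sigma>"
      unfolding I_def using assms(1) locate_le
      by (intro exI[of _ 0] exI[of _ "length L"] exI[of _ "p + 2"]) (simp add: same_outside_def holds_envelope_def)
  qed
  then have "runs (While ?b search_body) ?\<sigma> ((bcost ?b + tm search_body) * (p + 2) + bcost ?b)
      (\<lambda>\<tau>. ireg \<tau> 17 = int (locate L z s) \<and> same_outside ({17, 18, 19}, {}, {}, {}) \<sigma> \<tau>)"
    by (rule runs_weaken[OF _ order_refl]) (auto simp: I_def)
  then show ?thesis
    unfolding search_def z_def s_def
    by (rule runs_Seq_ev[rotated]) (simp_all add: search_unit_def algebra_simps)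
qed

end


section \<open>Sites, cells and candidates\<close>

text \<open>The first component is the direction, 0 for the sites themselves and 1 for their mirror
  images. A disc of level \<open>l\<close> that contains the query point has its center at most 6
  columns and 6 rows away, see \<open>offset_bound\<close>. The list has
  \<open>2 * 13 * 13 = 338\<close> entries.\<close>

definition offsets :: "(nat \<times> int \<times> int) list" where
  "offsets = List.product [0, 1] (List.product [-6..6] [-6..6])"

lemma set_offsets: "(d, dx, dy) \<in> set offsets \<longleftrightarrow> d < 2 \<and> dx \<in> {-6..6} \<and> dy \<in> {-6..6}"
  unfolding offsets_def set_product set_upto by (auto simp only: list.set mem_Times_iff fst_conv snd_conv)

text \<open>Coordinates are scaled such that the smallest radius is 2.  Every site occurs twice, as itself
  and mirrored at the horizontal axis: an envelope takes care of the points above its origin only.\<close>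

locale sites =
  fixes ps :: "point list" and r :: "point \<Rightarrow> real"
  assumes nonempty: "ps \<noteq> []" and radius_pos: "p \<in> set ps \<Longrightarrow> 0 < r p"
begin

definition n :: nat where "n = length ps"
definition rmin :: real where "rmin = Min (r ` set ps)"
definition idx :: "nat \<Rightarrow> nat" where "idx v = (if v < n then v else v - n)"
definition dir :: "nat \<Rightarrow> nat" where "dir v = (if v < n then 0 else 1)"
definition sg :: "nat \<Rightarrow> real" where "sg d = (if d = 0 then 1 else -1)"
definition sx :: "nat \<Rightarrow> real" where "sx v = 2 * fst (ps ! idx v) / rmin"
definition sy :: "nat \<Rightarrow> real" where "sy v = sg (dir v) * (2 * snd (ps ! idx v) / rmin)"
definition sr :: "nat \<Rightarrow> real" where "sr v = 2 * r (ps ! idx v) / rmin"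
definition lev :: "nat \<Rightarrow> nat" where "lev v = (LEAST l. sr v < 4 * 2 ^ l)"

text \<open>Level and direction are packed into one integer, so that a site and its mirror image
  never share a cell.\<close>

definition K1 :: "int list" where "K1 = map (\<lambda>v. int (lev v) + int (lev v) + int (dir v)) [0..<2 * n]"
definition K2 :: "int list" where "K2 = map (\<lambda>v. grid_coord (int (lev v)) (sx v)) [0..<2 * n]"
definition K3 :: "int list" where "K3 = map (\<lambda>v. grid_coord (int (lev v)) (sy v)) [0..<2 * n]"

text \<open>A disc of weight 1 centered at the origin gives the constant curve 1. All comparisons
  are decided by the index, and the envelope is the sorted list of the non-empty cells with a site
  for each.\<close>

sublocale first: site_data K1 K2 K3 "replicate (2 * n) 0" "replicate (2 * n) 0" "replicate (2 * n) 1" "2 * n"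
  by standard simp

lemma n_pos: "0 < n"
  using nonempty by (simp add: n_def)

lemma rmin_pos: "0 < rmin"
  using nonempty radius_pos by (auto simp: rmin_def)

lemma rmin_le: "p \<in> set ps \<Longrightarrow> rmin \<le> r p"
  by (simp add: rmin_def)

lemma idx_less: "v < 2 * n \<Longrightarrow> idx v < n"
  by (auto simp: idx_def)

lemma idx_in: "v < 2 * n \<Longrightarrow> ps ! idx v \<in> set ps"
  using idx_less by (simp add: n_def)

lemma dir_less: "dir v < 2"
  by (simp add: dir_def)

lemma key_eq: "v < 2 * n \<Longrightarrow> first.key v =
    Cell (int (lev v) + int (lev v) + int (dir v)) (grid_coord (int (lev v)) (sx v)) (grid_coord (int (lev v)) (sy v))"
  unfolding first.key_def by (simp add: K1_def K2_def K3_def)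

lemma level_dir_eq:
  "int l + int l + int d = int l' + int l' + int d' \<Longrightarrow> d < 2 \<Longrightarrow> d' < 2 \<Longrightarrow> l = l' \<and> d = d'"
  by presburger

lemma lev_bounds:
  assumes "v < 2 * n"
  shows "2 * 2 ^ lev v \<le> sr v" "sr v < 4 * 2 ^ lev v"
proof -
  have "1 \<le> r (ps ! idx v) / rmin"
    using rmin_le[OF idx_in[OF assms]] rmin_pos by simp
  then have two: "2 \<le> sr v" by (simp add: sr_def)
  obtain k where "sr v / 4 < 2 ^ k" using real_arch_pow[of 2 "sr v / 4"] by auto
  then have "sr v < 4 * 2 ^ k" by simp
  then show "sr v < 4 * 2 ^ lev v" unfolding lev_def by (rule LeastI)
  show "2 * 2 ^ lev v \<le> sr v"
  proof (cases "lev v")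
    case 0
    then show ?thesis using two by simp
  next
    case (Suc l)
    then have "\<not> sr v < 4 * 2 ^ l"
      using not_less_Least[of l "\<lambda>l. sr v < 4 * 2 ^ l"] by (simp add: lev_def)
    then show ?thesis using Suc by simp
  qed
qed

lemma lev_le_iff: "v < 2 * n \<Longrightarrow> l \<le> lev v \<Longrightarrow> sr v < 4 * 2 ^ l \<longleftrightarrow> l = lev v"
  by (metis lev_bounds(2) lev_def le_neq_implies_less not_less_Least)

lemma grid_coord_bounds:
  assumes "w = 2 ^ l / sqrt 2"
  shows "w * grid_coord (int l) x \<le> x" "x < w * grid_coord (int l) x + w" "0 < w"
proof -
  show w: "0 < w" using assms by simp
  have g: "grid_coord (int l) x = \<lfloor>x / w\<rfloor>" by (simp add: grid_coord_def assms)
  have "real_of_int \<lfloor>x / w\<rfloor> \<le> x / w" "x / w < real_of_int \<lfloor>x / w\<rfloor> + 1" by linarith+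
  then have "real_of_int \<lfloor>x / w\<rfloor> * w \<le> x" "x < (real_of_int \<lfloor>x / w\<rfloor> + 1) * w"
    unfolding pos_le_divide_eq[OF w] pos_divide_less_eq[OF w] .
  then show "w * grid_coord (int l) x \<le> x" "x < w * grid_coord (int l) x + w"
    unfolding g by (simp_all add: algebra_simps)
qed

lemma same_cell:
  assumes "u < 2 * n" "v < 2 * n" "first.key u = first.key v" "w = 2 ^ lev v / sqrt 2"
  shows "lev u = lev v" "dir u = dir v" "\<bar>sx u - sx v\<bar> < w" "\<bar>sy u - sy v\<bar> < w"
proof -
  have e: "int (lev u) + int (lev u) + int (dir u) = int (lev v) + int (lev v) + int (dir v)"
    "grid_coord (int (lev u)) (sx u) = grid_coord (int (lev v)) (sx v)"
    "grid_coord (int (lev u)) (sy u) = grid_coord (int (lev v)) (sy v)"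
    using assms(3) by (simp_all add: key_eq assms(1,2))
  show l: "lev u = lev v" "dir u = dir v" using level_dir_eq[OF e(1) dir_less dir_less] by auto
  show "\<bar>sx u - sx v\<bar> < w" "\<bar>sy u - sy v\<bar> < w"
    using grid_coord_bounds(1,2)[OF assms(4), of "sx u"] grid_coord_bounds(1,2)[OF assms(4), of "sx v"]
      grid_coord_bounds(1,2)[OF assms(4), of "sy u"] grid_coord_bounds(1,2)[OF assms(4), of "sy v"] e(2,3) l(1)
    by (auto simp: abs_less_iff)
qed

lemma width_square:
  assumes "w = 2 ^ l / sqrt 2"
  shows "2 * (w * w) = 2 ^ l * 2 ^ l" "0 < w" "w < 2 ^ l"
proof -
  show "2 * (w * w) = 2 ^ l * 2 ^ l" by (simp add: assms)
  show "0 < w" by (simp add: assms)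
  have "1 < sqrt 2" by simp
  then show "w < 2 ^ l" by (simp add: assms divide_less_eq)
qed

definition qx :: "point \<Rightarrow> real" where "qx x = 2 * fst x / rmin"
definition qy :: "nat \<Rightarrow> point \<Rightarrow> real" where "qy d x = sg d * (2 * snd x / rmin)"

lemma scaled_disc:
  assumes "v < 2 * n" "dir v = d"
  shows "(sx v - qx x) * (sx v - qx x) + (sy v - qy d x) * (sy v - qy d x) \<le> sr v * sr v \<longleftrightarrow>
    x \<in> cball (ps ! idx v) (r (ps ! idx v))"
proof -
  let ?p = "ps ! idx v" and ?k = "2 / rmin"
  have k: "0 < ?k" using rmin_pos by simp
  have s: "sg d * sg d = 1" by (simp add: sg_def)
  have "(sy v - qy d x) * (sy v - qy d x) = (sg d * sg d) * ((?k * (snd ?p - snd x)) * (?k * (snd ?p - snd x)))"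
    by (simp add: sy_def qy_def assms(2) algebra_simps)
  then have y: "(sy v - qy d x) * (sy v - qy d x) = ?k * ?k * (snd ?p - snd x)\<^sup>2"
    by (simp add: s power2_eq_square algebra_simps)
  have x: "(sx v - qx x) * (sx v - qx x) = ?k * ?k * (fst ?p - fst x)\<^sup>2"
    by (simp add: sx_def qx_def power2_eq_square algebra_simps)
  have r: "sr v * sr v = ?k * ?k * (r ?p)\<^sup>2"
    by (simp add: sr_def power2_eq_square)
  have "(sx v - qx x) * (sx v - qx x) + (sy v - qy d x) * (sy v - qy d x) \<le> sr v * sr v \<longleftrightarrow>
      ?k * ?k * ((fst ?p - fst x)\<^sup>2 + (snd ?p - snd x)\<^sup>2) \<le> ?k * ?k * (r ?p)\<^sup>2"
    unfolding x y r by (simp add: algebra_simps)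
  also have "\<dots> \<longleftrightarrow> (fst ?p - fst x)\<^sup>2 + (snd ?p - snd x)\<^sup>2 \<le> (r ?p)\<^sup>2"
    using k by (intro mult_le_cancel_left_pos mult_pos_pos)
  also have "\<dots> \<longleftrightarrow> sqrt ((fst ?p - fst x)\<^sup>2 + (snd ?p - snd x)\<^sup>2) \<le> r ?p"
    using radius_pos[OF idx_in[OF assms(1)]] real_sqrt_le_iff[of _ "(r ?p)\<^sup>2"] by (simp add: real_sqrt_le_iff)
  also have "sqrt ((fst ?p - fst x)\<^sup>2 + (snd ?p - snd x)\<^sup>2) = dist ?p x"
    by (cases ?p; cases x) (simp add: dist_Pair_Pair dist_real_def)
  finally show ?thesis by simp
qed

lemma scaled_disc_sites:
  assumes "u < 2 * n" "v < 2 * n" "dir u = dir v"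
    "(sx u - sx v) * (sx u - sx v) + (sy u - sy v) * (sy u - sy v) \<le> sr u * sr u"
  shows "ps ! idx v \<in> cball (ps ! idx u) (r (ps ! idx u))"
  using scaled_disc[OF assms(1) refl, of "ps ! idx v"] assms(3,4) by (simp add: qx_def qy_def sx_def sy_def)

lemma reach_step:
  assumes "u < 2 * n" "v < 2 * n" "ps ! idx v \<in> cball (ps ! idx u) (r (ps ! idx u))"
  shows "ps ! idx u \<rightarrow>\<^sup>*\<^bsub>transmission_graph (set ps) r\<^esub> ps ! idx v"
proof -
  let ?G = "transmission_graph (set ps) r"
  have in_P: "ps ! idx u \<in> verts ?G" "ps ! idx v \<in> verts ?G"
    using idx_in assms by (auto simp: transmission_graph_def)
  show ?thesis
  proof (cases "ps ! idx u = ps ! idx v")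
    case True
    then show ?thesis using in_P unfolding reachable_def by (simp add: rtrancl_on_refl)
  next
    case False
    then have "(ps ! idx u, ps ! idx v) \<in> arcs_ends ?G"
      using assms(3) in_P by (auto simp: arcs_ends_def arc_to_ends_def transmission_graph_def)
    then show ?thesis
      using in_P unfolding reachable_def by (meson rtrancl_on_refl rtrancl_on_into_rtrancl_on)
  qed
qed

lemma reach_trans:
  "a \<rightarrow>\<^sup>*\<^bsub>transmission_graph (set ps) r\<^esub> b \<Longrightarrow> b \<rightarrow>\<^sup>*\<^bsub>transmission_graph (set ps) r\<^esub> c \<Longrightarrow>
   a \<rightarrow>\<^sup>*\<^bsub>transmission_graph (set ps) r\<^esub> c"
  unfolding reachable_def by (rule rtrancl_on_trans)

end

text \<open>The sites of one cell share the origin that lies below their representative \<open>g v\<close>, at the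
  distance of the cell diameter.\<close>

locale grouped = sites +
  fixes g :: "nat \<Rightarrow> nat"
  assumes g_less: "v < 2 * n \<Longrightarrow> g v < 2 * n"
    and g_key: "v < 2 * n \<Longrightarrow> first.key (g v) = first.key v"
    and g_eq: "u < 2 * n \<Longrightarrow> v < 2 * n \<Longrightarrow> first.key u = first.key v \<Longrightarrow> g u = g v"
begin

definition gx :: "nat \<Rightarrow> real" where "gx v = sx v - sx (g v)"
definition gy :: "nat \<Rightarrow> real" where "gy v = sy v - sy (g v) + 2 ^ lev v"
definition gw :: "nat \<Rightarrow> real" where "gw v = sr v * sr v - gx v * gx v - gy v * gy v"

definition PX :: "real list" where "PX = map gx [0..<2 * n]"
definition PY :: "real list" where "PY = map gy [0..<2 * n]"
definition W :: "real list" where "W = map gw [0..<2 * n]"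

text \<open>Positive weight means that the origin is interior to the disc. For cell diameter
  \<open>h\<close> and cell width \<open>w\<close>, where \<open>2 * (w * w) = h * h\<close>, the
  squared distance of center and origin is below \<open>w * w + (w + h) * (w + h)\<close>, which is
  \<open>2 * h * h + 2 * w * h\<close>, hence at most \<open>4 * h * h\<close>. The radius is at
  least \<open>2 * h\<close>; this is the purpose of starting at radius 2.\<close>

lemma gw_pos:
  assumes "v < 2 * n"
  shows "0 < gw v"
proof -
  define w :: real where "w = 2 ^ lev v / sqrt 2"
  let ?h = "2 ^ lev v :: real"
  note c = same_cell[OF g_less[OF assms] assms g_key[OF assms] w_def]
  have w: "2 * (w * w) = ?h * ?h" "0 < w" "w < ?h" using width_square[OF w_def] .
  have "\<bar>gx v\<bar> < w" "\<bar>gy v\<bar> < w + ?h"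
    using c(3,4) w by (auto simp: gx_def gy_def abs_less_iff)
  then have "gx v * gx v < w * w" "gy v * gy v < (w + ?h) * (w + ?h)"
    using abs_mult_less[of "gx v" w "gx v" w] abs_mult_less[of "gy v" "w + ?h" "gy v" "w + ?h"] by auto
  then have "gx v * gx v + gy v * gy v < w * w + (w + ?h) * (w + ?h)" by linarith
  also have "\<dots> = 2 * (w * w) + 2 * (w * ?h) + ?h * ?h" by (simp add: algebra_simps)
  also have "\<dots> = 2 * (w * ?h) + 2 * (?h * ?h)" using w(1) by simp
  also have "\<dots> \<le> 4 * (?h * ?h)" using mult_right_mono[of w ?h ?h] w(3) by simp
  also have "\<dots> = (2 * ?h) * (2 * ?h)" by simp
  also have "\<dots> \<le> sr v * sr v"
  proof -
    have "0 \<le> 2 * ?h" by simp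
    then show ?thesis
      using lev_bounds(1)[OF assms] by (intro mult_mono) linarith+
  qed
  finally show ?thesis by (simp add: gw_def)
qed

sublocale second: site_data K1 K2 K3 PX PY W "2 * n"
  by standard (simp add: W_def gw_pos)



lemma second_F: "v < 2 * n \<Longrightarrow> second.F v = extent (gx v) (gy v) (gw v)"
  by (simp add: PX_def PY_def W_def)

section \<open>Candidates for a query point\<close>

definition cell_at :: "nat \<Rightarrow> int \<Rightarrow> int \<Rightarrow> point \<Rightarrow> nat \<Rightarrow> cell" where
  "cell_at d dx dy x l = Cell (int l + int l + int d)
     (grid_coord (int l) (qx x) + dx) (grid_coord (int l) (qy d x) + dy)"

definition ux :: "nat \<Rightarrow> point \<Rightarrow> real" where "ux v x = qx x - (sx v - gx v)"
definition uy :: "nat \<Rightarrow> nat \<Rightarrow> point \<Rightarrow> real" where "uy d v x = qy d x - (sy v - gy v)"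

definition sine :: "nat \<Rightarrow> nat \<Rightarrow> point \<Rightarrow> real" where
  "sine d v x = ux v x / sqrt (ux v x * ux v x + uy d v x * uy d v x)"

definition hit :: "(real \<times> nat) list \<Rightarrow> cell \<Rightarrow> real \<Rightarrow> nat" where
  "hit L z s = snd (L ! second.locate L z s)"

definition present :: "(real \<times> nat) list \<Rightarrow> cell \<Rightarrow> bool" where
  "present L z \<longleftrightarrow> second.locate L z 1 < length L \<and> first.key (hit L z 1) = z"

definition covers :: "nat \<Rightarrow> nat \<Rightarrow> point \<Rightarrow> bool" where
  "covers d v x \<longleftrightarrow> (sx v - qx x) * (sx v - qx x) + (sy v - qy d x) * (sy v - qy d x) \<le> sr v * sr v"

text \<open>Two searches are needed. The first one, with parameter 1, hits some site
  \<open>v\<close> of the cell, and with it the common origin. Only then is the direction from the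
  origin to \<open>x\<close> known, and the second search finds the disc that reaches farthest in
  this direction.\<close>

definition cand :: "(real \<times> nat) list \<Rightarrow> nat \<Rightarrow> int \<Rightarrow> int \<Rightarrow> point \<Rightarrow> nat \<Rightarrow> nat option" where
  "cand L d dx dy x l = (let z = cell_at d dx dy x l; v = hit L z 1; a = hit L z (sine d v x) in
     if present L z \<and> 0 < uy d v x \<and> covers d a x then Some a else None)"

lemma origin_eq:
  assumes "u < 2 * n" "v < 2 * n" "first.key u = first.key v"
  shows "sx u - gx u = sx v - gx v" "sy u - gy u = sy v - gy v"
  using g_eq[OF assms] same_cell(1)[OF assms refl] by (simp_all add: gx_def gy_def)

lemma sine_bounds:
  assumes "0 < uy d v x"
  defines "D \<equiv> sqrt (ux v x * ux v x + uy d v x * uy d v x)"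
  shows "-1 < sine d v x" "sine d v x < 1" "0 < D" "D * sine d v x = ux v x"
    "D * sqrt (1 - sine d v x * sine d v x) = uy d v x"
proof -
  let ?a = "ux v x" and ?b = "uy d v x"
  have D2: "D * D = ?a * ?a + ?b * ?b" by (simp add: D_def add_nonneg_nonneg)
  have pos: "0 < ?a * ?a + ?b * ?b" using assms(1) by (intro add_nonneg_pos) auto
  then show D: "0 < D" by (simp add: D_def)
  have "\<bar>?a\<bar> < D"
    unfolding D_def using assms(1) by (intro real_less_rsqrt) (simp add: power2_eq_square)
  then show "-1 < sine d v x" "sine d v x < 1"
    using D by (simp_all add: sine_def D_def[symmetric] less_divide_eq divide_less_eq abs_less_iff)
  show a: "D * sine d v x = ?a" using D by (simp add: sine_def D_def[symmetric])
  have "D * D * (1 - sine d v x * sine d v x) = D * D - (D * sine d v x) * (D * sine d v x)"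
    by (simp add: algebra_simps)
  also have "\<dots> = ?b * ?b" unfolding a D2 by simp
  finally have "sqrt (D * D * (1 - sine d v x * sine d v x)) = sqrt (?b * ?b)" by simp
  then show "D * sqrt (1 - sine d v x * sine d v x) = ?b"
    using D assms(1) by (simp add: real_sqrt_mult)
qed

text \<open>Stated with the origin taken from another site \<open>v\<close> of the same cell,
  because a query learns the origin from whatever site the first search hits.\<close>

lemma covers_iff:
  assumes "a < 2 * n" "v < 2 * n" "first.key a = first.key v" "0 < uy d v x"
  shows "covers d a x \<longleftrightarrow> sqrt (ux v x * ux v x + uy d v x * uy d v x) \<le> second.F a (sine d v x)"
proof -
  let ?D = "sqrt (ux v x * ux v x + uy d v x * uy d v x)" and ?s = "sine d v x"
  note b = sine_bounds[OF assms(4)]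
  have s: "?s * ?s \<le> 1"
    using b(1,2) by (simp add: abs_square_le_1 flip: power2_eq_square)
  have X: "gx a - ux v x = sx a - qx x" "gy a - uy d v x = sy a - qy d x"
    using origin_eq[OF assms(1-3)] by (simp_all add: ux_def uy_def)
  have sq: "(p - q) * (p - q) = (q - p) * (q - p)" for p q :: real by (simp add: algebra_simps)
  have "second.F a ?s = extent (gx a) (gy a) (gw a) ?s" using second_F assms(1) by simp
  moreover have "?D \<le> extent (gx a) (gy a) (gw a) ?s \<longleftrightarrow>
      (?D * ?s - gx a) * (?D * ?s - gx a) +
      (?D * sqrt (1 - ?s * ?s) - gy a) * (?D * sqrt (1 - ?s * ?s) - gy a) \<le> sr a * sr a"
    using b(3) by (intro in_disc_iff_extent[symmetric] gw_pos assms s) (simp_all add: gw_def)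
  moreover have "(?D * ?s - gx a) * (?D * ?s - gx a) = (sx a - qx x) * (sx a - qx x)"
    unfolding b(4) X(1)[symmetric] by (rule sq)
  moreover have "(?D * sqrt (1 - ?s * ?s) - gy a) * (?D * sqrt (1 - ?s * ?s) - gy a) =
      (sy a - qy d x) * (sy a - qy d x)"
    unfolding b(5) X(2)[symmetric] by (rule sq)
  ultimately show ?thesis by (simp add: covers_def)
qed

lemma hit_props:
  assumes L: "second.good {..<2 * n} (-1) L" and v: "v < 2 * n" "z = first.key v" and s: "-1 < s" "s \<le> 1"
  shows "second.locate L z s < length L" "hit L z s < 2 * n" "first.key (hit L z s) = z"
    "s < 1 \<Longrightarrow> second.F v s \<le> second.F (hit L z s) s"
  unfolding v(2) hit_def
  by (fact second.locate_found(1-3)[OF L v(1) s] second.locate_found(4)[OF L v(1) s _ v(1) refl])+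

lemma present_site:
  assumes "second.good {..<2 * n} (-1) L" "present L z"
  shows "hit L z 1 < 2 * n" "first.key (hit L z 1) = z"
  using assms second.good_nth[OF assms(1), of "second.locate L z 1"] by (auto simp: present_def hit_def)

lemma cand_SomeD:
  assumes L: "second.good {..<2 * n} (-1) L" and "cand L d dx dy x l = Some a" "d < 2"
  shows "a < 2 * n" "first.key a = cell_at d dx dy x l" "lev a = l" "dir a = d"
    "x \<in> cball (ps ! idx a) (r (ps ! idx a))" "covers d a x"
proof -
  define z where "z = cell_at d dx dy x l"
  define v where "v = hit L z 1"
  have c: "present L z" "0 < uy d v x" "covers d a x" "a = hit L z (sine d v x)"
    using assms(2) by (auto simp: cand_def Let_def z_def v_def split: if_splits)
  have v: "v < 2 * n" "first.key v = z" using present_site[OF L c(1)] by (auto simp: v_def)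
  note s = sine_bounds(1,2)[OF c(2)]
  show a: "a < 2 * n" "first.key a = cell_at d dx dy x l"
    using hit_props(2,3)[OF L v(1) v(2)[symmetric] s(1) less_imp_le[OF s(2)]] c(4) by (auto simp: z_def)
  then have "int (lev a) + int (lev a) + int (dir a) = int l + int l + int d"
    by (simp add: key_eq cell_at_def)
  then show ld: "lev a = l" "dir a = d" using level_dir_eq[OF _ dir_less assms(3)] by auto
  show "covers d a x" by fact
  then show "x \<in> cball (ps ! idx a) (r (ps ! idx a))"
    using scaled_disc[OF a(1) ld(2)] by (simp add: covers_def)
qed

text \<open>The curve found by the second search is at least as high as that of \<open>v\<close> in
  the direction of \<open>x\<close>. So if the disc of \<open>v\<close> contains \<open>x\<close>,
  then so does the disc of the candidate.\<close>

lemma cand_complete: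
  assumes L: "second.good {..<2 * n} (-1) L" and v: "v < 2 * n" "first.key v = cell_at d dx dy x l"
    "0 < uy d v x" "covers d v x"
  shows "\<exists>a. cand L d dx dy x l = Some a"
proof -
  define z where "z = cell_at d dx dy x l"
  define u where "u = hit L z 1"
  have z: "z = first.key v" using v(2) by (simp add: z_def)
  have u: "u < 2 * n" "first.key u = z" "present L z"
    using hit_props[OF L v(1) z, of 1] by (auto simp: u_def present_def)
  have k: "first.key v = first.key u" using u z by simp
  have uy: "0 < uy d u x" and ux: "ux u x = ux v x" "uy d u x = uy d v x"
    using origin_eq[OF v(1) u(1) k] v(3) by (simp_all add: ux_def uy_def)
  define a where "a = hit L z (sine d u x)"
  note s = sine_bounds(1,2)[OF uy]
  have a: "a < 2 * n" "first.key a = z" "second.F v (sine d u x) \<le> second.F a (sine d u x)"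
    using hit_props[OF L v(1) z s(1) less_imp_le[OF s(2)]] s(2) by (auto simp: a_def)
  have "covers d a x"
    using covers_iff[OF v(1) u(1) k uy] covers_iff[OF a(1) u(1) _ uy] a u v(4) by simp
  then show ?thesis
    using u(3) uy by (simp add: cand_def Let_def a_def u_def z_def)
qed

text \<open>Writing \<open>h\<close> for the cell diameter of the higher level and \<open>\<gamma> \<le> 1\<close> for the ratio of the
  diameters, \<open>a - b = (1 - \<gamma>) (a - x) + \<gamma> e\<close> with \<open>e\<close> of norm at most \<open>2 h\<close>.\<close>

lemma lower_cand_near:
  assumes L: "second.good {..<2 * n} (-1) L" and d: "d < 2" and "l' \<le> l"
    and a: "cand L d dx dy x l = Some a" and b: "cand L d dx dy x l' = Some b"
  shows "ps ! idx b \<in> cball (ps ! idx a) (r (ps ! idx a))"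
proof -
  note A = cand_SomeD[OF L a d] and B = cand_SomeD[OF L b d]
  define w :: real where "w = 2 ^ l / sqrt 2"
  define w' :: real where "w' = 2 ^ l' / sqrt 2"
  define c :: real where "c = 2 ^ l' / 2 ^ l"
  have c: "0 < c" "c \<le> 1" using \<open>l' \<le> l\<close> by (simp_all add: c_def power_increasing)
  have w': "w' = c * w" by (simp add: w_def w'_def c_def)
  have w: "0 < w" "2 * (w * w) = 2 ^ l * 2 ^ l" using width_square[OF w_def] by auto
  have key: "grid_coord (int l) (sx a) = grid_coord (int l) (qx x) + dx"
    "grid_coord (int l) (sy a) = grid_coord (int l) (qy d x) + dy"
    "grid_coord (int l') (sx b) = grid_coord (int l') (qx x) + dx"
    "grid_coord (int l') (sy b) = grid_coord (int l') (qy d x) + dy"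
    using A(2) B(2) key_eq[OF A(1)] key_eq[OF B(1)] A(3) B(3) by (auto simp: cell_at_def)
  have near: "\<bar>p - q - u * k\<bar> < u" if "grid_coord (int m) p = grid_coord (int m) q + k" "u = 2 ^ m / sqrt 2"
    for p q u :: real and m k
  proof -
    have "u * (grid_coord (int m) q + k) \<le> p" "p < u * (grid_coord (int m) q + k) + u"
      using grid_coord_bounds(1,2)[OF that(2), of p] that(1) by auto
    moreover have "u * (grid_coord (int m) q + k) = u * grid_coord (int m) q + u * k"
      by (simp add: algebra_simps)
    ultimately show ?thesis
      using grid_coord_bounds(1,2)[OF that(2), of q] by (simp add: abs_less_iff)
  qed
  define P where "P = (sx a, sy a)"
  define R where "R = (sx b, sy b)"
  define X where "X = (qx x, qy d x)"
  define e where "e = (P - X) - (1 / c) *\<^sub>R (R - X)"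
  \<comment> \<open>Measured in widths of its own cell, each site is away from the query point by
    the common offset \<open>k\<close> up to an error below 1. After scaling the lower one up by
    \<open>1 / c\<close>, the two differ by less than two widths of the higher level.\<close>
  have comp: "\<bar>p - q - (1 / c) * (p' - q)\<bar> < 2 * w"
    if "grid_coord (int l) p = grid_coord (int l) q + k" "grid_coord (int l') p' = grid_coord (int l') q + k"
    for p q p' :: real and k
  proof -
    have 1: "\<bar>p - q - w * k\<bar> < w" using near[OF that(1) w_def] .
    have "\<bar>p' - q - w' * k\<bar> < w'" using near[OF that(2) w'_def] .
    moreover have "c * ((1 / c) * (p' - q) - w * k) = p' - q - w' * k"
      unfolding w' right_diff_distrib using c by simp
    ultimately have "\<bar>c * ((1 / c) * (p' - q) - w * k)\<bar> < c * w"
      by (simp only: w')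
    then have "\<bar>(1 / c) * (p' - q) - w * k\<bar> < w"
      using c by (simp add: abs_mult)
    with 1 show ?thesis by linarith
  qed
  have e1: "\<bar>fst e\<bar> < 2 * w" "\<bar>snd e\<bar> < 2 * w"
    using comp[OF key(1,3)] comp[OF key(2,4)] by (simp_all add: e_def P_def R_def X_def)
  have "norm e = sqrt (fst e * fst e + snd e * snd e)"
    by (simp add: norm_prod_def power2_eq_square)
  also have "\<dots> \<le> 2 * 2 ^ l"
  proof (rule real_le_lsqrt)
    have "fst e * fst e \<le> (2 * w) * (2 * w)" "snd e * snd e \<le> (2 * w) * (2 * w)"
      using abs_mult_less[OF e1(1,1)] abs_mult_less[OF e1(2,2)] by auto
    then have "fst e * fst e + snd e * snd e \<le> 4 * (2 * (w * w))" by simp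
    also have "\<dots> = (2 * 2 ^ l)\<^sup>2" using w(2) by (simp add: power2_eq_square)
    finally show "fst e * fst e + snd e * snd e \<le> (2 * 2 ^ l)\<^sup>2" .
  qed simp
  also have "\<dots> \<le> sr a" using lev_bounds(1)[OF A(1)] A(3) by simp
  finally have ne: "norm e \<le> sr a" .
  have sa: "0 \<le> sr a" using ne norm_ge_zero order_trans by blast
  have "norm (P - X) = sqrt ((sx a - qx x) * (sx a - qx x) + (sy a - qy d x) * (sy a - qy d x))"
    by (simp add: norm_prod_def power2_eq_square P_def X_def)
  also have "\<dots> \<le> sr a"
    using A(6) sa by (intro real_le_lsqrt) (simp_all add: covers_def power2_eq_square)
  finally have nx: "norm (P - X) \<le> sr a" .
  have "P - R = (1 - c) *\<^sub>R (P - X) + c *\<^sub>R e"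
    using c by (simp add: e_def scaleR_diff_right scaleR_diff_left)
  then have "norm (P - R) \<le> norm ((1 - c) *\<^sub>R (P - X)) + norm (c *\<^sub>R e)"
    by (metis norm_triangle_ineq)
  also have "\<dots> = (1 - c) * norm (P - X) + c * norm e" using c by simp
  also have "\<dots> \<le> (1 - c) * sr a + c * sr a"
    using c nx ne by (intro add_mono mult_left_mono) auto
  also have "\<dots> = sr a" by (simp add: algebra_simps)
  finally have "norm (P - R) \<le> sr a" .
  moreover have "norm (P - R) = sqrt ((sx a - sx b) * (sx a - sx b) + (sy a - sy b) * (sy a - sy b))"
    by (simp add: norm_prod_def power2_eq_square P_def R_def)
  ultimately have "(sx a - sx b) * (sx a - sx b) + (sy a - sy b) * (sy a - sy b) \<le> sr a * sr a"
    using sqrt_le_D by (fastforce simp: power2_eq_square)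
  then show ?thesis
    using scaled_disc_sites[OF A(1) B(1)] A(4) B(4) by simp
qed

text \<open>Two sites of a cell are at most one diameter \<open>2 ^ l\<close> apart, and their
  scaled radii are at least twice as large.\<close>

lemma same_cell_near:
  assumes "u < 2 * n" "v < 2 * n" "first.key u = first.key v"
  shows "ps ! idx v \<in> cball (ps ! idx u) (r (ps ! idx u))"
proof -
  define w :: real where "w = 2 ^ lev v / sqrt 2"
  note c = same_cell[OF assms w_def]
  have w: "2 * (w * w) = 2 ^ lev v * 2 ^ lev v" using width_square[OF w_def] by auto
  have "(sx u - sx v) * (sx u - sx v) + (sy u - sy v) * (sy u - sy v) \<le> w * w + w * w"
    using abs_mult_less[OF c(3,3)] abs_mult_less[OF c(4,4)] by (intro add_mono) auto
  also have "\<dots> = 2 ^ lev u * 2 ^ lev u" using w c(1) by simp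
  also have "\<dots> \<le> sr u * sr u"
  proof -
    have "2 ^ lev u \<le> sr u"
      using lev_bounds(1)[OF assms(1)] zero_le_power[of "2::real" "lev u"] by linarith
    moreover have "(0::real) \<le> 2 ^ lev u" by simp
    ultimately show ?thesis by (intro mult_mono) linarith+
  qed
  finally show ?thesis by (rule scaled_disc_sites[OF assms(1,2) c(2)])
qed

text \<open>The difference is less than \<open>4 * sqrt 2\<close> cell widths, hence less than 6,
  and rounding both coordinates down can add less than 1. So the integer offset is below 7.\<close>

lemma offset_bound:
  assumes "\<bar>p - q\<bar> < 4 * 2 ^ l"
  shows "grid_coord (int l) p - grid_coord (int l) q \<in> {-6..6}"
proof -
  define w :: real where "w = 2 ^ l / sqrt 2"
  have s: "sqrt 2 < (3::real) / 2"
    by (rule real_less_lsqrt) (simp_all add: power2_eq_square)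
  have w: "0 < w" "2 ^ l = sqrt 2 * w" by (simp_all add: w_def)
  have "4 * (sqrt 2 * w) < 6 * w" using s w(1) by simp
  then have "\<bar>p - q\<bar> < 6 * w" using assms w(2) by linarith
  then have b: "p < q + 6 * w" "q < p + 6 * w" by auto
  note gp = grid_coord_bounds(1,2)[OF w_def, of p] and gq = grid_coord_bounds(1,2)[OF w_def, of q]
  let ?a = "grid_coord (int l) p" and ?b = "grid_coord (int l) q"
  have "w * ?a < w * (?b + 7)" "w * ?b < w * (?a + 7)"
    using gp gq b by (simp_all add: distrib_left)
  then have "real_of_int ?a < ?b + 7" "real_of_int ?b < ?a + 7"
    using w(1) by simp_all
  then have "?a < ?b + 7" "?b < ?a + 7" by linarith+
  then show ?thesis by auto
qed

text \<open>The point \<open>x\<close> lies above the origin of the cell of \<open>k\<close> or, in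
  the mirrored picture, above the origin of the cell of the mirror image
  \<open>k + n\<close>.\<close>

lemma cover_found:
  assumes L: "second.good {..<2 * n} (-1) L" and k: "k < n" "x \<in> cball (ps ! k) (r (ps ! k))"
  shows "\<exists>(d, dx, dy)\<in>set offsets. \<exists>v a. v < 2 * n \<and> idx v = k \<and> lev v = lev k \<and> first.key a = first.key v \<and>
    cand L d dx dy x (lev k) = Some a"
proof -
  have main: "\<exists>dx dy a. dx \<in> {-6..6} \<and> dy \<in> {-6..6} \<and> first.key a = first.key v \<and> cand L d dx dy x (lev v) = Some a"
    if v: "v < 2 * n" "idx v = k" "dir v = d" "0 < uy d v x" for v d
  proof -
    have cov: "covers d v x" using scaled_disc[OF v(1,3)] k(2) v(2) by (simp add: covers_def)
    have sr: "0 < sr v" "sr v < 4 * 2 ^ lev v"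
      using lev_bounds[OF v(1)] zero_less_power[of "2::real" "lev v"] by linarith+
    have sq: "\<bar>p\<bar> < 4 * 2 ^ lev v" if "p * p \<le> sr v * sr v" for p
      using abs_le_square_iff[of p "sr v"] that sr by (simp add: power2_eq_square)
    have "(sx v - qx x) * (sx v - qx x) \<le> sr v * sr v" "(sy v - qy d x) * (sy v - qy d x) \<le> sr v * sr v"
      using cov zero_le_square[of "sx v - qx x"] zero_le_square[of "sy v - qy d x"]
      unfolding covers_def by linarith+
    then have "\<bar>sx v - qx x\<bar> < 4 * 2 ^ lev v" "\<bar>sy v - qy d x\<bar> < 4 * 2 ^ lev v"
      using sq by auto
    note off = this[THEN offset_bound]
    let ?dx = "grid_coord (int (lev v)) (sx v) - grid_coord (int (lev v)) (qx x)"
    let ?dy = "grid_coord (int (lev v)) (sy v) - grid_coord (int (lev v)) (qy d x)"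
    have key: "first.key v = cell_at d ?dx ?dy x (lev v)"
      by (simp add: key_eq v cell_at_def)
    from cand_complete[OF L v(1) key v(4) cov] obtain a where a: "cand L d ?dx ?dy x (lev v) = Some a" by blast
    moreover have "d < 2" using dir_less v(3) by auto
    ultimately have "first.key a = first.key v" using cand_SomeD(2)[OF L a] key by simp
    then show ?thesis using a off by blast
  qed
  have off: "(d, dx, dy) \<in> set offsets" if "d < 2" "dx \<in> {-6..6}" "dy \<in> {-6..6}" for d dx dy
    using that unfolding set_offsets by blast
  show ?thesis
  proof (cases "0 < uy 0 k x")
    case True
    have v: "k < 2 * n" "idx k = k" "dir k = 0" using k(1) by (simp_all add: idx_def dir_def)
    from main[OF v True] obtain dx dy a where "dx \<in> {-6..6}" "dy \<in> {-6..6}" "first.key a = first.key k"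
      "cand L 0 dx dy x (lev k) = Some a" by blast
    then show ?thesis using v off[of 0 dx dy] by force
  next
    case False
    define v where "v = k + n"
    have v: "v < 2 * n" "idx v = k" "dir v = 1" "k < 2 * n" "idx k = k" "dir k = 0"
      using k(1) by (simp_all add: v_def idx_def dir_def)
    have m: "sy v = - sy k" "qy 1 x = - qy 0 x" "sr v = sr k"
      using v by (simp_all add: sy_def qy_def sg_def sr_def)
    then have lv: "lev v = lev k" by (simp add: lev_def)
    \<comment> \<open>An origin lies strictly below every site of its cell, since the shift by the
      diameter exceeds the width of the cell. So a point that is not above the origin of
      \<open>k\<close> is below \<open>k\<close> itself, and in the mirrored picture above
      it.\<close>
    have low: "sy u - gy u < sy u" if "u < 2 * n" for u
      using same_cell(4)[OF g_less[OF that] that g_key[OF that] refl] width_square(3)[OF refl, of "lev u"]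
      by (simp add: gy_def abs_less_iff)
    have "qy 0 x \<le> sy k - gy k" using False by (simp add: uy_def)
    then have "qy 0 x < sy k" using low[OF v(4)] by linarith
    then have "0 < uy 1 v x" using low[OF v(1)] m by (simp add: uy_def)
    from main[OF v(1-3) this] obtain dx dy a where "dx \<in> {-6..6}" "dy \<in> {-6..6}" "first.key a = first.key v"
      "cand L 1 dx dy x (lev v) = Some a" by blast
    then show ?thesis using v off[of 1 dx dy] lv by force
  qed
qed

definition found :: "(real \<times> nat) list \<Rightarrow> nat \<Rightarrow> nat \<Rightarrow> int \<Rightarrow> int \<Rightarrow> point \<Rightarrow> nat \<Rightarrow> bool" where
  "found L m d dx dy x a \<longleftrightarrow>
     (\<exists>l\<le>m. cand L d dx dy x l = Some a \<and> (\<forall>l'<l. cand L d dx dy x l' = None))"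

lemma reaches_point_iff:
  assumes L: "second.good {..<2 * n} (-1) L" and m: "\<And>v. v < 2 * n \<Longrightarrow> lev v \<le> m"
  shows "reaches_point (set ps) r s x \<longleftrightarrow>
    (\<exists>(d, dx, dy)\<in>set offsets. \<exists>a. found L m d dx dy x a \<and> s \<rightarrow>\<^sup>*\<^bsub>transmission_graph (set ps) r\<^esub> ps ! idx a)"
proof
  assume "reaches_point (set ps) r s x"
  then obtain q where q: "q \<in> set ps" "x \<in> cball q (r q)" "s \<rightarrow>\<^sup>*\<^bsub>transmission_graph (set ps) r\<^esub> q"
    by (auto simp: reaches_point_def)
  then obtain k where k: "k < n" "ps ! k = q" by (auto simp: in_set_conv_nth n_def)
  from cover_found[OF L k(1), of x] q(2) k(2) obtain d dx dy v a where
    off: "(d, dx, dy) \<in> set offsets" and v: "v < 2 * n" "idx v = k" "first.key a = first.key v"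
    and a: "cand L d dx dy x (lev k) = Some a" by blast
  have d: "d < 2" using off unfolding set_offsets by blast
  have "lev k \<le> m" using m k(1) by simp
  define l where "l = (LEAST l. cand L d dx dy x l \<noteq> None)"
  have l: "cand L d dx dy x l \<noteq> None" "l \<le> lev k"
    using LeastI[of "\<lambda>l. cand L d dx dy x l \<noteq> None" "lev k"] Least_le[of "\<lambda>l. cand L d dx dy x l \<noteq> None" "lev k"] a
    by (auto simp: l_def)
  then obtain b where b: "cand L d dx dy x l = Some b" by blast
  have "cand L d dx dy x l' = None" if "l' < l" for l'
    using not_less_Least[of l' "\<lambda>l. cand L d dx dy x l \<noteq> None"] that by (auto simp: l_def)
  then have "found L m d dx dy x b"
    unfolding found_def using b l(2) \<open>lev k \<le> m\<close> by (intro exI[of _ l]) auto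
  \<comment> \<open>The site \<open>q\<close> reaches \<open>a\<close> within its cell, and
    \<open>b\<close>, found at a level that is not higher, lies in the disc of
    \<open>a\<close>.\<close>
  moreover have "s \<rightarrow>\<^sup>*\<^bsub>transmission_graph (set ps) r\<^esub> ps ! idx b"
  proof -
    note A = cand_SomeD(1)[OF L a d] and B = cand_SomeD(1)[OF L b d]
    have "ps ! idx v \<rightarrow>\<^sup>*\<^bsub>transmission_graph (set ps) r\<^esub> ps ! idx a"
      by (rule reach_step[OF v(1) A same_cell_near[OF v(1) A v(3)[symmetric]]])
    moreover have "ps ! idx a \<rightarrow>\<^sup>*\<^bsub>transmission_graph (set ps) r\<^esub> ps ! idx b"
      by (rule reach_step[OF A B lower_cand_near[OF L d l(2) a b]])
    ultimately show ?thesis using q(3) v(2) k(2) reach_trans by blast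
  qed
  ultimately show "\<exists>(d, dx, dy)\<in>set offsets. \<exists>a. found L m d dx dy x a \<and>
      s \<rightarrow>\<^sup>*\<^bsub>transmission_graph (set ps) r\<^esub> ps ! idx a"
    using off by blast
next
  assume "\<exists>(d, dx, dy)\<in>set offsets. \<exists>a. found L m d dx dy x a \<and>
    s \<rightarrow>\<^sup>*\<^bsub>transmission_graph (set ps) r\<^esub> ps ! idx a"
  then obtain d dx dy a l where off: "(d, dx, dy) \<in> set offsets" and a: "cand L d dx dy x l = Some a"
    and s: "s \<rightarrow>\<^sup>*\<^bsub>transmission_graph (set ps) r\<^esub> ps ! idx a"
    by (auto simp: found_def)
  have "d < 2" using off unfolding set_offsets by blast
  from cand_SomeD[OF L a this] s idx_in show "reaches_point (set ps) r s x"
    unfolding reaches_point_def by blast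
qed

end


section \<open>Constructing the data structure\<close>

definition min_body :: com where
  "min_body = If (RLess (RGet 2 (IReg 4)) (RReg 2)) (rset 2 (RGet 2 (IReg 4))) skip ;;
     iset 4 (IAdd (IReg 4) (IConst 1))"

definition find_min :: com where
  "find_min = (rset 2 (RGet 2 (IConst 0)) ;; iset 4 (IConst 0)) ;; While (ILess (IReg 4) (IReg 0)) min_body"

definition min_unit :: nat where
  "min_unit = 2 * bcost (ILess (IReg 4) (IReg 0)) + tm min_body + tm (rset 2 (RGet 2 (IConst 0)) ;; iset 4 (IConst 0))"

definition scaled :: "rexp \<Rightarrow> rexp" where
  "scaled e = RDiv (RMul (RConst 2) e) (RReg 2)"

definition sign_const :: "nat \<Rightarrow> rexp" where
  "sign_const d = RConst (if d = 0 then 1 else -1)"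

definition pre_site :: "nat \<Rightarrow> com" where
  "pre_site d = rset 11 (scaled (RGet 2 (IReg 4))) ;; rset 14 (scaled (RGet 0 (IReg 4))) ;;
     rset 15 (RMul (sign_const d) (scaled (RGet 1 (IReg 4)))) ;; iset 23 (IConst 0) ;; rset 12 (RConst 1)"

definition level_body :: com where
  "level_body = rset 12 (RMul (RConst 2) (RReg 12)) ;; iset 23 (IAdd (IReg 23) (IConst 1))"

definition level_guard :: bexp where
  "level_guard = BNot (RLess (RReg 11) (RMul (RConst 4) (RReg 12)))"

definition push_site :: "nat \<Rightarrow> com" where
  "push_site d = If (ILess (IReg 2) (IReg 23)) (iset 2 (IReg 23)) skip ;;
     Do (RPush 3 (RReg 14)) ;; Do (RPush 4 (RReg 15)) ;; Do (RPush 5 (RReg 11)) ;; Do (RPush 6 (RReg 12)) ;;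
     Do (IPush 0 (IAdd (IAdd (IReg 23) (IReg 23)) (IConst (int d)))) ;;
     Do (Grid 25 26 (RReg 14) (RReg 15) (IReg 23)) ;; Do (IPush 1 (IReg 25)) ;; Do (IPush 2 (IReg 26)) ;;
     Do (RPush 7 (RConst 0)) ;; Do (RPush 8 (RConst 0)) ;; Do (RPush 9 (RConst 1)) ;;
     iset 4 (IAdd (IReg 4) (IConst 1))"

text \<open>The level is found by repeated doubling, one iteration per level. As the levels are
  bounded by the logarithm of the radius ratio, this stays within the allowed time.\<close>

definition site_body :: "nat \<Rightarrow> com" where
  "site_body d = pre_site d ;; While level_guard level_body ;; push_site d"

definition add_sites :: "nat \<Rightarrow> com" where
  "add_sites d = iset 4 (IConst 0) ;; While (ILess (IReg 4) (IReg 0)) (site_body d)"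

definition site_unit :: nat where
  "site_unit = tm (pre_site 0) + tm (push_site 0) + 2 * bcost level_guard + tm level_body"

definition add_unit :: nat where
  "add_unit = site_unit + 2 * bcost (ILess (IReg 4) (IReg 0)) + tm (iset 4 (IConst 0))"

definition rep_start :: com where
  "rep_start = iset 20 (IGet 0 (IReg 4)) ;; iset 21 (IGet 1 (IReg 4)) ;; iset 22 (IGet 2 (IReg 4)) ;;
     rset 19 (RConst 1)"

text \<open>The weight is computed from the center just written to arrays 7 and 8, so the order of
  the writes matters.\<close>

definition rep_end :: com where
  "rep_end = iset 27 (IGet 3 (IReg 17)) ;;
     Do (RPut 7 (IReg 4) (RSub (RGet 3 (IReg 4)) (RGet 3 (IReg 27)))) ;;
     Do (RPut 8 (IReg 4) (RAdd (RSub (RGet 4 (IReg 4)) (RGet 4 (IReg 27))) (RGet 6 (IReg 4)))) ;;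
     Do (RPut 9 (IReg 4) (RSub (RSub (RMul (RGet 5 (IReg 4)) (RGet 5 (IReg 4)))
       (RMul (RGet 7 (IReg 4)) (RGet 7 (IReg 4)))) (RMul (RGet 8 (IReg 4)) (RGet 8 (IReg 4))))) ;;
     iset 4 (IAdd (IReg 4) (IConst 1))"

definition set_origins :: com where
  "set_origins = iset 4 (IConst 0) ;; While (ILess (IReg 4) (IReg 1)) (rep_start ;; search ;; rep_end)"

definition origin_unit :: nat where
  "origin_unit = search_unit + tm rep_start + tm rep_end + 2 * bcost (ILess (IReg 4) (IReg 1)) + tm (iset 4 (IConst 0))"

definition set_counters :: com where
  "set_counters = iset 31 (IReg 0) ;; iset 1 (IAdd (IReg 0) (IReg 0)) ;; iset 2 (IConst 0)"

definition construct :: com where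
  "construct = find_min ;; set_counters ;; add_sites 0 ;; add_sites 1 ;; build ;; set_origins ;; build"

definition construct_unit :: nat where
  "construct_unit = min_unit + tm set_counters + 2 * add_unit + 4 * build_unit + 2 * origin_unit"

lemma put_map_upt:
  assumes "i < N"
  shows "put (map f [0..<i] @ replicate (N - i) c) (int i) (f i) = map f [0..<Suc i] @ replicate (N - Suc i) c"
    "get (map f [0..<Suc i] @ replicate (N - Suc i) c) (int i) = f i"
proof -
  have "replicate (N - i) c = c # replicate (N - Suc i) c"
    using assms by (metis Suc_diff_Suc replicate_Suc)
  then show "put (map f [0..<i] @ replicate (N - i) c) (int i) (f i) = map f [0..<Suc i] @ replicate (N - Suc i) c"
    by (simp add: put_def list_update_append)
  show "get (map f [0..<Suc i] @ replicate (N - Suc i) c) (int i) = f i"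
    by (simp add: get_def nth_append)
qed

context sites
begin

definition holds_input :: "store \<Rightarrow> bool" where
  "holds_input \<sigma> \<longleftrightarrow> ireg \<sigma> 0 = int n \<and> rarr \<sigma> 0 = map fst ps \<and> rarr \<sigma> 1 = map snd ps \<and> rarr \<sigma> 2 = map r ps"

lemma get_input:
  assumes "holds_input \<sigma>" "i < n"
  shows "get (rarr \<sigma> 0) (int i) = fst (ps ! i)" "get (rarr \<sigma> 1) (int i) = snd (ps ! i)"
    "get (rarr \<sigma> 2) (int i) = r (ps ! i)"
  using assms by (simp_all add: holds_input_def n_def)

lemma runs_find_min:
  assumes "holds_input \<sigma>"
  shows "runs find_min \<sigma> (min_unit * n) (\<lambda>\<tau>. rreg \<tau> 2 = rmin \<and> same_outside ({4}, {2}, {}, {}) \<sigma> \<tau>)"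
proof -
  let ?b = "ILess (IReg 4) (IReg 0)" and ?c = "rset 2 (RGet 2 (IConst 0)) ;; iset 4 (IConst 0)"
  define I where "I q \<tau> \<longleftrightarrow> (\<exists>i. same_outside ({4}, {2}, {}, {}) \<sigma> \<tau> \<and> ireg \<tau> 4 = int i \<and> i \<le> n \<and>
      rreg \<tau> 2 \<in> r ` set ps \<and> (\<forall>j<i. rreg \<tau> 2 \<le> r (ps ! j)) \<and> q = (bcost ?b + tm min_body) * (n - i) + bcost ?b)" for q \<tau>
  have "runs (While ?b min_body) (ev ?c \<sigma>) ((bcost ?b + tm min_body) * n + bcost ?b)
      (\<lambda>\<tau>. (\<exists>q. I q \<tau>) \<and> \<not> bval ?b \<tau>)"
  proof (rule runs_While)
    fix q \<tau> assume "I q \<tau>" and b: "bval ?b \<tau>"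
    then obtain i where I: "same_outside ({4}, {2}, {}, {}) \<sigma> \<tau>" "ireg \<tau> 4 = int i"
      "rreg \<tau> 2 \<in> r ` set ps" "\<forall>j<i. rreg \<tau> 2 \<le> r (ps ! j)" "q = (bcost ?b + tm min_body) * (n - i) + bcost ?b"
      unfolding I_def by blast
    have inp: "holds_input \<tau>" using assms I(1) by (simp add: holds_input_def same_outside_def)
    have i: "i < n" using b I(2) inp by (simp add: holds_input_def)
    have "ps ! i \<in> set ps" using i by (simp add: n_def)
    let ?q = "(bcost ?b + tm min_body) * (n - Suc i) + bcost ?b"
    have "I ?q (ev min_body \<tau>)"
      unfolding I_def using I(1-4) i get_input[OF inp i] \<open>ps ! i \<in> set ps\<close>
      by (intro exI[of _ "Suc i"]) (auto simp: min_body_def same_outside_def less_Suc_eq intro: order_trans)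
    moreover have "bcost ?b + tm min_body + ?q \<le> q"
      unfolding I(5) using i by (simp add: Suc_diff_Suc[symmetric])
    moreover have "loopfree min_body" by (simp add: min_body_def)
    ultimately show "\<exists>T. runs min_body \<tau> T (\<lambda>\<tau>. \<exists>q'. I q' \<tau> \<and> bcost ?b + T + q' \<le> q)"
      using runs_ev_pay by blast
  next
    fix q \<tau> assume "I q \<tau>" then show "bcost ?b \<le> q" by (auto simp: I_def)
  next
    show "I ((bcost ?b + tm min_body) * n + bcost ?b) (ev ?c \<sigma>)"
      unfolding I_def using get_input(3)[OF assms n_pos] nonempty
      by (intro exI[of _ 0]) (simp add: same_outside_def)
  qed
  then have "runs (While ?b min_body) (ev ?c \<sigma>) ((bcost ?b + tm min_body) * n + bcost ?b)
      (\<lambda>\<tau>. rreg \<tau> 2 = rmin \<and> same_outside ({4}, {2}, {}, {}) \<sigma> \<tau>)"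
  proof (rule runs_weaken[OF _ order_refl])
    fix \<tau> assume "(\<exists>q. I q \<tau>) \<and> \<not> bval ?b \<tau>"
    then obtain i where I: "same_outside ({4}, {2}, {}, {}) \<sigma> \<tau>" "ireg \<tau> 4 = int i" "i \<le> n" "\<not> ireg \<tau> 4 < ireg \<tau> 0"
      "rreg \<tau> 2 \<in> r ` set ps" "\<forall>j<i. rreg \<tau> 2 \<le> r (ps ! j)"
      unfolding I_def by auto
    have "ireg \<tau> 0 = int n" using assms I(1) by (simp add: holds_input_def same_outside_def)
    then have "i = n" using I by simp
    have "rreg \<tau> 2 \<le> r p" if "p \<in> set ps" for p
      using that I(6) \<open>i = n\<close> by (metis in_set_conv_nth n_def)
    then have "Min (r ` set ps) = rreg \<tau> 2"
      using I(5) by (intro Min_eqI) auto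
    then show "rreg \<tau> 2 = rmin \<and> same_outside ({4}, {2}, {}, {}) \<sigma> \<tau>"
      using I(1) by (simp add: rmin_def)
  qed
  then show ?thesis
    unfolding find_min_def
  proof (rule runs_Seq_ev[rotated])
    have "x \<le> x * n" for x using n_pos by simp
    from this[of "tm ?c + bcost ?b"]
    show "tm ?c + ((bcost ?b + tm min_body) * n + bcost ?b) \<le> min_unit * n"
      unfolding min_unit_def by (simp only: add_mult_distrib mult_2)
  qed simp
qed

text \<open>The highest level in register 2 is recorded as attained, or 0 if there is no site yet.
  This bounds the number of levels that a query visits.\<close>

definition sites_done :: "nat \<Rightarrow> store \<Rightarrow> bool" where
  "sites_done k \<sigma> \<longleftrightarrow> holds_input \<sigma> \<and> rreg \<sigma> 2 = rmin \<and>
     rarr \<sigma> 3 = map sx [0..<k] \<and> rarr \<sigma> 4 = map sy [0..<k] \<and> rarr \<sigma> 5 = map sr [0..<k] \<and>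
     rarr \<sigma> 6 = map (\<lambda>v. 2 ^ lev v) [0..<k] \<and>
     iarr \<sigma> 0 = map (\<lambda>v. int (lev v) + int (lev v) + int (dir v)) [0..<k] \<and>
     iarr \<sigma> 1 = map (\<lambda>v. grid_coord (int (lev v)) (sx v)) [0..<k] \<and>
     iarr \<sigma> 2 = map (\<lambda>v. grid_coord (int (lev v)) (sy v)) [0..<k] \<and>
     rarr \<sigma> 7 = replicate k 0 \<and> rarr \<sigma> 8 = replicate k 0 \<and> rarr \<sigma> 9 = replicate k 1 \<and>
     (\<exists>m. ireg \<sigma> 2 = int m \<and> (\<forall>v<k. lev v \<le> m) \<and> (m = 0 \<or> (\<exists>v<k. m = lev v)))"

lemma runs_site_body:
  assumes "sites_done v \<sigma>" "v < 2 * n" "dir v = d" "ireg \<sigma> 4 = int (idx v)" "lev v \<le> B"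
  shows "runs (site_body d) \<sigma> (site_unit * (B + 1))
    (\<lambda>\<tau>. sites_done (Suc v) \<tau> \<and> ireg \<tau> 4 = int (Suc (idx v)))"
proof -
  let ?\<sigma> = "ev (pre_site d) \<sigma>"
  have inp: "holds_input \<sigma>" "rreg \<sigma> 2 = rmin" using assms(1) by (auto simp: sites_done_def)
  note g = get_input[OF inp(1) idx_less[OF assms(2)]]
  have r: "rreg ?\<sigma> 11 = sr v" "rreg ?\<sigma> 14 = sx v" "rreg ?\<sigma> 15 = sy v" "ireg ?\<sigma> 23 = 0" "rreg ?\<sigma> 12 = 1"
    using g inp(2) assms(3,4)
    by (simp_all add: pre_site_def scaled_def sign_const_def sr_def sx_def sy_def sg_def)
  have s: "same_outside ({23}, {11, 12, 14, 15}, {}, {}) \<sigma> ?\<sigma>"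
    by (simp add: pre_site_def same_outside_def)
  define I where "I q \<tau> \<longleftrightarrow> (\<exists>l. same_outside ({23}, {12}, {}, {}) ?\<sigma> \<tau> \<and> ireg \<tau> 23 = int l \<and>
      rreg \<tau> 12 = 2 ^ l \<and> l \<le> lev v \<and> q = (bcost level_guard + tm level_body) * (lev v - l) + bcost level_guard)" for q \<tau>
  have guard: "bval level_guard \<tau> \<longleftrightarrow> l \<noteq> lev v"
    if "same_outside ({23}, {12}, {}, {}) ?\<sigma> \<tau>" "rreg \<tau> 12 = 2 ^ l" "l \<le> lev v" for l \<tau>
  proof -
    have "rreg \<tau> 11 = sr v" using that(1) r(1) by (simp add: same_outside_def)
    then show ?thesis using lev_le_iff[OF assms(2) that(3)] that(2) by (simp add: level_guard_def)
  qed
  have "runs (While level_guard level_body) ?\<sigma> ((bcost level_guard + tm level_body) * lev v + bcost level_guard)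
      (\<lambda>\<tau>. (\<exists>q. I q \<tau>) \<and> \<not> bval level_guard \<tau>)"
  proof (rule runs_While)
    fix q \<tau> assume "I q \<tau>" and b: "bval level_guard \<tau>"
    then obtain l where I: "same_outside ({23}, {12}, {}, {}) ?\<sigma> \<tau>" "ireg \<tau> 23 = int l"
      "rreg \<tau> 12 = 2 ^ l" "l \<le> lev v" "q = (bcost level_guard + tm level_body) * (lev v - l) + bcost level_guard"
      unfolding I_def by blast
    have l: "l < lev v" using guard[OF I(1,3,4)] b I(4) by simp
    let ?q = "(bcost level_guard + tm level_body) * (lev v - Suc l) + bcost level_guard"
    have "I ?q (ev level_body \<tau>)"
      unfolding I_def using I(1-3) l
      by (intro exI[of _ "Suc l"]) (simp add: level_body_def same_outside_def)
    moreover have "bcost level_guard + tm level_body + ?q \<le> q"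
      unfolding I(5) using l by (simp add: Suc_diff_Suc[symmetric])
    moreover have "loopfree level_body" by (simp add: level_body_def)
    ultimately show "\<exists>T. runs level_body \<tau> T (\<lambda>\<tau>. \<exists>q'. I q' \<tau> \<and> bcost level_guard + T + q' \<le> q)"
      using runs_ev_pay by blast
  next
    fix q \<tau> assume "I q \<tau>" then show "bcost level_guard \<le> q" by (auto simp: I_def)
  next
    show "I ((bcost level_guard + tm level_body) * lev v + bcost level_guard) ?\<sigma>"
      unfolding I_def using r by (intro exI[of _ 0]) (simp add: same_outside_def)
  qed
  then have loop: "runs (While level_guard level_body) ?\<sigma> ((bcost level_guard + tm level_body) * lev v + bcost level_guard)
      (\<lambda>\<tau>. same_outside ({23}, {12}, {}, {}) ?\<sigma> \<tau> \<and> ireg \<tau> 23 = int (lev v) \<and> rreg \<tau> 12 = 2 ^ lev v)"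
    by (rule runs_weaken[OF _ order_refl]) (use guard in \<open>auto simp: I_def\<close>)
  have "runs (While level_guard level_body ;; push_site d) ?\<sigma>
      ((bcost level_guard + tm level_body) * lev v + bcost level_guard + tm (push_site d))
      (\<lambda>\<tau>. sites_done (Suc v) \<tau> \<and> ireg \<tau> 4 = int (Suc (idx v)))"
  proof (rule runs_Seq[OF loop _ order_refl])
    fix \<tau> assume t: "same_outside ({23}, {12}, {}, {}) ?\<sigma> \<tau> \<and> ireg \<tau> 23 = int (lev v) \<and> rreg \<tau> 12 = 2 ^ lev v"
    then have t': "same_outside ({23}, {11, 12, 14, 15}, {}, {}) \<sigma> \<tau>" "rreg \<tau> 11 = sr v" "rreg \<tau> 14 = sx v" "rreg \<tau> 15 = sy v"
      using s r by (simp_all add: same_outside_def)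
    have a: "iarr \<tau> = iarr \<sigma>" "rarr \<tau> = rarr \<sigma>" "ireg \<tau> 2 = ireg \<sigma> 2" "ireg \<tau> 0 = ireg \<sigma> 0"
      "ireg \<tau> 4 = ireg \<sigma> 4" "rreg \<tau> 2 = rreg \<sigma> 2"
      using t'(1) by (auto simp: same_outside_def)
    obtain m where m: "ireg \<sigma> 2 = int m" "\<forall>u<v. lev u \<le> m" "m = 0 \<or> (\<exists>u<v. m = lev u)"
      using assms(1) by (auto simp: sites_done_def)
    have "\<exists>m. ireg (ev (push_site d) \<tau>) 2 = int m \<and> (\<forall>u<Suc v. lev u \<le> m) \<and> (m = 0 \<or> (\<exists>u<Suc v. m = lev u))"
    proof (cases "m < lev v")
      case True
      then show ?thesis
        using m t by (intro exI[of _ "lev v"]) (auto simp: push_site_def a less_Suc_eq intro: order_trans)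
    next
      case False
      then show ?thesis
        using m t by (intro exI[of _ m]) (auto simp: push_site_def a less_Suc_eq)
    qed
    moreover have "holds_input (ev (push_site d) \<tau>) \<and> rreg (ev (push_site d) \<tau>) 2 = rmin"
      using inp a by (simp add: push_site_def holds_input_def)
    ultimately have "sites_done (Suc v) (ev (push_site d) \<tau>)"
      using assms(1) t t'(2-4) assms(3) unfolding sites_done_def
      by (simp add: push_site_def a replicate_append_same)
    moreover have "ireg (ev (push_site d) \<tau>) 4 = int (Suc (idx v))"
      using a assms(4) by (simp add: push_site_def)
    ultimately show "runs (push_site d) \<tau> (tm (push_site d)) (\<lambda>\<tau>. sites_done (Suc v) \<tau> \<and> ireg \<tau> 4 = int (Suc (idx v)))"
      by (intro runs_ev) (simp_all add: push_site_def)
  qed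
  then show ?thesis
    unfolding site_body_def
  proof (rule runs_Seq_ev[rotated])
    have c: "tm (pre_site d) = tm (pre_site 0)" "tm (push_site d) = tm (push_site 0)"
      by (simp_all add: pre_site_def push_site_def sign_const_def)
    have "(bcost level_guard + tm level_body) * lev v \<le> (bcost level_guard + tm level_body) * B"
      using assms(5) by simp
    then show "tm (pre_site d) + ((bcost level_guard + tm level_body) * lev v + bcost level_guard + tm (push_site d))
        \<le> site_unit * (B + 1)"
      unfolding c site_unit_def by (simp add: algebra_simps)
  qed (simp add: pre_site_def)
qed

lemma runs_add_sites:
  assumes "sites_done (d * n) \<sigma>" "d < 2" "\<And>v. v < 2 * n \<Longrightarrow> lev v \<le> B"
  shows "runs (add_sites d) \<sigma> (add_unit * (n * (B + 1))) (sites_done (d * n + n))"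
proof -
  let ?b = "ILess (IReg 4) (IReg 0)" and ?c = "iset 4 (IConst 0)"
  let ?u = "bcost ?b + site_unit * (B + 1)"
  define I where "I q \<tau> \<longleftrightarrow> (\<exists>i. sites_done (d * n + i) \<tau> \<and> ireg \<tau> 4 = int i \<and> i \<le> n \<and>
      q = ?u * (n - i) + bcost ?b)" for q \<tau>
  have "runs (While ?b (site_body d)) (ev ?c \<sigma>) (?u * n + bcost ?b) (\<lambda>\<tau>. (\<exists>q. I q \<tau>) \<and> \<not> bval ?b \<tau>)"
  proof (rule runs_While)
    fix q \<tau> assume "I q \<tau>" and b: "bval ?b \<tau>"
    then obtain i where I: "sites_done (d * n + i) \<tau>" "ireg \<tau> 4 = int i" "q = ?u * (n - i) + bcost ?b"
      unfolding I_def by blast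
    have i: "i < n" using b I(1,2) by (simp add: sites_done_def holds_input_def)
    have d: "d = 0 \<or> d = 1" using assms(2) by auto
    then have v: "d * n + i < 2 * n" "dir (d * n + i) = d" "idx (d * n + i) = i"
      using i by (auto simp: dir_def idx_def)
    let ?q = "?u * (n - Suc i) + bcost ?b"
    have "runs (site_body d) \<tau> (site_unit * (B + 1)) (\<lambda>\<tau>. \<exists>q'. I q' \<tau> \<and> bcost ?b + site_unit * (B + 1) + q' \<le> q)"
    proof (rule runs_weaken[OF _ order_refl])
      show "runs (site_body d) \<tau> (site_unit * (B + 1))
          (\<lambda>\<tau>. sites_done (Suc (d * n + i)) \<tau> \<and> ireg \<tau> 4 = int (Suc i))"
        using runs_site_body[OF I(1) v(1,2) _ assms(3)[OF v(1)], unfolded v(3), OF I(2)] .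
    next
      fix \<tau>' assume t: "sites_done (Suc (d * n + i)) \<tau>' \<and> ireg \<tau>' 4 = int (Suc i)"
      then have "I ?q \<tau>'" unfolding I_def using i by (intro exI[of _ "Suc i"]) simp
      moreover have "bcost ?b + site_unit * (B + 1) + ?q \<le> q"
        unfolding I(3) using i by (simp only: Suc_diff_Suc[OF i, symmetric] mult_Suc_right)
      ultimately show "\<exists>q'. I q' \<tau>' \<and> bcost ?b + site_unit * (B + 1) + q' \<le> q" by blast
    qed
    then show "\<exists>T. runs (site_body d) \<tau> T (\<lambda>\<tau>. \<exists>q'. I q' \<tau> \<and> bcost ?b + T + q' \<le> q)" by blast
  next
    fix q \<tau> assume "I q \<tau>" then show "bcost ?b \<le> q" by (auto simp: I_def)
  next
    show "I (?u * n + bcost ?b) (ev ?c \<sigma>)"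
      unfolding I_def using assms(1) by (intro exI[of _ 0]) (simp add: sites_done_def holds_input_def)
  qed
  then have "runs (While ?b (site_body d)) (ev ?c \<sigma>) (?u * n + bcost ?b) (sites_done (d * n + n))"
  proof (rule runs_weaken[OF _ order_refl])
    fix \<tau> assume "(\<exists>q. I q \<tau>) \<and> \<not> bval ?b \<tau>"
    then obtain i where I: "sites_done (d * n + i) \<tau>" "ireg \<tau> 4 = int i" "i \<le> n" "\<not> ireg \<tau> 4 < ireg \<tau> 0"
      unfolding I_def by auto
    then have "i = n" by (simp add: sites_done_def holds_input_def)
    then show "sites_done (d * n + n) \<tau>" using I(1) by simp
  qed
  then show ?thesis
    unfolding add_sites_def
  proof (rule runs_Seq_ev[rotated])
    have x: "x \<le> x * (n * (B + 1))" "x * n \<le> x * (n * (B + 1))" for x using n_pos by simp_all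
    have "tm ?c + (?u * n + bcost ?b) = (tm ?c + bcost ?b) + bcost ?b * n + site_unit * (n * (B + 1))"
      by (simp add: algebra_simps)
    also have "\<dots> \<le> (tm ?c + bcost ?b) * (n * (B + 1)) + bcost ?b * (n * (B + 1)) + site_unit * (n * (B + 1))"
      using x by (intro add_mono order_refl)
    also have "\<dots> = add_unit * (n * (B + 1))"
      unfolding add_unit_def by (simp only: add_mult_distrib mult_2)
    finally show "tm ?c + (?u * n + bcost ?b) \<le> add_unit * (n * (B + 1))" .
  qed simp
qed

text \<open>Depends on the cell of \<open>v\<close> only, as \<open>grouped\<close> requires of a
  representative.\<close>

definition rep :: "(real \<times> nat) list \<Rightarrow> nat \<Rightarrow> nat" where
  "rep L v = snd (L ! first.locate L (first.key v) 1)"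

lemma grouped_rep: "first.good {..<2 * n} (-1) L \<Longrightarrow> grouped ps r (rep L)"
  by unfold_locales (use first.locate_found(2,3)[of L _ 1] in \<open>auto simp: rep_def\<close>)

end

text \<open>What construction hands over to queries and what queries preserve. Emptiness of all
  further arrays is part of it, because the space bound counts every cell.\<close>

definition (in grouped) ready :: "nat \<Rightarrow> (real \<times> nat) list \<Rightarrow> store \<Rightarrow> bool" where
  "ready m L \<sigma> \<longleftrightarrow> rarr \<sigma> 0 = map fst ps \<and> rarr \<sigma> 1 = map snd ps \<and> rarr \<sigma> 2 = map r ps \<and>
     rarr \<sigma> 3 = map sx [0..<2 * n] \<and> rarr \<sigma> 4 = map sy [0..<2 * n] \<and> rarr \<sigma> 5 = map sr [0..<2 * n] \<and>
     rarr \<sigma> 6 = map (\<lambda>v. 2 ^ lev v) [0..<2 * n] \<and>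
     second.holds_data \<sigma> \<and> second.holds_envelope L \<sigma> \<and>
     (\<forall>a>10. rarr \<sigma> a = []) \<and> (\<forall>a>3. iarr \<sigma> a = []) \<and>
     ireg \<sigma> 2 = int m \<and> ireg \<sigma> 31 = int n \<and> rreg \<sigma> 2 = rmin \<and> (\<forall>v<2 * n. lev v \<le> m)"

context sites
begin

section \<open>Choosing the origins, and the construction as a whole\<close>

definition keyed :: "(real \<times> nat) list \<Rightarrow> store \<Rightarrow> bool" where
  "keyed L \<sigma> \<longleftrightarrow> first.holds_envelope L \<sigma> \<and> iarr \<sigma> 0 = K1 \<and> iarr \<sigma> 1 = K2 \<and> iarr \<sigma> 2 = K3 \<and>
     rarr \<sigma> 3 = map sx [0..<2 * n] \<and> rarr \<sigma> 4 = map sy [0..<2 * n] \<and> rarr \<sigma> 5 = map sr [0..<2 * n] \<and>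
     rarr \<sigma> 6 = map (\<lambda>v. 2 ^ lev v) [0..<2 * n] \<and> ireg \<sigma> 1 = int (2 * n)"

lemma keyed_same:
  "keyed L \<sigma> \<Longrightarrow> same_outside ({4} \<union> {17..30}, {19}, {}, {7, 8, 9}) \<sigma> \<tau> \<Longrightarrow> keyed L \<tau>"
  by (simp add: keyed_def same_outside_def first.holds_envelope_def)

lemma runs_set_origins:
  assumes k: "keyed L \<sigma>" and p: "2 * n \<le> 2 ^ p"
    and init: "rarr \<sigma> 7 = replicate (2 * n) 0" "rarr \<sigma> 8 = replicate (2 * n) 0" "rarr \<sigma> 9 = replicate (2 * n) 1"
  shows "runs set_origins \<sigma> (origin_unit * (2 * n * (p + 3)))
    (\<lambda>\<tau>. rarr \<tau> 7 = grouped.PX ps r (rep L) \<and> rarr \<tau> 8 = grouped.PY ps r (rep L) \<and> rarr \<tau> 9 = grouped.W ps r (rep L) \<and>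
      same_outside ({4} \<union> {17..30}, {19}, {}, {7, 8, 9}) \<sigma> \<tau>)"
proof -
  have good: "first.good {..<2 * n} (-1) L" using k by (simp add: keyed_def first.holds_envelope_def)
  interpret G: grouped ps r "rep L" using grouped_rep[OF good] .
  let ?b = "ILess (IReg 4) (IReg 1)" and ?c = "iset 4 (IConst 0)" and ?N = "2 * n"
  let ?W = "({4} \<union> {17..30}, {19}, {}, {7, 8, 9}) :: nat set \<times> nat set \<times> nat set \<times> nat set"
  let ?body = "rep_start ;; search ;; rep_end"
  let ?t = "tm rep_start + (search_unit * (p + 3) + tm rep_end)"
  \<comment> \<open>Arrays 7 to 9 are rewritten from left to right and hold placeholders beyond
    position \<open>i\<close>. The search reads only cells and pieces, so it works on these
    half-updated curves.\<close>
  define I where "I q \<tau> \<longleftrightarrow> (\<exists>i. same_outside ?W \<sigma> \<tau> \<and> ireg \<tau> 4 = int i \<and> i \<le> ?N \<and>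
      rarr \<tau> 7 = map G.gx [0..<i] @ replicate (?N - i) 0 \<and> rarr \<tau> 8 = map G.gy [0..<i] @ replicate (?N - i) 0 \<and>
      rarr \<tau> 9 = map G.gw [0..<i] @ replicate (?N - i) 1 \<and> q = (bcost ?b + ?t) * (?N - i) + bcost ?b)" for q \<tau>
  have "runs (While ?b ?body) (ev ?c \<sigma>) ((bcost ?b + ?t) * ?N + bcost ?b) (\<lambda>\<tau>. (\<exists>q. I q \<tau>) \<and> \<not> bval ?b \<tau>)"
  proof (rule runs_While)
    fix q \<tau> assume "I q \<tau>" and b: "bval ?b \<tau>"
    then obtain i where I: "same_outside ?W \<sigma> \<tau>" "ireg \<tau> 4 = int i"
      "rarr \<tau> 7 = map G.gx [0..<i] @ replicate (?N - i) 0" "rarr \<tau> 8 = map G.gy [0..<i] @ replicate (?N - i) 0"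
      "rarr \<tau> 9 = map G.gw [0..<i] @ replicate (?N - i) 1" "q = (bcost ?b + ?t) * (?N - i) + bcost ?b"
      unfolding I_def by blast
    have kt: "keyed L \<tau>" using keyed_same[OF k I(1)] .
    have i: "i < ?N" using b I(2) kt by (simp add: keyed_def)
    let ?\<tau> = "ev rep_start \<tau>"
    have s1: "same_outside ({20, 21, 22}, {19}, {}, {}) \<tau> ?\<tau>" by (simp add: rep_start_def same_outside_def)
    then have k1: "keyed L ?\<tau>" using kt by (simp add: keyed_def same_outside_def first.holds_envelope_def)
    have z: "Cell (ireg ?\<tau> 20) (ireg ?\<tau> 21) (ireg ?\<tau> 22) = first.key i" "rreg ?\<tau> 19 = 1"
      using I(2) kt by (simp_all add: rep_start_def keyed_def first.key_def)
    let ?l = "first.locate L (first.key i) 1"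
    have "first.holds_envelope L ?\<tau>" "iarr ?\<tau> 0 = K1" "iarr ?\<tau> 1 = K2" "iarr ?\<tau> 2 = K3"
      using k1 by (auto simp: keyed_def)
    note S = first.runs_search[OF this p, unfolded z]
    have "runs (search ;; rep_end) ?\<tau> (search_unit * (p + 3) + tm rep_end)
        (\<lambda>\<tau>. \<exists>q'. I q' \<tau> \<and> bcost ?b + ?t + q' \<le> q)"
    proof (rule runs_Seq[OF S _ order_refl])
      fix \<tau>' assume t: "ireg \<tau>' 17 = int ?l \<and> same_outside ({17, 18, 19}, {}, {}, {}) ?\<tau> \<tau>'"
      have lp: "?l < length L" "rep L i < ?N"
        using first.locate_found(1,3)[OF good i] by (auto simp: rep_def)
      have s2: "same_outside ({17, 18, 19, 20, 21, 22}, {19}, {}, {}) \<tau> \<tau>'"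
        using s1 t by (auto simp: same_outside_def)
      then have k2: "keyed L \<tau>'" using kt by (simp add: keyed_def same_outside_def first.holds_envelope_def)
      have g: "get (iarr \<tau>' 3) (int ?l) = int (rep L i)"
        using k2 lp by (simp add: keyed_def first.holds_envelope_def rep_def)
      have v: "get (rarr \<tau>' 3) (int i) = sx i" "get (rarr \<tau>' 4) (int i) = sy i" "get (rarr \<tau>' 5) (int i) = sr i"
        "get (rarr \<tau>' 6) (int i) = 2 ^ lev i" "get (rarr \<tau>' 3) (int (rep L i)) = sx (rep L i)"
        "get (rarr \<tau>' 4) (int (rep L i)) = sy (rep L i)"
        using k2 i lp(2) by (simp_all add: keyed_def)
      have a: "ireg \<tau>' 4 = int i" "rarr \<tau>' 7 = map G.gx [0..<i] @ replicate (?N - i) 0"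
        "rarr \<tau>' 8 = map G.gy [0..<i] @ replicate (?N - i) 0" "rarr \<tau>' 9 = map G.gw [0..<i] @ replicate (?N - i) 1"
        using s2 I by (simp_all add: same_outside_def)
      let ?q = "(bcost ?b + ?t) * (?N - Suc i) + bcost ?b" and ?e = "ev rep_end \<tau>'"
      have e7: "rarr ?e 7 = put (rarr \<tau>' 7) (int i) (G.gx i)"
        using a g v t by (simp add: rep_end_def G.gx_def)
      have e8: "rarr ?e 8 = put (rarr \<tau>' 8) (int i) (G.gy i)"
        using a g v t by (simp add: rep_end_def G.gy_def)
      note p7 = put_map_upt[OF i, of G.gx 0] and p8 = put_map_upt[OF i, of G.gy 0] and p9 = put_map_upt[OF i, of G.gw 1]
      have gg: "get (put (rarr \<tau>' 7) (int i) (sx i - sx (rep L i))) (int i) = G.gx i"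
        "get (put (rarr \<tau>' 8) (int i) (sy i - sy (rep L i) + 2 ^ lev i)) (int i) = G.gy i"
        using p7 p8 a by (simp_all only: G.gx_def[symmetric] G.gy_def[symmetric])
      have e9: "rarr ?e 9 = put (rarr \<tau>' 9) (int i) (G.gw i)"
        using a(1) g v t gg by (simp add: rep_end_def G.gw_def)
      have "I ?q ?e"
        unfolding I_def
      proof (intro exI[of _ "Suc i"] conjI)
        show "same_outside ?W \<sigma> ?e"
          using I(1) s2 by (auto simp: rep_end_def same_outside_def)
        show "ireg ?e 4 = int (Suc i)" using a(1) by (simp add: rep_end_def)
        show "Suc i \<le> ?N" using i by simp
        show "rarr ?e 7 = map G.gx [0..<Suc i] @ replicate (?N - Suc i) 0" unfolding e7 a(2) by (rule p7)
        show "rarr ?e 8 = map G.gy [0..<Suc i] @ replicate (?N - Suc i) 0" unfolding e8 a(3) by (rule p8)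
        show "rarr ?e 9 = map G.gw [0..<Suc i] @ replicate (?N - Suc i) 1" unfolding e9 a(4) by (rule p9)
      qed simp
      moreover have "bcost ?b + ?t + ?q \<le> q"
        unfolding I(6) Suc_diff_Suc[OF i, symmetric] by simp
      moreover have "loopfree rep_end" by (simp add: rep_end_def)
      ultimately show "runs rep_end \<tau>' (tm rep_end) (\<lambda>\<tau>. \<exists>q'. I q' \<tau> \<and> bcost ?b + ?t + q' \<le> q)"
        by (intro runs_ev) blast+
    qed
    then have "runs ?body \<tau> ?t (\<lambda>\<tau>. \<exists>q'. I q' \<tau> \<and> bcost ?b + ?t + q' \<le> q)"
      by (rule runs_Seq_ev[rotated]) (simp_all add: rep_start_def)
    then show "\<exists>T. runs ?body \<tau> T (\<lambda>\<tau>. \<exists>q'. I q' \<tau> \<and> bcost ?b + T + q' \<le> q)" by blast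
  next
    fix q \<tau> assume "I q \<tau>" then show "bcost ?b \<le> q" by (auto simp: I_def)
  next
    show "I ((bcost ?b + ?t) * ?N + bcost ?b) (ev ?c \<sigma>)"
      unfolding I_def using init by (intro exI[of _ 0]) (simp add: same_outside_def)
  qed
  then have "runs (While ?b ?body) (ev ?c \<sigma>) ((bcost ?b + ?t) * ?N + bcost ?b)
    (\<lambda>\<tau>. rarr \<tau> 7 = G.PX \<and> rarr \<tau> 8 = G.PY \<and> rarr \<tau> 9 = G.W \<and> same_outside ?W \<sigma> \<tau>)"
  proof (rule runs_weaken[OF _ order_refl])
    fix \<tau> assume "(\<exists>q. I q \<tau>) \<and> \<not> bval ?b \<tau>"
    then obtain i where I: "same_outside ?W \<sigma> \<tau>" "ireg \<tau> 4 = int i" "i \<le> ?N" "\<not> ireg \<tau> 4 < ireg \<tau> 1"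
      "rarr \<tau> 7 = map G.gx [0..<i] @ replicate (?N - i) 0" "rarr \<tau> 8 = map G.gy [0..<i] @ replicate (?N - i) 0"
      "rarr \<tau> 9 = map G.gw [0..<i] @ replicate (?N - i) 1"
      unfolding I_def by auto
    have "ireg \<tau> 1 = int ?N" using keyed_same[OF k I(1)] by (simp add: keyed_def)
    then have "i = ?N" using I(2-4) by linarith
    then show "rarr \<tau> 7 = G.PX \<and> rarr \<tau> 8 = G.PY \<and> rarr \<tau> 9 = G.W \<and> same_outside ?W \<sigma> \<tau>"
      using I by (simp add: G.PX_def G.PY_def G.W_def)
  qed
  then show ?thesis
    unfolding set_origins_def
  proof (rule runs_Seq_ev[rotated])
    have x: "x \<le> x * (?N * (p + 3))" "x * ?N \<le> x * (?N * (p + 3))" for x using n_pos by simp_all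
    have "tm ?c + ((bcost ?b + ?t) * ?N + bcost ?b) =
        (tm ?c + bcost ?b) + (bcost ?b + tm rep_start + tm rep_end) * ?N + search_unit * (?N * (p + 3))"
      by (simp add: algebra_simps)
    also have "\<dots> \<le> (tm ?c + bcost ?b) * (?N * (p + 3)) + (bcost ?b + tm rep_start + tm rep_end) * (?N * (p + 3))
        + search_unit * (?N * (p + 3))"
      by (intro add_mono order_refl x)
    also have "\<dots> = origin_unit * (?N * (p + 3))"
      unfolding origin_unit_def by (simp only: add_mult_distrib mult_2)
    finally show "tm ?c + ((bcost ?b + ?t) * ?N + bcost ?b) \<le> origin_unit * (?N * (p + 3))" .
  qed simp
qed

end


lemma writes_add_sites:
  "writes (add_sites d) = ({2, 4, 23, 25, 26}, {11, 12, 14, 15}, {0, 1, 2}, {3, 4, 5, 6, 7, 8, 9})"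
  by (auto simp: add_sites_def site_body_def pre_site_def level_body_def push_site_def)

context sites
begin

definition fresh :: "store \<Rightarrow> bool" where
  "fresh \<sigma> \<longleftrightarrow> (\<forall>a>9. rarr \<sigma> a = []) \<and> (\<forall>a>2. iarr \<sigma> a = []) \<and> ireg \<sigma> 31 = int n \<and> ireg \<sigma> 1 = int (2 * n)"

lemma runs_add_sites':
  assumes "sites_done (d * n) \<sigma> \<and> fresh \<sigma>" "d < 2" "\<And>v. v < 2 * n \<Longrightarrow> lev v \<le> B"
  shows "runs (add_sites d) \<sigma> (add_unit * (n * (B + 1))) (\<lambda>\<tau>. sites_done (d * n + n) \<tau> \<and> fresh \<tau>)"
  by (rule runs_weaken[OF runs_same_outside[OF runs_add_sites[OF conjunct1[OF assms(1)] assms(2,3)]]])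
    (use assms(1) in \<open>auto simp: writes_add_sites same_outside_def fresh_def\<close>)

definition sorted_cells :: "(real \<times> nat) list \<Rightarrow> store \<Rightarrow> bool" where
  "sorted_cells L \<sigma> \<longleftrightarrow> keyed L \<sigma> \<and> rarr \<sigma> 0 = map fst ps \<and> rarr \<sigma> 1 = map snd ps \<and> rarr \<sigma> 2 = map r ps \<and>
     rreg \<sigma> 2 = rmin \<and> (\<forall>a>10. rarr \<sigma> a = []) \<and> (\<forall>a>3. iarr \<sigma> a = []) \<and> ireg \<sigma> 31 = int n \<and>
     (\<exists>m. ireg \<sigma> 2 = int m \<and> (\<forall>v<2 * n. lev v \<le> m) \<and> (m = 0 \<or> (\<exists>v<2 * n. m = lev v)))"

lemma runs_first_build:
  assumes "sites_done (2 * n) \<sigma> \<and> fresh \<sigma>" "2 * n \<le> 2 ^ p"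
  shows "runs build \<sigma> (build_unit * (2 * n * (p + 1))) (\<lambda>\<tau>. \<exists>L. sorted_cells L \<tau> \<and>
    rarr \<tau> 7 = replicate (2 * n) 0 \<and> rarr \<tau> 8 = replicate (2 * n) 0 \<and> rarr \<tau> 9 = replicate (2 * n) 1)"
proof -
  have d: "first.holds_data \<sigma>" "ireg \<sigma> 1 = int (2 * n)"
    using assms(1) unfolding first.holds_data_def by (simp_all add: sites_done_def K1_def K2_def K3_def fresh_def)
  show ?thesis
  proof (rule runs_weaken[OF first.runs_build[OF d _ assms(2)] order_refl])
    show "0 < 2 * n" using n_pos by simp
  next
    fix \<tau> assume t: "(\<exists>L. first.holds_envelope L \<tau>) \<and> rarr \<tau> 11 = [] \<and> iarr \<tau> 4 = [] \<and> iarr \<tau> 5 = [] \<and>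
      same_outside ({3, 4, 5, 6, 7, 8, 9, 10, 11, 12, 13, 14, 15, 16},
        {3, 4, 5, 6, 7, 8, 9, 10}, {3, 4, 5}, {10, 11}) \<sigma> \<tau>"
    then obtain L where L: "first.holds_envelope L \<tau>" by blast
    have r: "rarr \<tau> a = rarr \<sigma> a" if "a \<noteq> 10" "a \<noteq> 11" for a
      using t that by (simp add: same_outside_def)
    have i: "iarr \<tau> a = iarr \<sigma> a" if "a \<noteq> 3" "a \<noteq> 4" "a \<noteq> 5" for a
      using t that by (simp add: same_outside_def)
    have s: "ireg \<tau> 1 = ireg \<sigma> 1" "ireg \<tau> 2 = ireg \<sigma> 2" "ireg \<tau> 31 = ireg \<sigma> 31" "rreg \<tau> 2 = rreg \<sigma> 2"
      using t by (simp_all add: same_outside_def)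
    have "rarr \<tau> a = []" if "a > 10" for a
      using t r[of a] assms(1) that by (cases "a = 11") (auto simp: fresh_def)
    moreover have "iarr \<tau> a = []" if "a > 3" for a
      using t i[of a] assms(1) that by (cases "a = 4 \<or> a = 5") (auto simp: fresh_def)
    moreover have "keyed L \<tau>"
      using L assms(1) s by (simp add: keyed_def r i sites_done_def K1_def K2_def K3_def fresh_def)
    ultimately have "sorted_cells L \<tau>"
      using assms(1) s unfolding sorted_cells_def by (simp add: r sites_done_def holds_input_def fresh_def)
    then show "\<exists>L. sorted_cells L \<tau> \<and> rarr \<tau> 7 = replicate (2 * n) 0 \<and>
        rarr \<tau> 8 = replicate (2 * n) 0 \<and> rarr \<tau> 9 = replicate (2 * n) 1"
      using assms(1) by (auto simp: r sites_done_def)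
  qed
qed

lemma runs_second_build:
  assumes s: "sorted_cells L \<sigma>" and d: "rarr \<sigma> 7 = grouped.PX ps r (rep L)"
    "rarr \<sigma> 8 = grouped.PY ps r (rep L)" "rarr \<sigma> 9 = grouped.W ps r (rep L)"
    and p: "2 * n \<le> 2 ^ p" and B: "\<And>v. v < 2 * n \<Longrightarrow> lev v \<le> B"
  shows "runs build \<sigma> (build_unit * (2 * n * (p + 1)))
    (\<lambda>\<tau>. \<exists>g m L. grouped ps r g \<and> grouped.ready ps r g m L \<tau> \<and> m \<le> B)"
proof -
  have good: "first.good {..<2 * n} (-1) L"
    using s by (simp add: sorted_cells_def keyed_def first.holds_envelope_def)
  interpret G: grouped ps r "rep L" using grouped_rep[OF good] .
  have h: "G.second.holds_data \<sigma>" "ireg \<sigma> 1 = int (2 * n)"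
    using s d by (auto simp: G.second.holds_data_def sorted_cells_def keyed_def)
  show ?thesis
  proof (rule runs_weaken[OF G.second.runs_build[OF h _ p] order_refl])
    show "0 < 2 * n" using n_pos by simp
  next
    fix \<tau> assume t: "(\<exists>L. G.second.holds_envelope L \<tau>) \<and> rarr \<tau> 11 = [] \<and> iarr \<tau> 4 = [] \<and> iarr \<tau> 5 = [] \<and>
      same_outside ({3, 4, 5, 6, 7, 8, 9, 10, 11, 12, 13, 14, 15, 16},
        {3, 4, 5, 6, 7, 8, 9, 10}, {3, 4, 5}, {10, 11}) \<sigma> \<tau>"
    then obtain L' where L': "G.second.holds_envelope L' \<tau>" by blast
    have r: "rarr \<tau> a = rarr \<sigma> a" if "a \<noteq> 10" "a \<noteq> 11" for a
      using t that by (simp add: same_outside_def)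
    have i: "iarr \<tau> a = iarr \<sigma> a" if "a \<noteq> 3" "a \<noteq> 4" "a \<noteq> 5" for a
      using t that by (simp add: same_outside_def)
    have c: "ireg \<tau> 2 = ireg \<sigma> 2" "ireg \<tau> 31 = ireg \<sigma> 31" "rreg \<tau> 2 = rreg \<sigma> 2"
      using t by (simp_all add: same_outside_def)
    obtain m where m: "ireg \<sigma> 2 = int m" "\<forall>v<2 * n. lev v \<le> m" "m = 0 \<or> (\<exists>v<2 * n. m = lev v)"
      using s by (auto simp: sorted_cells_def)
    have "rarr \<tau> a = []" if "a > 10" for a
      using t r[of a] s that by (cases "a = 11") (auto simp: sorted_cells_def)
    moreover have "iarr \<tau> a = []" if "a > 3" for a
      using t i[of a] s that by (cases "a = 4 \<or> a = 5") (auto simp: sorted_cells_def)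
    moreover have "G.second.holds_data \<tau>"
      using h(1) by (simp add: G.second.holds_data_def r i)
    ultimately have "G.ready m L' \<tau>"
      using s m c L' unfolding G.ready_def by (simp add: r sorted_cells_def keyed_def)
    moreover have "m \<le> B" using m(3) B by auto
    ultimately show "\<exists>g m L. grouped ps r g \<and> grouped.ready ps r g m L \<tau> \<and> m \<le> B"
      using G.grouped_axioms by blast
  qed
qed

lemma runs_set_origins':
  assumes s: "sorted_cells L \<sigma>" and p: "2 * n \<le> 2 ^ p"
    and init: "rarr \<sigma> 7 = replicate (2 * n) 0" "rarr \<sigma> 8 = replicate (2 * n) 0" "rarr \<sigma> 9 = replicate (2 * n) 1"
  shows "runs set_origins \<sigma> (origin_unit * (2 * n * (p + 3)))
    (\<lambda>\<tau>. sorted_cells L \<tau> \<and> rarr \<tau> 7 = grouped.PX ps r (rep L) \<and> rarr \<tau> 8 = grouped.PY ps r (rep L) \<and>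
      rarr \<tau> 9 = grouped.W ps r (rep L))"
proof -
  have k: "keyed L \<sigma>" using s by (simp add: sorted_cells_def)
  show ?thesis
  proof (rule runs_weaken[OF runs_set_origins[OF k p init] order_refl])
    fix \<tau> assume t: "rarr \<tau> 7 = grouped.PX ps r (rep L) \<and> rarr \<tau> 8 = grouped.PY ps r (rep L) \<and>
      rarr \<tau> 9 = grouped.W ps r (rep L) \<and> same_outside ({4} \<union> {17..30}, {19}, {}, {7, 8, 9}) \<sigma> \<tau>"
    then have "keyed L \<tau>" using keyed_same[OF k] by blast
    then have "sorted_cells L \<tau>"
      using s t unfolding sorted_cells_def by (simp add: same_outside_def)
    then show "sorted_cells L \<tau> \<and> rarr \<tau> 7 = grouped.PX ps r (rep L) \<and> rarr \<tau> 8 = grouped.PY ps r (rep L) \<and>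
      rarr \<tau> 9 = grouped.W ps r (rep L)" using t by blast
  qed
qed

lemma runs_construct:
  assumes inp: "holds_input \<sigma>" and e: "\<forall>a>2. rarr \<sigma> a = []" "\<forall>a. iarr \<sigma> a = []"
    and p: "2 * n \<le> 2 ^ p" and B: "\<And>v. v < 2 * n \<Longrightarrow> lev v \<le> B"
  shows "runs construct \<sigma> (construct_unit * (n * ((B + 1) * (p + 3))))
    (\<lambda>\<tau>. \<exists>g m L. grouped ps r g \<and> grouped.ready ps r g m L \<tau> \<and> m \<le> B)"
proof -
  let ?done = "\<lambda>\<tau>. \<exists>g m L. grouped ps r g \<and> grouped.ready ps r g m L \<tau> \<and> m \<le> B"
  let ?b = "build_unit * (2 * n * (p + 1))" and ?o = "origin_unit * (2 * n * (p + 3))"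
    and ?a = "add_unit * (n * (B + 1))"
  have 6: "runs (set_origins ;; build) \<tau> (?o + ?b) ?done"
    if t: "\<exists>L. sorted_cells L \<tau> \<and> rarr \<tau> 7 = replicate (2 * n) 0 \<and> rarr \<tau> 8 = replicate (2 * n) 0 \<and>
      rarr \<tau> 9 = replicate (2 * n) 1" for \<tau>
  proof -
    obtain L where L: "sorted_cells L \<tau>" "rarr \<tau> 7 = replicate (2 * n) 0" "rarr \<tau> 8 = replicate (2 * n) 0"
      "rarr \<tau> 9 = replicate (2 * n) 1" using t by blast
    show ?thesis
      by (rule runs_Seq[OF runs_set_origins'[OF L(1) p L(2-4)] _ order_refl])
        (use runs_second_build p B in blast)
  qed
  have 5: "runs (build ;; set_origins ;; build) \<tau> (?b + (?o + ?b)) ?done"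
    if t: "sites_done (2 * n) \<tau> \<and> fresh \<tau>" for \<tau>
    by (rule runs_Seq[OF runs_first_build[OF t p] 6 order_refl])
  have 4: "runs (add_sites 1 ;; build ;; set_origins ;; build) \<tau> (?a + (?b + (?o + ?b))) ?done"
    if t: "sites_done n \<tau> \<and> fresh \<tau>" for \<tau>
    by (rule runs_Seq[OF runs_add_sites'[of 1] 5 order_refl]) (use t B in \<open>auto simp: mult_2\<close>)
  have 3: "runs (add_sites 0 ;; add_sites 1 ;; build ;; set_origins ;; build) \<tau> (?a + (?a + (?b + (?o + ?b)))) ?done"
    if t: "sites_done 0 \<tau> \<and> fresh \<tau>" for \<tau>
    by (rule runs_Seq[OF runs_add_sites'[of 0] 4 order_refl]) (use t B in auto)
  have 2: "runs (set_counters ;; add_sites 0 ;; add_sites 1 ;; build ;; set_origins ;; build) \<tau>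
      (tm set_counters + (?a + (?a + (?b + (?o + ?b))))) ?done"
    if t: "rreg \<tau> 2 = rmin \<and> same_outside ({4}, {2}, {}, {}) \<sigma> \<tau>" for \<tau>
  proof (rule runs_Seq_ev[OF _ 3 order_refl])
    have a: "rarr \<tau> = rarr \<sigma>" "iarr \<tau> = iarr \<sigma>" "ireg \<tau> 0 = ireg \<sigma> 0"
      using t by (auto simp: same_outside_def)
    show "sites_done 0 (ev set_counters \<tau>) \<and> fresh (ev set_counters \<tau>)"
      using inp e t by (simp add: set_counters_def sites_done_def fresh_def holds_input_def a)
  qed (simp add: set_counters_def)
  have "runs construct \<sigma> (min_unit * n + (tm set_counters + (?a + (?a + (?b + (?o + ?b)))))) ?done"
    unfolding construct_def by (rule runs_Seq[OF runs_find_min[OF inp] 2 order_refl])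
  then show ?thesis
  proof (rule runs_weaken)
    let ?X = "n * ((B + 1) * (p + 3))"
    have k: "x * y \<le> x * ?X" if "y \<le> ?X" for x y using that by simp
    have "n * 1 \<le> ?X" using n_pos by (intro mult_le_mono) auto
    then have "min_unit * n \<le> min_unit * ?X" by simp
    moreover have "1 * 1 \<le> ?X" using n_pos by (intro mult_le_mono) auto
    then have "tm set_counters * 1 \<le> tm set_counters * ?X" by (intro k) simp
    moreover have "n * ((B + 1) * 1) \<le> ?X" by (intro mult_le_mono) auto
    then have "?a \<le> add_unit * ?X" by (intro k) simp
    moreover have "n * (1 * (p + 1)) \<le> ?X" by (intro mult_le_mono) auto
    then have "build_unit * (n * (p + 1)) \<le> build_unit * ?X" by (intro k) simp
    then have "?b \<le> 2 * (build_unit * ?X)" by (simp add: algebra_simps)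
    moreover have "n * (1 * (p + 3)) \<le> ?X" by (intro mult_le_mono) auto
    then have "origin_unit * (n * (p + 3)) \<le> origin_unit * ?X" by (intro k) simp
    then have "?o \<le> 2 * (origin_unit * ?X)" by (simp add: algebra_simps)
    ultimately have "min_unit * n + (tm set_counters + (?a + (?a + (?b + (?o + ?b))))) \<le>
        min_unit * ?X + tm set_counters * ?X + 2 * (add_unit * ?X) + 4 * (build_unit * ?X) + 2 * (origin_unit * ?X)"
      by linarith
    also have "\<dots> = construct_unit * ?X"
      unfolding construct_unit_def by (simp only: add_mult_distrib mult.assoc)
    finally show "min_unit * n + (tm set_counters + (?a + (?a + (?b + (?o + ?b))))) \<le> construct_unit * ?X" .
  qed
qed

end


section \<open>Answering queries\<close>

definition find_start :: "nat \<Rightarrow> com" where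
  "find_start d = rset 14 (scaled (RReg 0)) ;; rset 15 (RMul (sign_const d) (scaled (RReg 1))) ;;
     iset 28 (IConst (-1)) ;; iset 23 (IConst 0)"

text \<open>Register 28 holds -1 as long as there is no candidate. Levels are visited upwards, so
  the loop stops at the candidate of the lowest level.\<close>

definition find_guard :: bexp where
  "find_guard = BAnd (BNot (ILess (IReg 2) (IReg 23))) (ILess (IReg 28) (IConst 0))"

definition look_start :: "nat \<Rightarrow> int \<Rightarrow> int \<Rightarrow> com" where
  "look_start d dx dy = iset 20 (IAdd (IAdd (IReg 23) (IReg 23)) (IConst (int d))) ;;
     Do (Grid 21 22 (RReg 14) (RReg 15) (IReg 23)) ;;
     iset 21 (IAdd (IReg 21) (IConst dx)) ;; iset 22 (IAdd (IReg 22) (IConst dy)) ;; rset 19 (RConst 1)"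

definition present_exp :: bexp where
  "present_exp = BAnd (ILess (IReg 17) (IReg 3)) (BAnd (IEq (IGet 0 (IGet 3 (IReg 17))) (IReg 20))
     (BAnd (IEq (IGet 1 (IGet 3 (IReg 17))) (IReg 21)) (IEq (IGet 2 (IGet 3 (IReg 17))) (IReg 22))))"

definition look_origin :: com where
  "look_origin = iset 27 (IGet 3 (IReg 17)) ;;
     rset 16 (RSub (RReg 14) (RSub (RGet 3 (IReg 27)) (RGet 7 (IReg 27)))) ;;
     rset 17 (RSub (RReg 15) (RSub (RGet 4 (IReg 27)) (RGet 8 (IReg 27))))"

definition look_sine :: com where
  "look_sine = rset 19 (RDiv (RReg 16) (RSqrt (RAdd (RMul (RReg 16) (RReg 16)) (RMul (RReg 17) (RReg 17)))))"

definition look_test :: "nat \<Rightarrow> com" where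
  "look_test d = iset 27 (IGet 3 (IReg 17)) ;;
     If (RLess (RMul (RGet 5 (IReg 27)) (RGet 5 (IReg 27)))
           (RAdd (RMul (RSub (RGet 3 (IReg 27)) (RReg 14)) (RSub (RGet 3 (IReg 27)) (RReg 14)))
              (RMul (RSub (RGet 4 (IReg 27)) (RReg 15)) (RSub (RGet 4 (IReg 27)) (RReg 15)))))
       skip (iset 28 (if d = 0 then IReg 27 else ISub (IReg 27) (IReg 31)))"

definition look_cell :: "nat \<Rightarrow> com" where
  "look_cell d = look_origin ;; If (RLess (RConst 0) (RReg 17)) (look_sine ;; search ;; look_test d) skip"

definition next_level :: com where
  "next_level = iset 23 (IAdd (IReg 23) (IConst 1))"

definition look :: "nat \<Rightarrow> int \<Rightarrow> int \<Rightarrow> com" where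
  "look d dx dy = look_start d dx dy ;; search ;; If present_exp (look_cell d) skip ;; next_level"

definition find :: "nat \<Rightarrow> int \<Rightarrow> int \<Rightarrow> com" where
  "find d dx dy = find_start d ;; While find_guard (look d dx dy)"

definition look_unit :: nat where
  "look_unit = 2 * search_unit + tm (look_start 0 0 0) + bcost present_exp + tm look_origin +
     bcost (RLess (RConst 0) (RReg 17)) + tm look_sine + tm (look_test 1) + 1 + tm next_level"

definition find_unit :: nat where
  "find_unit = look_unit + 2 * bcost find_guard + tm (find_start 0)"

abbreviation find_writes :: "nat set \<times> nat set \<times> nat set \<times> nat set" where
  "find_writes \<equiv> ({17, 18, 19, 20, 21, 22, 23, 27, 28}, {14, 15, 16, 17, 19}, {}, {})"

lemma in_place_find: "in_place (find d dx dy)"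
  by (auto simp: find_def find_start_def look_def look_start_def look_cell_def look_origin_def
      look_sine_def look_test_def next_level_def search_def search_body_def)

context grouped
begin

lemma ready_same:
  assumes "ready m L \<sigma>" "iarr \<tau> = iarr \<sigma>" "rarr \<tau> = rarr \<sigma>"
    "ireg \<tau> 2 = ireg \<sigma> 2" "ireg \<tau> 3 = ireg \<sigma> 3" "ireg \<tau> 31 = ireg \<sigma> 31" "rreg \<tau> 2 = rreg \<sigma> 2"
  shows "ready m L \<tau>"
  using assms by (simp add: ready_def second.holds_data_def second.holds_envelope_def)

lemma ready_find: "ready m L \<sigma> \<Longrightarrow> same_outside find_writes \<sigma> \<tau> \<Longrightarrow> ready m L \<tau>"
  by (rule ready_same[of m L \<sigma>]) (auto simp: same_outside_def)

lemma ready_search: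
  assumes "ready m L \<sigma>" "2 * n \<le> 2 ^ p"
  shows "runs search \<sigma> (search_unit * (p + 3))
    (\<lambda>\<tau>. ireg \<tau> 17 = int (second.locate L (Cell (ireg \<sigma> 20) (ireg \<sigma> 21) (ireg \<sigma> 22)) (rreg \<sigma> 19)) \<and>
      same_outside ({17, 18, 19}, {}, {}, {}) \<sigma> \<tau>)"
  using assms by (intro second.runs_search) (auto simp: ready_def second.holds_data_def)

definition query_state :: "nat \<Rightarrow> (real \<times> nat) list \<Rightarrow> nat \<Rightarrow> point \<Rightarrow> store \<Rightarrow> store \<Rightarrow> bool" where
  "query_state m L d x \<sigma> \<tau> \<longleftrightarrow> ready m L \<tau> \<and> rreg \<tau> 14 = qx x \<and> rreg \<tau> 15 = qy d x \<and>
     same_outside find_writes \<sigma> \<tau>"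

lemma query_state_same:
  assumes "query_state m L d x \<sigma> \<tau>"
    "same_outside ({17, 18, 19, 20, 21, 22, 23, 27, 28}, {16, 17, 19}, {}, {}) \<tau> \<tau>'"
  shows "query_state m L d x \<sigma> \<tau>'"
proof -
  have "same_outside find_writes \<tau> \<tau>'" using assms(2) by (auto simp: same_outside_def)
  then show ?thesis
    using assms ready_find unfolding query_state_def by (auto simp: same_outside_def)
qed

definition answer_of :: "nat option \<Rightarrow> int" where
  "answer_of c = (case c of None \<Rightarrow> -1 | Some a \<Rightarrow> int (idx a))"

lemma runs_look_cell:
  assumes q: "query_state m L d x \<sigma> \<tau>" and p: "2 * n \<le> 2 ^ p" and d: "d < 2"
    and z: "z = cell_at d dx dy x l" "present L z"
    and t: "ireg \<tau> 17 = int (second.locate L z 1)" "Cell (ireg \<tau> 20) (ireg \<tau> 21) (ireg \<tau> 22) = z"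
      "ireg \<tau> 28 = -1" "ireg \<tau> 23 = int l"
  shows "runs (look_cell d) \<tau> (tm look_origin + (bcost (RLess (RConst 0) (RReg 17)) +
      (tm look_sine + (search_unit * (p + 3) + tm (look_test 1)) + 1)))
    (\<lambda>\<tau>'. query_state m L d x \<sigma> \<tau>' \<and> ireg \<tau>' 23 = int l \<and> ireg \<tau>' 28 = answer_of (cand L d dx dy x l))"
    (is "runs _ _ _ ?Q")
proof -
  have ready: "ready m L \<tau>" using q by (simp add: query_state_def)
  then have good: "second.good {..<2 * n} (-1) L" by (simp add: ready_def second.holds_envelope_def)
  define v where "v = hit L z 1"
  note pv = present_site[OF good z(2), folded v_def]
  have iL: "get (iarr \<tau> 3) (int i) = int (snd (L ! i))" if "i < length L" for i
    using ready that by (simp add: ready_def second.holds_envelope_def)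
  have gv: "get (rarr \<tau> 3) (int u) = sx u" "get (rarr \<tau> 4) (int u) = sy u" "get (rarr \<tau> 5) (int u) = sr u"
    "get (rarr \<tau> 7) (int u) = gx u" "get (rarr \<tau> 8) (int u) = gy u" if "u < 2 * n" for u
    using ready that unfolding ready_def second.holds_data_def by (simp_all add: PX_def PY_def)
  let ?\<tau> = "ev look_origin \<tau>"
  have v17: "get (iarr \<tau> 3) (int (second.locate L z 1)) = int v"
    using iL z(2) by (simp add: present_def v_def hit_def)
  have o: "rreg ?\<tau> 16 = ux v x" "rreg ?\<tau> 17 = uy d v x" "iarr ?\<tau> = iarr \<tau>" "rarr ?\<tau> = rarr \<tau>"
    "ireg ?\<tau> 23 = int l" "ireg ?\<tau> 28 = -1" "Cell (ireg ?\<tau> 20) (ireg ?\<tau> 21) (ireg ?\<tau> 22) = z"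
    using q t gv[OF pv(1)] v17 by (simp_all add: look_origin_def ux_def uy_def query_state_def)
  have q1: "query_state m L d x \<sigma> ?\<tau>"
    by (rule query_state_same[OF q]) (simp add: look_origin_def same_outside_def)
  show ?thesis
    unfolding look_cell_def
  proof (rule runs_Seq_ev[OF _ _ order_refl])
    show "loopfree look_origin" by (simp add: look_origin_def)
    show "runs (If (RLess (RConst 0) (RReg 17)) (look_sine ;; search ;; look_test d) skip) ?\<tau>
      (bcost (RLess (RConst 0) (RReg 17)) + (tm look_sine + (search_unit * (p + 3) + tm (look_test 1)) + 1)) ?Q"
    proof (rule runs_If[OF _ _ order_refl])
      assume "\<not> bval (RLess (RConst 0) (RReg 17)) ?\<tau>"
      then have "cand L d dx dy x l = None"
        using o by (simp add: cand_def Let_def flip: z(1) v_def)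
      then show "runs skip ?\<tau> (tm look_sine + (search_unit * (p + 3) + tm (look_test 1)) + 1) ?Q"
        using q1 o by (intro runs_ev) (simp_all add: answer_of_def)
    next
      assume "bval (RLess (RConst 0) (RReg 17)) ?\<tau>"
      then have pos: "0 < uy d v x" using o by simp
      define s where "s = sine d v x"
      note sb = sine_bounds(1,2)[OF pos, folded s_def]
      let ?\<rho> = "ev look_sine ?\<tau>"
      have q2: "query_state m L d x \<sigma> ?\<rho>"
        by (rule query_state_same[OF q1]) (simp add: look_sine_def same_outside_def)
      have s2: "rreg ?\<rho> 19 = s" "Cell (ireg ?\<rho> 20) (ireg ?\<rho> 21) (ireg ?\<rho> 22) = z"
        "ireg ?\<rho> 23 = int l" "ireg ?\<rho> 28 = -1"
        using o by (simp_all add: look_sine_def s_def sine_def)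
      have r2: "ready m L ?\<rho>" using q2 by (simp add: query_state_def)
      define a where "a = hit L z s"
      have ha: "second.locate L z s < length L" "a < 2 * n" "first.key a = z"
        using hit_props(1-3)[OF good pv(1) pv(2)[symmetric] sb(1) less_imp_le[OF sb(2)]] by (auto simp: a_def)
      have cand: "cand L d dx dy x l = (if covers d a x then Some a else None)"
        using z(2) pos by (simp add: cand_def Let_def a_def s_def v_def flip: z(1))
      note S = ready_search[OF r2 p, unfolded s2(1,2)]
      have "runs (search ;; look_test d) ?\<rho> (search_unit * (p + 3) + tm (look_test 1)) ?Q"
      proof (rule runs_Seq[OF S _ order_refl])
        fix \<tau>' assume t': "ireg \<tau>' 17 = int (second.locate L z s) \<and> same_outside ({17, 18, 19}, {}, {}, {}) ?\<rho> \<tau>'"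
        have q3: "query_state m L d x \<sigma> \<tau>'"
          by (rule query_state_same[OF q2]) (use t' in \<open>simp add: same_outside_def\<close>)
        have a3: "iarr \<tau>' = iarr \<tau>" "rarr \<tau>' = rarr \<tau>" "ireg \<tau>' 23 = int l" "ireg \<tau>' 28 = -1"
          using t' s2 o by (auto simp: same_outside_def look_sine_def)
        have x3: "rreg \<tau>' 14 = qx x" "rreg \<tau>' 15 = qy d x" "ireg \<tau>' 31 = int n"
          using q3 by (simp_all add: query_state_def ready_def)
        have a17: "get (iarr \<tau>' 3) (ireg \<tau>' 17) = int a"
          using t' iL[OF ha(1)] by (simp add: a3 a_def hit_def)
        have id: "idx a = (if d = 0 then a else a - n)" "d \<noteq> 0 \<Longrightarrow> n \<le> a" if "covers d a x"
        proof -
          have "dir a = d"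
            using cand_SomeD(4)[OF good _ d, of dx dy x l a] cand that by simp
          then show "idx a = (if d = 0 then a else a - n)" "d \<noteq> 0 \<Longrightarrow> n \<le> a"
            by (auto simp: idx_def dir_def split: if_splits)
        qed
        have "ireg (ev (look_test d) \<tau>') 28 = answer_of (cand L d dx dy x l)"
        proof (cases "covers d a x")
          case True
          then show ?thesis
            using id[OF True] gv[OF ha(2)] x3 a17 cand
            by (auto simp: look_test_def a3 covers_def answer_of_def not_less[symmetric] of_nat_diff)
        next
          case False
          then show ?thesis
            using gv[OF ha(2)] x3 a17 cand
            by (simp add: look_test_def a3 covers_def answer_of_def not_less[symmetric])
        qed
        moreover have "query_state m L d x \<sigma> (ev (look_test d) \<tau>')"
          by (rule query_state_same[OF q3]) (simp add: look_test_def same_outside_def)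
        moreover have "ireg (ev (look_test d) \<tau>') 23 = int l"
          using a3 by (simp add: look_test_def)
        \<comment> \<open>A mirror image costs one subtraction more, to get back the index of its
          site; so direction 1 gives the bound for both.\<close>
        moreover have "tm (look_test d) \<le> tm (look_test 1)" by (simp add: look_test_def)
        ultimately show "runs (look_test d) \<tau>' (tm (look_test 1)) ?Q"
          by (intro runs_ev) (simp_all add: look_test_def)
      qed
      then show "runs (look_sine ;; search ;; look_test d) ?\<tau>
          (tm look_sine + (search_unit * (p + 3) + tm (look_test 1)) + 1) ?Q"
        by (rule runs_Seq_ev[rotated]) (simp_all add: look_sine_def)
    qed
  qed
qed

lemma runs_look:
  assumes q: "query_state m L d x \<sigma> \<tau>" and p: "2 * n \<le> 2 ^ p" and d: "d < 2"
    and t: "ireg \<tau> 28 = -1" "ireg \<tau> 23 = int l"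
  shows "runs (look d dx dy) \<tau> (look_unit * (p + 3))
    (\<lambda>\<tau>'. query_state m L d x \<sigma> \<tau>' \<and> ireg \<tau>' 23 = int (Suc l) \<and> ireg \<tau>' 28 = answer_of (cand L d dx dy x l))"
    (is "runs _ _ _ ?Q")
proof -
  define z where "z = cell_at d dx dy x l"
  let ?c = "tm look_origin + (bcost (RLess (RConst 0) (RReg 17)) +
      (tm look_sine + (search_unit * (p + 3) + tm (look_test 1)) + 1))"
  let ?R = "\<lambda>\<tau>'. query_state m L d x \<sigma> \<tau>' \<and> ireg \<tau>' 23 = int l \<and> ireg \<tau>' 28 = answer_of (cand L d dx dy x l)"
  let ?\<tau> = "ev (look_start d dx dy) \<tau>"
  have q1: "query_state m L d x \<sigma> ?\<tau>"
    by (rule query_state_same[OF q]) (simp add: look_start_def same_outside_def)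
  have s1: "Cell (ireg ?\<tau> 20) (ireg ?\<tau> 21) (ireg ?\<tau> 22) = z" "rreg ?\<tau> 19 = 1" "ireg ?\<tau> 28 = -1" "ireg ?\<tau> 23 = int l"
    using q t by (simp_all add: look_start_def z_def cell_at_def query_state_def)
  have r1: "ready m L ?\<tau>" using q1 by (simp add: query_state_def)
  note S = ready_search[OF r1 p, unfolded s1(1,2)]
  have nxt: "runs next_level \<rho> (tm next_level) ?Q" if "?R \<rho>" for \<rho>
  proof (rule runs_ev)
    have "query_state m L d x \<sigma> (ev next_level \<rho>)"
      by (rule query_state_same[of m L d x \<sigma> \<rho>]) (use that in \<open>simp_all add: next_level_def same_outside_def\<close>)
    then show "?Q (ev next_level \<rho>)" using that by (simp add: next_level_def)
  qed (simp_all add: next_level_def)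
  have "runs (search ;; If present_exp (look_cell d) skip ;; next_level) ?\<tau>
      (search_unit * (p + 3) + ((bcost present_exp + ?c) + tm next_level)) ?Q"
  proof (rule runs_Seq[OF S _ order_refl])
    fix \<rho> assume t': "ireg \<rho> 17 = int (second.locate L z 1) \<and> same_outside ({17, 18, 19}, {}, {}, {}) ?\<tau> \<rho>"
    have q2: "query_state m L d x \<sigma> \<rho>"
      by (rule query_state_same[OF q1]) (use t' in \<open>simp add: same_outside_def\<close>)
    have s2: "Cell (ireg \<rho> 20) (ireg \<rho> 21) (ireg \<rho> 22) = z" "ireg \<rho> 28 = -1" "ireg \<rho> 23 = int l"
      using t' s1 by (simp_all add: same_outside_def)
    have r2: "ready m L \<rho>" using q2 by (simp add: query_state_def)
    obtain z1 z2 z3 where zc: "z = Cell z1 z2 z3" by (cases z)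
    have zz: "ireg \<rho> 20 = z1" "ireg \<rho> 21 = z2" "ireg \<rho> 22 = z3"
      using s2(1) zc by simp_all
    have pres: "bval present_exp \<rho> \<longleftrightarrow> present L z"
    proof -
      have len: "ireg \<rho> 3 = int (length L)" using r2 by (simp add: ready_def second.holds_envelope_def)
      have "get (iarr \<rho> 3) (int (second.locate L z 1)) = int (hit L z 1)" if "second.locate L z 1 < length L"
        using r2 that by (simp add: ready_def second.holds_envelope_def hit_def)
      then show ?thesis
        using t' len r2 zc by (auto simp: present_exp_def present_def zz second.key_def ready_def second.holds_data_def)
    qed
    have "runs (If present_exp (look_cell d) skip) \<rho> (bcost present_exp + ?c) ?R"
    proof (rule runs_If[OF _ _ order_refl])
      assume "bval present_exp \<rho>"
      then have "present L z" using pres by simp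
      from runs_look_cell[OF q2 p d z_def this _ s2] t' show "runs (look_cell d) \<rho> ?c ?R" by blast
    next
      assume "\<not> bval present_exp \<rho>"
      then have "cand L d dx dy x l = None"
        using pres by (simp add: cand_def Let_def flip: z_def)
      then show "runs skip \<rho> ?c ?R"
        using q2 s2 by (intro runs_ev) (simp_all add: answer_of_def)
    qed
    then show "runs (If present_exp (look_cell d) skip ;; next_level) \<rho> ((bcost present_exp + ?c) + tm next_level) ?Q"
      by (rule runs_Seq[OF _ nxt order_refl])
  qed
  then show ?thesis
    unfolding look_def
  proof (rule runs_Seq_ev[rotated])
    have x: "x \<le> x * (p + 3)" for x :: nat by simp
    have c: "tm (look_start d dx dy) = tm (look_start 0 0 0)" by (simp add: look_start_def)
    let ?k = "tm (look_start 0 0 0) + bcost present_exp + tm look_origin +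
      bcost (RLess (RConst 0) (RReg 17)) + tm look_sine + tm (look_test 1) + 1 + tm next_level"
    have "tm (look_start d dx dy) + (search_unit * (p + 3) + ((bcost present_exp + ?c) + tm next_level)) =
        2 * (search_unit * (p + 3)) + ?k"
      unfolding c by simp
    also have "\<dots> \<le> 2 * (search_unit * (p + 3)) + ?k * (p + 3)" by (intro add_left_mono x)
    also have "\<dots> = look_unit * (p + 3)"
      unfolding look_unit_def by (simp only: add_mult_distrib mult.assoc add.assoc)
    finally show "tm (look_start d dx dy) + (search_unit * (p + 3) + ((bcost present_exp + ?c) + tm next_level))
        \<le> look_unit * (p + 3)" .
  qed (simp add: look_start_def)
qed

lemma runs_find:
  assumes r: "ready m L \<sigma>" and p: "2 * n \<le> 2 ^ p" and d: "d < 2"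
    and x: "rreg \<sigma> 0 = fst x" "rreg \<sigma> 1 = snd x"
  shows "runs (find d dx dy) \<sigma> (find_unit * ((m + 1) * (p + 3)))
    (\<lambda>\<tau>. ready m L \<tau> \<and> same_outside find_writes \<sigma> \<tau> \<and>
       ((\<exists>a<2 * n. found L m d dx dy x a \<and> ireg \<tau> 28 = int (idx a)) \<or>
        ireg \<tau> 28 = -1 \<and> \<not> (\<exists>a. found L m d dx dy x a)))"
proof -
  have good: "second.good {..<2 * n} (-1) L" using r by (simp add: ready_def second.holds_envelope_def)
  let ?\<sigma> = "ev (find_start d) \<sigma>" and ?u = "bcost find_guard + look_unit * (p + 3)"
  let ?c = "cand L d dx dy x"
  \<comment> \<open>Either all levels below \<open>l\<close> are known to have no candidate, or the
    lowest candidate has been found and the guard fails.\<close>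
  define I where "I q \<tau> \<longleftrightarrow> (\<exists>l. query_state m L d x \<sigma> \<tau> \<and> ireg \<tau> 23 = int l \<and> l \<le> Suc m \<and>
      (ireg \<tau> 28 = -1 \<and> (\<forall>l'<l. ?c l' = None) \<or>
       (\<exists>a. found L m d dx dy x a \<and> a < 2 * n \<and> ireg \<tau> 28 = int (idx a))) \<and>
      q = ?u * (Suc m - l) + bcost find_guard)" for q \<tau>
  have start: "query_state m L d x \<sigma> ?\<sigma>" "ireg ?\<sigma> 23 = 0" "ireg ?\<sigma> 28 = -1"
  proof -
    have "same_outside find_writes \<sigma> ?\<sigma>" by (simp add: find_start_def same_outside_def)
    moreover have "rreg \<sigma> 2 = rmin" using r by (simp add: ready_def)
    ultimately show "query_state m L d x \<sigma> ?\<sigma>"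
      using ready_find[OF r] x unfolding query_state_def
      by (auto simp: find_start_def scaled_def sign_const_def qx_def qy_def sg_def)
  qed (simp_all add: find_start_def)
  have guard: "bval find_guard \<tau> \<longleftrightarrow> l \<le> m \<and> ireg \<tau> 28 < 0"
    if "query_state m L d x \<sigma> \<tau>" "ireg \<tau> 23 = int l" for \<tau> l
    using that by (auto simp: find_guard_def query_state_def ready_def)
  have "runs (While find_guard (look d dx dy)) ?\<sigma> (?u * Suc m + bcost find_guard)
      (\<lambda>\<tau>. (\<exists>q. I q \<tau>) \<and> \<not> bval find_guard \<tau>)"
  proof (rule runs_While)
    fix q \<tau> assume "I q \<tau>" and b: "bval find_guard \<tau>"
    then obtain l where I: "query_state m L d x \<sigma> \<tau>" "ireg \<tau> 23 = int l"
      "ireg \<tau> 28 = -1 \<and> (\<forall>l'<l. ?c l' = None) \<or> (\<exists>a. found L m d dx dy x a \<and> a < 2 * n \<and> ireg \<tau> 28 = int (idx a))"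
      "q = ?u * (Suc m - l) + bcost find_guard"
      unfolding I_def by blast
    have l: "l \<le> m" "ireg \<tau> 28 = -1" "\<forall>l'<l. ?c l' = None" using guard[OF I(1,2)] b I(3) by auto
    have "runs (look d dx dy) \<tau> (look_unit * (p + 3))
        (\<lambda>\<tau>'. \<exists>q'. I q' \<tau>' \<and> bcost find_guard + look_unit * (p + 3) + q' \<le> q)"
    proof (rule runs_weaken[OF runs_look[OF I(1) p d l(2) I(2), of dx dy] order_refl])
      fix \<tau>' assume t: "query_state m L d x \<sigma> \<tau>' \<and> ireg \<tau>' 23 = int (Suc l) \<and> ireg \<tau>' 28 = answer_of (?c l)"
      let ?q = "?u * (Suc m - Suc l) + bcost find_guard"
      have "ireg \<tau>' 28 = -1 \<and> (\<forall>l'<Suc l. ?c l' = None) \<or>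
          (\<exists>a. found L m d dx dy x a \<and> a < 2 * n \<and> ireg \<tau>' 28 = int (idx a))"
      proof (cases "?c l")
        case None
        then show ?thesis using t l(3) by (auto simp: answer_of_def less_Suc_eq)
      next
        case (Some a)
        then have "found L m d dx dy x a" using l(1,3) unfolding found_def by blast
        moreover have "a < 2 * n" using cand_SomeD(1)[OF good Some d] .
        ultimately show ?thesis using t Some by (auto simp: answer_of_def)
      qed
      then have "I ?q \<tau>'" unfolding I_def using t l(1) by (intro exI[of _ "Suc l"]) simp
      moreover have "bcost find_guard + look_unit * (p + 3) + ?q \<le> q"
        using l(1) unfolding I(4) by (simp only: Suc_diff_le[OF l(1)] mult_Suc_right diff_Suc_Suc)
      ultimately show "\<exists>q'. I q' \<tau>' \<and> bcost find_guard + look_unit * (p + 3) + q' \<le> q" by blast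
    qed
    then show "\<exists>T. runs (look d dx dy) \<tau> T (\<lambda>\<tau>'. \<exists>q'. I q' \<tau>' \<and> bcost find_guard + T + q' \<le> q)" by blast
  next
    fix q \<tau> assume "I q \<tau>" then show "bcost find_guard \<le> q" by (auto simp: I_def)
  next
    show "I (?u * Suc m + bcost find_guard) ?\<sigma>"
      unfolding I_def using start by (intro exI[of _ 0]) simp
  qed
  then have "runs (While find_guard (look d dx dy)) ?\<sigma> (?u * Suc m + bcost find_guard)
    (\<lambda>\<tau>. ready m L \<tau> \<and> same_outside find_writes \<sigma> \<tau> \<and>
       ((\<exists>a<2 * n. found L m d dx dy x a \<and> ireg \<tau> 28 = int (idx a)) \<or>
        ireg \<tau> 28 = -1 \<and> \<not> (\<exists>a. found L m d dx dy x a)))"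
  proof (rule runs_weaken[OF _ order_refl])
    fix \<tau> assume a: "(\<exists>q. I q \<tau>) \<and> \<not> bval find_guard \<tau>"
    then obtain l where I: "query_state m L d x \<sigma> \<tau>" "ireg \<tau> 23 = int l"
      "ireg \<tau> 28 = -1 \<and> (\<forall>l'<l. ?c l' = None) \<or> (\<exists>a. found L m d dx dy x a \<and> a < 2 * n \<and> ireg \<tau> 28 = int (idx a))"
      unfolding I_def by blast
    have g: "m < l \<or> 0 \<le> ireg \<tau> 28" using guard[OF I(1,2)] a by auto
    have "\<not> found L m d dx dy x a" if "m < l" "\<forall>l'<l. ?c l' = None" for a
      using that by (auto simp: found_def)
    then have "(\<exists>a<2 * n. found L m d dx dy x a \<and> ireg \<tau> 28 = int (idx a)) \<or>
        ireg \<tau> 28 = -1 \<and> \<not> (\<exists>a. found L m d dx dy x a)"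
      using I(3) g by auto
    then show "ready m L \<tau> \<and> same_outside find_writes \<sigma> \<tau> \<and>
       ((\<exists>a<2 * n. found L m d dx dy x a \<and> ireg \<tau> 28 = int (idx a)) \<or>
        ireg \<tau> 28 = -1 \<and> \<not> (\<exists>a. found L m d dx dy x a))"
      using I(1) by (simp add: query_state_def)
  qed
  then show ?thesis
    unfolding find_def
  proof (rule runs_Seq_ev[rotated])
    let ?X = "(m + 1) * (p + 3)"
    have x: "x \<le> x * ?X" for x :: nat by simp
    have c: "tm (find_start d) = tm (find_start 0)" by (simp add: find_start_def sign_const_def)
    have "Suc m * 1 \<le> ?X" by (intro mult_le_mono) auto
    then have "bcost find_guard * Suc m \<le> bcost find_guard * ?X" by (intro mult_le_mono2) simp
    then have "tm (find_start d) + (?u * Suc m + bcost find_guard) \<le>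
        tm (find_start 0) * ?X + (bcost find_guard * ?X + look_unit * ?X) + bcost find_guard * ?X"
      using x[of "tm (find_start 0)"] x[of "bcost find_guard"] unfolding c
      by (simp add: add_mult_distrib algebra_simps)
    also have "\<dots> = find_unit * ?X"
      unfolding find_unit_def by (simp only: add_mult_distrib mult_2)
    finally show "tm (find_start d) + (?u * Suc m + bcost find_guard) \<le> find_unit * ?X" .
  qed (simp add: find_start_def)
qed

end


section \<open>Queries on the linked store\<close>

text \<open>\<open>runs\<close> together with the peak of memory. The program of the given oracle
  may allocate, and its bounds \<open>S\<close> and \<open>Q\<close> are reals.\<close>

definition runs_in :: "com \<Rightarrow> store \<Rightarrow> real \<Rightarrow> real \<Rightarrow> (store \<Rightarrow> bool) \<Rightarrow> bool" where
  "runs_in c \<sigma> T M Q \<longleftrightarrow> (\<exists>t m \<tau>. exec c \<sigma> t m \<tau> \<and> real t \<le> T \<and> real m \<le> M \<and> Q \<tau>)"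

lemma runs_in_Seq:
  assumes "runs_in c \<sigma> T M R" "\<And>\<tau>. R \<tau> \<Longrightarrow> runs_in d \<tau> T' M Q"
  shows "runs_in (c ;; d) \<sigma> (T + T') M Q"
proof -
  obtain t m \<sigma>' where 1: "exec c \<sigma> t m \<sigma>'" "real t \<le> T" "real m \<le> M" "R \<sigma>'"
    using assms(1) by (auto simp: runs_in_def)
  obtain t' m' \<tau> where 2: "exec d \<sigma>' t' m' \<tau>" "real t' \<le> T'" "real m' \<le> M" "Q \<tau>"
    using assms(2)[OF 1(4)] by (auto simp: runs_in_def)
  have "real (t + t') \<le> T + T'" "real (max m m') \<le> M" using 1 2 by auto
  with exec_Seq[OF 1(1) 2(1)] 2(4) show ?thesis unfolding runs_in_def by blast
qed

lemma runs_in_weaken: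
  "runs_in c \<sigma> T M Q \<Longrightarrow> T \<le> T' \<Longrightarrow> (\<And>\<tau>. Q \<tau> \<Longrightarrow> Q' \<tau>) \<Longrightarrow> runs_in c \<sigma> T' M Q'"
  unfolding runs_in_def by (meson order_trans)

lemma runs_in_If:
  assumes "bval b \<sigma> \<Longrightarrow> runs_in c \<sigma> T M Q" "\<not> bval b \<sigma> \<Longrightarrow> runs_in d \<sigma> T M Q"
  shows "runs_in (If b c d) \<sigma> (real (bcost b) + T) M Q"
proof (cases "bval b \<sigma>")
  case True
  then obtain t m \<tau> where "exec c \<sigma> t m \<tau>" "real t \<le> T" "real m \<le> M" "Q \<tau>"
    using assms(1) by (auto simp: runs_in_def)
  moreover from this have "real (bcost b + t) \<le> real (bcost b) + T" by simp
  ultimately show ?thesis unfolding runs_in_def using exec_IfT[OF True] by blast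
next
  case False
  then obtain t m \<tau> where "exec d \<sigma> t m \<tau>" "real t \<le> T" "real m \<le> M" "Q \<tau>"
    using assms(2) by (auto simp: runs_in_def)
  moreover from this have "real (bcost b + t) \<le> real (bcost b) + T" by simp
  ultimately show ?thesis unfolding runs_in_def using exec_IfF[OF False] by blast
qed

lemma runs_in_even:
  assumes "runs c \<sigma> T Q" "in_place c" "finite_store \<sigma>" "finite_store \<rho>" "real (cells \<sigma> + cells \<rho>) \<le> M"
    "\<And>\<tau>. Q \<tau> \<Longrightarrow> R (link \<tau> \<rho>)"
  shows "runs_in (ren even_name c) (link \<sigma> \<rho>) (real T) M R"
proof -
  obtain t m \<tau> where e: "exec c \<sigma> t m \<tau>" "t \<le> T" "Q \<tau>" using assms(1) by (auto simp: runs_def)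
  have "m = cells \<sigma>" using exec_in_place[OF e(1) assms(2)] by simp
  then show ?thesis
    unfolding runs_in_def using exec_even[OF e(1) assms(3,4)] e(2,3) assms(5,6) by fastforce
qed

text \<open>After linking, 60, 56 and 58 are the registers 30, 28 and 29 of the program \<open>find\<close>, and 1 and 3 are the
  registers 0 and 1 of the reachability queries.\<close>

definition call_with :: com where
  "call_with = iset 1 (IReg 60) ;; iset 3 (IReg 56)"

definition raise_flag :: com where
  "raise_flag = If (ILess (IConst 0) (IReg 1)) (ren even_name (iset 29 (IConst 1))) skip"

definition try_offset :: "com \<Rightarrow> nat \<times> int \<times> int \<Rightarrow> com" where
  "try_offset reach = (\<lambda>(d, dx, dy). ren even_name (find d dx dy) ;;
     If (ILess (IReg 56) (IConst 0)) skip (call_with ;; ren odd_name reach ;; raise_flag))"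

text \<open>The loop over the offsets is unrolled: they are constants in the program text, whose
  length does not depend on the input.\<close>

definition try_offsets :: "com \<Rightarrow> (nat \<times> int \<times> int) list \<Rightarrow> com" where
  "try_offsets reach os = foldr (\<lambda>off c. try_offset reach off ;; c) os skip"

definition geo_query :: "com \<Rightarrow> com" where
  "geo_query reach = ren even_name (iset 30 (IReg 0) ;; iset 29 (IConst 0)) ;;
     try_offsets reach offsets ;; ren even_name (iset 0 (IReg 29))"

text \<open>The even registers 0 and 2 of the linked store are the registers 0 and 1 of its first
  half, so loading a query leaves the data of the oracle alone.\<close>

lemma load_site_point_link:
  "load_site_point (i, x) (link \<sigma> \<rho>) =
     link (\<sigma>\<lparr>ireg := (ireg \<sigma>)(0 := int i), rreg := (rreg \<sigma>)(0 := fst x, 1 := snd x)\<rparr>) \<rho>"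
  by (simp add: load_site_point_def link_def interleave_upd_even)

lemma runs_in_call:
  assumes "ireg \<sigma> 30 = int i" "ireg \<sigma> 28 = int j" "finite_store \<sigma>" "finite_store \<rho>"
    "real (cells \<sigma> + cells \<rho>) \<le> M" "R (link \<sigma> (load_pair (i, j) \<rho>))"
  shows "runs_in call_with (link \<sigma> \<rho>) 4 M R"
proof -
  have l: "ireg (link \<sigma> \<rho>) 60 = int i" "ireg (link \<sigma> \<rho>) 56 = int j"
    using assms(1,2) interleave_even[of "ireg \<sigma>" "ireg \<rho>" 30] interleave_even[of "ireg \<sigma>" "ireg \<rho>" 28]
    by (simp_all add: link_def)
  have u: "interleave f (g(0 := y, Suc 0 := y')) = (interleave f g)(Suc 0 := y, 3 := y')"
    for f g :: "nat \<Rightarrow> int" and y y'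
    using interleave_upd_odd[of f g 0 y] interleave_upd_odd[of f "g(0 := y)" 1 y'] by (simp add: numeral_3_eq_3)
  have e: "ev call_with (link \<sigma> \<rho>) = link \<sigma> (load_pair (i, j) \<rho>)"
    using l by (simp add: call_with_def load_pair_def) (simp add: link_def u)
  obtain t m where x: "exec call_with (link \<sigma> \<rho>) t m (ev call_with (link \<sigma> \<rho>))" "t \<le> tm call_with"
    using exec_ev[of call_with "link \<sigma> \<rho>"] by (auto simp: call_with_def)
  moreover have "m = cells (link \<sigma> \<rho>)"
    using exec_in_place[OF x(1)] by (simp add: call_with_def)

  then have "real m \<le> M" using assms(3-5) by (simp add: cells_link)
  moreover have "real t \<le> 4" using x(2) by (simp add: call_with_def)
  ultimately show ?thesis
    unfolding runs_in_def using x(1) assms(6) unfolding e by blast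
qed

context grouped
begin

text \<open>The 31 is \<open>3 + 7 * 2 + 3 * 2 + 2 * 4\<close>: the input arrays of length
  \<open>n\<close>, seven real and three integer arrays of length \<open>2 * n\<close>, and the ends
  and curves of at most \<open>4 * n\<close> pieces.\<close>

lemma ready_finite:
  assumes "ready m L \<sigma>"
  shows "finite_store \<sigma>" "cells \<sigma> \<le> 31 * n"
proof -
  have i: "iarr \<sigma> a = []" if "a > 3" for a using assms that by (simp add: ready_def)
  have r: "rarr \<sigma> a = []" if "a > 10" for a using assms that by (simp add: ready_def)
  have si: "{a. iarr \<sigma> a \<noteq> []} \<subseteq> {..3}" using i by (auto simp: not_less[symmetric])
  have sr: "{a. rarr \<sigma> a \<noteq> []} \<subseteq> {..10}" using r by (auto simp: not_less[symmetric])
  show "finite_store \<sigma>"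
    unfolding finite_store_def using si sr finite_subset by blast
  have env: "length L \<le> 2 * (2 * n)" "length (rarr \<sigma> 10) = length L" "length (iarr \<sigma> 3) = length L"
    using assms by (simp_all add: ready_def second.holds_envelope_def)
  have I: "(\<Sum>a | iarr \<sigma> a \<noteq> []. length (iarr \<sigma> a)) = (\<Sum>a\<le>3. length (iarr \<sigma> a))"
    by (rule sum.mono_neutral_left) (use si in auto)
  have R: "(\<Sum>a | rarr \<sigma> a \<noteq> []. length (rarr \<sigma> a)) = (\<Sum>a\<le>10. length (rarr \<sigma> a))"
    by (rule sum.mono_neutral_left) (use sr in auto)
  have li: "length (iarr \<sigma> 0) = 2 * n" "length (iarr \<sigma> 1) = 2 * n" "length (iarr \<sigma> 2) = 2 * n"
    using assms unfolding ready_def second.holds_data_def by (simp_all add: K1_def K2_def K3_def)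
  have lr: "length (rarr \<sigma> 0) = n" "length (rarr \<sigma> 1) = n" "length (rarr \<sigma> 2) = n"
    "length (rarr \<sigma> 3) = 2 * n" "length (rarr \<sigma> 4) = 2 * n" "length (rarr \<sigma> 5) = 2 * n" "length (rarr \<sigma> 6) = 2 * n"
    "length (rarr \<sigma> 7) = 2 * n" "length (rarr \<sigma> 8) = 2 * n" "length (rarr \<sigma> 9) = 2 * n"
    using assms unfolding ready_def second.holds_data_def by (simp_all add: PX_def PY_def W_def n_def)
  have "(\<Sum>a\<le>3. length (iarr \<sigma> a)) =
      length (iarr \<sigma> 0) + length (iarr \<sigma> 1) + length (iarr \<sigma> 2) + length (iarr \<sigma> 3)"
    by (simp add: eval_nat_numeral)
  moreover have "(\<Sum>a\<le>10. length (rarr \<sigma> a)) =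
      length (rarr \<sigma> 0) + length (rarr \<sigma> 1) + length (rarr \<sigma> 2) + length (rarr \<sigma> 3) + length (rarr \<sigma> 4) +
      length (rarr \<sigma> 5) + length (rarr \<sigma> 6) + length (rarr \<sigma> 7) + length (rarr \<sigma> 8) + length (rarr \<sigma> 9) +
      length (rarr \<sigma> 10)"
    by (simp add: eval_nat_numeral)
  ultimately show "cells \<sigma> \<le> 31 * n"
    unfolding cells_def I R using li lr env by linarith
qed

end

text \<open>\<open>I\<close> is the set of stores, closed under queries, that witnesses the
  correctness of the given oracle; \<open>p\<close> bounds the logarithm of the number of
  curves.\<close>

locale reach_oracle = grouped +
  fixes reach :: com and I :: "store set" and S Q :: real and m :: nat and L :: "(real \<times> nat) list" and p :: nat
  assumes finite_I: "\<rho> \<in> I \<Longrightarrow> finite_store \<rho>"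
    and cells_I: "\<rho> \<in> I \<Longrightarrow> real (cells \<rho>) \<le> S"
    and query_I: "\<rho> \<in> I \<Longrightarrow> i < n \<Longrightarrow> j < n \<Longrightarrow> \<exists>t k \<rho>'. exec reach (load_pair (i, j) \<rho>) t k \<rho>' \<and>
      real t \<le> Q \<and> real k \<le> S \<and>
      ireg \<rho>' 0 = (if ps ! i \<rightarrow>\<^sup>*\<^bsub>transmission_graph (set ps) r\<^esub> ps ! j then 1 else 0) \<and> \<rho>' \<in> I"
    and size: "2 * n \<le> 2 ^ p"
begin

abbreviation space :: real where "space \<equiv> 31 * real n + S"

definition reach_state :: "nat \<Rightarrow> point \<Rightarrow> bool \<Rightarrow> store \<Rightarrow> bool" where
  "reach_state i x b \<tau> \<longleftrightarrow> (\<exists>\<sigma> \<rho>. \<tau> = link \<sigma> \<rho> \<and> ready m L \<sigma> \<and> \<rho> \<in> I \<and> ireg \<sigma> 30 = int i \<and>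
     rreg \<sigma> 0 = fst x \<and> rreg \<sigma> 1 = snd x \<and> ireg \<sigma> 29 = (if b then 1 else 0))"

definition success :: "nat \<Rightarrow> point \<Rightarrow> nat \<times> int \<times> int \<Rightarrow> bool" where
  "success i x = (\<lambda>(d, dx, dy). \<exists>a. found L m d dx dy x a \<and>
     ps ! i \<rightarrow>\<^sup>*\<^bsub>transmission_graph (set ps) r\<^esub> ps ! idx a)"

lemma space_bound: "ready m L \<sigma> \<Longrightarrow> \<rho> \<in> I \<Longrightarrow> real (cells \<sigma> + cells \<rho>) \<le> space"
  using ready_finite(2)[of m L \<sigma>] cells_I[of \<rho>] by simp

lemma found_unique: "found L m d dx dy x a \<Longrightarrow> found L m d dx dy x a' \<Longrightarrow> a = a'"
  unfolding found_def by (metis linorder_neqE_nat option.distinct(1) option.inject)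

text \<open>One walk through the levels and one reachability query. The 20 generously covers passing
  the arguments, evaluating the answer and testing for a candidate.\<close>

definition try_time :: real where
  "try_time = real (find_unit * ((m + 1) * (p + 3))) + (Q + 20)"

lemma runs_in_try_offset:
  assumes s: "reach_state i x b \<tau>" and i: "i < n" and d: "d < 2"
  shows "runs_in (try_offset reach (d, dx, dy)) \<tau> try_time space (reach_state i x (b \<or> success i x (d, dx, dy)))"
proof -
  obtain \<sigma> \<rho> where t: "\<tau> = link \<sigma> \<rho>" and r: "ready m L \<sigma>" and rho: "\<rho> \<in> I" and reg: "ireg \<sigma> 30 = int i"
    "rreg \<sigma> 0 = fst x" "rreg \<sigma> 1 = snd x" "ireg \<sigma> 29 = (if b then 1 else 0)"
    using s unfolding reach_state_def by blast
  let ?f = "ILess (IReg 56) (IConst 0)" and ?b = "b \<or> success i x (d, dx, dy)"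
  define F where "F \<upsilon> \<longleftrightarrow> (\<exists>\<sigma>'. \<upsilon> = link \<sigma>' \<rho> \<and> ready m L \<sigma>' \<and> same_outside find_writes \<sigma> \<sigma>' \<and>
      ((\<exists>a<2 * n. found L m d dx dy x a \<and> ireg \<sigma>' 28 = int (idx a)) \<or>
       ireg \<sigma>' 28 = -1 \<and> \<not> (\<exists>a. found L m d dx dy x a)))" for \<upsilon>
  have find: "runs_in (ren even_name (find d dx dy)) \<tau> (real (find_unit * ((m + 1) * (p + 3)))) space F"
    unfolding t
    by (rule runs_in_even[OF runs_find[OF r size d reg(2,3)] in_place_find ready_finite(1)[OF r] finite_I[OF rho]
          space_bound[OF r rho]]) (auto simp: F_def)
  have "runs_in (If ?f skip (call_with ;; ren odd_name reach ;; raise_flag)) \<upsilon> (real (bcost ?f) + (Q + 16)) space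
      (reach_state i x ?b)" if "F \<upsilon>" for \<upsilon>
  proof (rule runs_in_If)
    obtain \<sigma>' where u: "\<upsilon> = link \<sigma>' \<rho>" "ready m L \<sigma>'" "same_outside find_writes \<sigma> \<sigma>'"
      and c: "(\<exists>a<2 * n. found L m d dx dy x a \<and> ireg \<sigma>' 28 = int (idx a)) \<or>
       ireg \<sigma>' 28 = -1 \<and> \<not> (\<exists>a. found L m d dx dy x a)"
      using \<open>F \<upsilon>\<close> unfolding F_def by blast
    have reg': "ireg \<sigma>' 30 = int i" "rreg \<sigma>' 0 = fst x" "rreg \<sigma>' 1 = snd x" "ireg \<sigma>' 29 = (if b then 1 else 0)"
      using reg u(3) by (simp_all add: same_outside_def)
    have r56: "ireg \<upsilon> 56 = ireg \<sigma>' 28"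
      using interleave_even[of "ireg \<sigma>'" "ireg \<rho>" 28] by (simp add: u(1) link_def)
    note fin = ready_finite(1)[OF u(2)] finite_I[OF rho]
    note sp = space_bound[OF u(2) rho]
    {
      assume "bval ?f \<upsilon>"
      then have "\<not> (\<exists>a. found L m d dx dy x a)" using c r56 by auto
      then have "reach_state i x ?b \<upsilon>"
        unfolding reach_state_def using u rho reg' by (intro exI[of _ \<sigma>'] exI[of _ \<rho>]) (auto simp: success_def)
      \<comment> \<open>Without a candidate no reachability query is made, but the time bound still
        contains \<open>Q\<close>. It is nonnegative because it bounds the time of a query that
        exists.\<close>
      moreover have "0 \<le> Q"
        using query_I[OF rho i i] by (metis of_nat_0_le_iff order_trans)
      ultimately show "runs_in skip \<upsilon> (Q + 16) space (reach_state i x ?b)"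
        unfolding runs_in_def using exec_Do[of Skip \<upsilon>] sp u(1) fin by (auto simp: cells_link intro!: exI)
    }
    assume "\<not> bval ?f \<upsilon>"
    then obtain a where a: "a < 2 * n" "found L m d dx dy x a" "ireg \<sigma>' 28 = int (idx a)"
      using c r56 by auto
    let ?\<rho> = "load_pair (i, idx a) \<rho>"
    have fr: "finite_store ?\<rho>" "cells ?\<rho> = cells \<rho>"
      using fin(2) by (simp_all add: load_pair_def finite_store_def cells_def)
    obtain t k \<rho>' where q: "exec reach ?\<rho> t k \<rho>'" "real t \<le> Q" "real k \<le> S"
      "ireg \<rho>' 0 = (if ps ! i \<rightarrow>\<^sup>*\<^bsub>transmission_graph (set ps) r\<^esub> ps ! idx a then 1 else 0)" "\<rho>' \<in> I"
      using query_I[OF rho i idx_less[OF a(1)]] by blast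
    have suc: "success i x (d, dx, dy) \<longleftrightarrow> ps ! i \<rightarrow>\<^sup>*\<^bsub>transmission_graph (set ps) r\<^esub> ps ! idx a"
      using a(2) found_unique[OF _ a(2)] unfolding success_def prod.case by blast
    have call: "runs_in call_with \<upsilon> 4 space (\<lambda>\<upsilon>. \<upsilon> = link \<sigma>' ?\<rho>)"
      unfolding u(1) by (rule runs_in_call[OF reg'(1) a(3) fin sp]) simp
    have run: "runs_in (ren odd_name reach) (link \<sigma>' ?\<rho>) Q space (\<lambda>\<upsilon>. \<upsilon> = link \<sigma>' \<rho>')"
      unfolding runs_in_def
      using exec_odd[OF q(1) fin(1) fr(1)] q(2,3) ready_finite(2)[OF u(2)] by (fastforce simp: of_nat_add)
    have r1: "ireg (link \<sigma>' \<rho>') 1 = ireg \<rho>' 0"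
      using interleave_odd[of "ireg \<sigma>'" "ireg \<rho>'" 0] by (simp add: link_def)
    have flag: "runs_in raise_flag (link \<sigma>' \<rho>') 12 space (reach_state i x ?b)"
    proof -
      have "runs_in raise_flag (link \<sigma>' \<rho>') (real (bcost (ILess (IConst 0) (IReg 1))) + 5) space (reach_state i x ?b)"
        unfolding raise_flag_def
      proof (rule runs_in_If)
        assume "bval (ILess (IConst 0) (IReg 1)) (link \<sigma>' \<rho>')"
        then have "success i x (d, dx, dy)" using q(4) r1 suc by (auto split: if_splits)
        let ?\<sigma> = "\<sigma>'\<lparr>ireg := (ireg \<sigma>')(29 := 1)\<rparr>"
        have r2: "ready m L ?\<sigma>" by (rule ready_same[OF u(2)]) simp_all
        have "reach_state i x ?b (link ?\<sigma> \<rho>')"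
          unfolding reach_state_def using r2 q(5) reg' \<open>success i x (d, dx, dy)\<close>
          by (intro exI[of _ ?\<sigma>] exI[of _ \<rho>']) auto
        then have "runs_in (ren even_name (iset 29 (IConst 1))) (link \<sigma>' \<rho>') (real 2) space (reach_state i x ?b)"
          by (intro runs_in_even[OF runs_ev[where Q = "\<lambda>\<tau>. \<tau> = ?\<sigma>"] _ fin(1) finite_I[OF q(5)]
                space_bound[OF u(2) q(5)]]) auto
        then show "runs_in (ren even_name (iset 29 (IConst 1))) (link \<sigma>' \<rho>') 5 space (reach_state i x ?b)"
          by (rule runs_in_weaken) auto
      next
        assume "\<not> bval (ILess (IConst 0) (IReg 1)) (link \<sigma>' \<rho>')"
        then have "\<not> success i x (d, dx, dy)" using q(4) r1 suc by (auto split: if_splits)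
        then have "reach_state i x ?b (link \<sigma>' \<rho>')"
          unfolding reach_state_def using u(2) q(5) reg' by (intro exI[of _ \<sigma>'] exI[of _ \<rho>']) auto
        then show "runs_in skip (link \<sigma>' \<rho>') 5 space (reach_state i x ?b)"
          unfolding runs_in_def using exec_Do[of Skip "link \<sigma>' \<rho>'"] space_bound[OF u(2) q(5)] fin(1) finite_I[OF q(5)]
          by (intro exI[of _ 1] exI[of _ "cells (link \<sigma>' \<rho>')"] exI[of _ "link \<sigma>' \<rho>'"]) (auto simp: cells_link)
      qed
      then show ?thesis by (rule runs_in_weaken) auto
    qed
    have "runs_in (call_with ;; ren odd_name reach ;; raise_flag) \<upsilon> (4 + (Q + 12)) space (reach_state i x ?b)"
      by (rule runs_in_Seq[OF call], simp, rule runs_in_Seq[OF run], simp add: flag)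
    then show "runs_in (call_with ;; ren odd_name reach ;; raise_flag) \<upsilon> (Q + 16) space (reach_state i x ?b)"
      by (rule runs_in_weaken) auto
  qed
  from runs_in_Seq[OF find this] show ?thesis
    unfolding try_offset_def prod.case by (rule runs_in_weaken) (simp_all add: try_time_def)
qed

lemma reach_state_cells:
  assumes "reach_state i x b \<tau>"
  shows "real (cells \<tau>) \<le> space"
proof -
  obtain \<sigma> \<rho> where "\<tau> = link \<sigma> \<rho>" "ready m L \<sigma>" "\<rho> \<in> I" using assms by (auto simp: reach_state_def)
  then show ?thesis using space_bound[of \<sigma> \<rho>] ready_finite(1)[of m L \<sigma>] finite_I[of \<rho>] by (simp add: cells_link)
qed

lemma runs_in_try_offsets:
  assumes "reach_state i x b \<tau>" "i < n" "\<forall>off\<in>set os. fst off < 2"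
  shows "runs_in (try_offsets reach os) \<tau> (real (length os) * try_time + 1) space
    (reach_state i x (b \<or> (\<exists>off\<in>set os. success i x off)))"
  using assms
proof (induction os arbitrary: b \<tau>)
  case Nil
  then show ?case
    using exec_Do[of Skip \<tau>] reach_state_cells[OF Nil(1)] unfolding runs_in_def try_offsets_def
    by (intro exI[of _ 1] exI[of _ "cells \<tau>"] exI[of _ \<tau>]) auto
next
  case (Cons off os)
  obtain d dx dy where off: "off = (d, dx, dy)" by (cases off)
  have "runs_in (try_offset reach off) \<tau> try_time space (reach_state i x (b \<or> success i x off))"
    unfolding off by (rule runs_in_try_offset) (use Cons.prems off in auto)
  moreover have "runs_in (try_offsets reach os) \<tau>' (real (length os) * try_time + 1) space
      (reach_state i x ((b \<or> success i x off) \<or> (\<exists>off\<in>set os. success i x off)))"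
    if "reach_state i x (b \<or> success i x off) \<tau>'" for \<tau>'
    using Cons.IH[OF that Cons.prems(2)] Cons.prems(3) by simp
  ultimately have "runs_in (try_offset reach off ;; try_offsets reach os) \<tau>
      (try_time + (real (length os) * try_time + 1)) space
      (reach_state i x ((b \<or> success i x off) \<or> (\<exists>off\<in>set os. success i x off)))"
    by (rule runs_in_Seq)
  then show ?case
    by (simp add: try_offsets_def algebra_simps disj_assoc)
qed

lemma runs_in_geo_query:
  assumes r: "ready m L \<sigma>" and rho: "\<rho> \<in> I" and i: "i < n"
  shows "runs_in (geo_query reach) (load_site_point (i, x) (link \<sigma> \<rho>)) (338 * try_time + 10) space
    (\<lambda>\<tau>. ireg \<tau> 0 = (if reaches_point (set ps) r (ps ! i) x then 1 else 0) \<and>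
       (\<exists>\<sigma> \<rho>. \<tau> = link \<sigma> \<rho> \<and> ready m L \<sigma> \<and> \<rho> \<in> I))"
proof -
  let ?\<sigma> = "\<sigma>\<lparr>ireg := (ireg \<sigma>)(0 := int i), rreg := (rreg \<sigma>)(0 := fst x, 1 := snd x)\<rparr>"
  let ?c = "iset 30 (IReg 0) ;; iset 29 (IConst 0)"
  have r1: "ready m L ?\<sigma>" by (rule ready_same[OF r]) simp_all
  have r2: "ready m L (ev ?c ?\<sigma>)" by (rule ready_same[OF r]) simp_all
  have init: "runs_in (ren even_name ?c) (link ?\<sigma> \<rho>) (real (tm ?c)) space (reach_state i x False)"
  proof (rule runs_in_even[OF runs_ev[where Q = "\<lambda>\<tau>. \<tau> = ev ?c ?\<sigma>"] _ ready_finite(1)[OF r1] finite_I[OF rho]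
        space_bound[OF r1 rho]])
    fix \<tau> assume "\<tau> = ev ?c ?\<sigma>"
    then show "reach_state i x False (link \<tau> \<rho>)"
      unfolding reach_state_def using r2 rho by (intro exI[of _ \<tau>] exI[of _ \<rho>]) auto
  qed auto
  have good: "second.good {..<2 * n} (-1) L" using r by (simp add: ready_def second.holds_envelope_def)
  have lev: "lev v \<le> m" if "v < 2 * n" for v using r that by (simp add: ready_def)
  let ?ans = "reaches_point (set ps) r (ps ! i) x"
  have "?ans \<longleftrightarrow> (\<exists>(d, dx, dy)\<in>set offsets. \<exists>a. found L m d dx dy x a \<and>
      ps ! i \<rightarrow>\<^sup>*\<^bsub>transmission_graph (set ps) r\<^esub> ps ! idx a)"
    by (rule reaches_point_iff[OF good]) (rule lev)
  then have "(\<exists>off\<in>set offsets. success i x off) \<longleftrightarrow> ?ans"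
    unfolding success_def by (simp only:)
  moreover have "length offsets = 338" by (simp add: offsets_def)
  moreover have "\<forall>off\<in>set offsets. fst off < 2" using set_offsets by auto
  ultimately have tries: "runs_in (try_offsets reach offsets) \<tau> (338 * try_time + 1) space (reach_state i x ?ans)"
    if "reach_state i x False \<tau>" for \<tau>
    using runs_in_try_offsets[OF that i, of offsets] by simp
  let ?Q = "\<lambda>\<tau>. ireg \<tau> 0 = (if ?ans then 1 else 0) \<and> (\<exists>\<sigma> \<rho>. \<tau> = link \<sigma> \<rho> \<and> ready m L \<sigma> \<and> \<rho> \<in> I)"
  have final: "runs_in (ren even_name (iset 0 (IReg 29))) \<tau> (real 2) space ?Q" if st: "reach_state i x ?ans \<tau>" for \<tau>
  proof -
    obtain \<sigma>' \<rho>' where s: "\<tau> = link \<sigma>' \<rho>'" "ready m L \<sigma>'" "\<rho>' \<in> I" "ireg \<sigma>' 29 = (if ?ans then 1 else 0)"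
      using st unfolding reach_state_def by blast
    let ?\<tau> = "ev (iset 0 (IReg 29)) \<sigma>'"
    have r3: "ready m L ?\<tau>" by (rule ready_same[OF s(2)]) simp_all
    have "ireg (link ?\<tau> \<rho>') 0 = ireg ?\<tau> 0"
      using interleave_even[of "ireg ?\<tau>" "ireg \<rho>'" 0] by (simp add: link_def)
    then have "ireg (link ?\<tau> \<rho>') 0 = (if ?ans then 1 else 0)" using s(4) by simp
    moreover have "\<exists>\<sigma> \<rho>. link ?\<tau> \<rho>' = link \<sigma> \<rho> \<and> ready m L \<sigma> \<and> \<rho> \<in> I" using r3 s(3) by blast
    ultimately have "?Q (link ?\<tau> \<rho>')" by blast
    then show ?thesis
      unfolding s(1)
      by (intro runs_in_even[OF runs_ev[where Q = "\<lambda>\<tau>. \<tau> = ?\<tau>"] _ ready_finite(1)[OF s(2)] finite_I[OF s(3)]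
            space_bound[OF s(2,3)]]) auto
  qed
  have "runs_in (geo_query reach) (link ?\<sigma> \<rho>) (real (tm ?c) + ((338 * try_time + 1) + real 2)) space ?Q"
    unfolding geo_query_def by (rule runs_in_Seq[OF init runs_in_Seq[OF tries final]])
  then show ?thesis
    unfolding load_site_point_link by (rule runs_in_weaken) simp_all
qed

text \<open>The invariant required of a data structure consists of all links of a ready store with a
  store from \<open>I\<close>: the search leaves the first half ready, and the given oracle keeps
  the second half in \<open>I\<close>.\<close>

lemma geometric_oracle:
  assumes "ready m L \<sigma>" "\<rho> \<in> I" "space \<le> S'" "338 * try_time + 10 \<le> Q'"
  shows "geometric_reachability_oracle ps r (geo_query reach) S' Q' (link \<sigma> \<rho>)"
  unfolding geometric_reachability_oracle_def data_structure_def
proof (intro exI[of _ "{link \<sigma> \<rho> |\<sigma> \<rho>. ready m L \<sigma> \<and> \<rho> \<in> I}"] conjI ballI)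
  show "link \<sigma> \<rho> \<in> {link \<sigma> \<rho> |\<sigma> \<rho>. ready m L \<sigma> \<and> \<rho> \<in> I}" using assms(1,2) by blast
next
  fix \<tau> assume "\<tau> \<in> {link \<sigma> \<rho> |\<sigma> \<rho>. ready m L \<sigma> \<and> \<rho> \<in> I}"
  then obtain \<sigma>' \<rho>' where t: "\<tau> = link \<sigma>' \<rho>'" "ready m L \<sigma>'" "\<rho>' \<in> I" by blast
  note fin = ready_finite(1)[OF t(2)] finite_I[OF t(3)]
  show "finite_store \<tau>" unfolding t(1) by (rule finite_store_link[OF fin])
  show "real (cells \<tau>) \<le> S'"
    using space_bound[OF t(2,3)] assms(3) unfolding t(1) cells_link[OF fin] by linarith
  fix q assume "q \<in> {..<length ps} \<times> (UNIV :: point set)"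
  then obtain i x where q: "q = (i, x)" "i < n" by (auto simp: n_def)
  obtain t' k \<tau>' where e: "exec (geo_query reach) (load_site_point (i, x) \<tau>) t' k \<tau>'" "real t' \<le> 338 * try_time + 10"
    "real k \<le> space" "ireg \<tau>' 0 = (if reaches_point (set ps) r (ps ! i) x then 1 else 0)"
    "\<exists>\<sigma> \<rho>. \<tau>' = link \<sigma> \<rho> \<and> ready m L \<sigma> \<and> \<rho> \<in> I"
    using runs_in_geo_query[OF t(2,3) q(2), of x] unfolding runs_in_def t(1) by blast
  show "\<exists>t k \<tau>'. exec (geo_query reach) (load_site_point q \<tau>) t k \<tau>' \<and> real t \<le> Q' \<and> real k \<le> S' \<and>
      ireg \<tau>' 0 = (if (case q of (i, x) \<Rightarrow> reaches_point (set ps) r (ps ! i) x) then 1 else 0) \<and>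
      \<tau>' \<in> {link \<sigma> \<rho> |\<sigma> \<rho>. ready m L \<sigma> \<and> \<rho> \<in> I}"
    unfolding q(1) prod.case using e assms(3,4) by (intro exI[of _ t'] exI[of _ k] exI[of _ \<tau>']) auto
qed

end

section \<open>Levels and search depth in terms of \<open>lg\<close>\<close>

context sites
begin

text \<open>A site of level \<open>l\<close> has scaled radius at least \<open>2 * 2 ^ l\<close>,
  the smallest scaled radius is 2, and the quotient of two radii is at most the radius
  ratio.\<close>

lemma lev_le_radius_ratio:
  assumes "v < 2 * n"
  shows "2 ^ lev v \<le> radius_ratio (set ps) r"
proof -
  have fin: "finite {r p / r q |p q. p \<in> set ps \<and> q \<in> set ps}"
  proof -
    have "{r p / r q |p q. p \<in> set ps \<and> q \<in> set ps} = (\<lambda>(p, q). r p / r q) ` (set ps \<times> set ps)" by auto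
    then show ?thesis by simp
  qed
  have "rmin \<in> r ` set ps" unfolding rmin_def using nonempty by (intro Min_in) auto
  then obtain q where "q \<in> set ps" "rmin = r q" by auto
  then have "r (ps ! idx v) / rmin \<in> {r p / r q |p q. p \<in> set ps \<and> q \<in> set ps}"
    using idx_in[OF assms] by (intro CollectI exI[of _ "ps ! idx v"] exI[of _ q]) simp
  then have "r (ps ! idx v) / rmin \<le> radius_ratio (set ps) r"
    unfolding radius_ratio_def by (rule Max_ge[OF fin])
  moreover have "2 ^ lev v \<le> r (ps ! idx v) / rmin"
    using lev_bounds(1)[OF assms] by (simp add: sr_def)
  ultimately show ?thesis by linarith
qed

lemma lev_le_lg:
  assumes "v < 2 * n"
  shows "real (lev v) \<le> lg (radius_ratio (set ps) r)"
proof -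
  have "real (lev v) = log 2 (2 ^ lev v)" by simp
  also have "\<dots> \<le> log 2 (radius_ratio (set ps) r)"
  proof (subst log_le_cancel_iff)
    have "(0::real) < 2 ^ lev v" by simp
    then show "0 < radius_ratio (set ps) r" using lev_le_radius_ratio[OF assms] by linarith
  qed (use lev_le_radius_ratio[OF assms] in auto)
  finally show ?thesis by (simp add: lg_def)
qed

end

lemma power_bound_lg:
  assumes "0 < n"
  shows "\<exists>p. 2 * n \<le> 2 ^ p \<and> real p + 3 \<le> 6 * lg (real n)"
proof -
  define k where "k = nat \<lceil>log 2 (real n)\<rceil>"
  have l: "0 \<le> log 2 (real n)" using assms by simp
  have k: "log 2 (real n) \<le> real k" "real k \<le> log 2 (real n) + 1"
    using l by (simp_all add: k_def)
  have "real n = 2 powr log 2 (real n)" using assms by simp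
  also have "\<dots> \<le> 2 powr real k" using k(1) by (intro powr_mono) auto
  also have "\<dots> = 2 ^ k" by (simp add: powr_realpow)
  finally have "n \<le> 2 ^ k" by (metis of_nat_le_iff of_nat_numeral of_nat_power)
  moreover have "log 2 (real n) \<le> lg (real n)" "1 \<le> lg (real n)" by (simp_all add: lg_def)
  \<comment> \<open>\<open>k\<close> exceeds the logarithm by at most 1, so the left side is at most
    the logarithm plus 5, and each of these units is at most \<open>lg (real n)\<close>.\<close>
  then have "real (Suc k) + 3 \<le> 6 * lg (real n)" using k(2) by simp
  ultimately show ?thesis by (intro exI[of _ "Suc k"]) simp
qed

text \<open>Dominates the constants of all bounds at once. The 12 is 6 for the search depth times 2
  for the number of levels, see \<open>power_bound_lg\<close> and \<open>lev_le_lg\<close>; there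
  are 338 offsets, each with overhead 20 and one query of time \<open>Q\<close>; 10 is the frame of
  a query and 31 the number of cells per site.\<close>

definition total_const :: real where
  "total_const = 12 * real construct_unit + 338 * (12 * real find_unit) + 338 * 20 + 10 + 338 + 31"

theorem theorem4p3:
  shows "\<exists>(C::real) > 0. \<exists>construct :: com. \<forall>reach_query :: com. \<exists>geo_query :: com.
    \<forall>(P :: point set) (r :: point \<Rightarrow> real) (ps :: point list)
       (S :: nat \<Rightarrow> real) (Q :: nat \<Rightarrow> real) (\<sigma> :: store).
      finite P \<and> P \<noteq> {} \<and> (\<forall>p\<in>P. 0 < r p) \<and> distinct ps \<and> set ps = P \<longrightarrow>
      (let n = card P; \<Psi> = radius_ratio P r in
        reachability_oracle ps r reach_query (S n) (Q n) \<sigma> \<longrightarrow>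
        (\<exists>t m \<tau>. exec construct (link (sites_store ps r) \<sigma>) t m \<tau> \<and>
           real t \<le> C * (real n * lg (real n) * lg \<Psi>) \<and>
           geometric_reachability_oracle ps r geo_query
             (S n + C * (real n * lg \<Psi>)) (C * (Q n + lg (real n) * lg \<Psi>)) \<tau>))"
proof -
  have main: "\<exists>t m \<tau>. exec (ren even_name construct) (link (sites_store ps r) \<sigma>) t m \<tau> \<and>
      real t \<le> total_const * (real n * lg (real n) * lg \<Psi>) \<and>
      geometric_reachability_oracle ps r (geo_query reach)
        (S + total_const * (real n * lg \<Psi>)) (total_const * (Q + lg (real n) * lg \<Psi>)) \<tau>"
    if asm: "ps \<noteq> []" "\<forall>p\<in>set ps. 0 < r p" "n = length ps" "\<Psi> = radius_ratio (set ps) r"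
      and orc: "reachability_oracle ps r reach S Q \<sigma>"
    for reach :: com and r :: "point \<Rightarrow> real" and ps :: "point list" and S Q :: real and \<sigma> :: store
      and n :: nat and \<Psi> :: real
  proof -
    interpret sites ps r by unfold_locales (use asm in auto)
    have n: "n = sites.n ps" using asm(3) by (simp add: n_def)
    obtain I where \<sigma>: "\<sigma> \<in> I" and all: "\<forall>\<rho>\<in>I. finite_store \<rho> \<and> real (cells \<rho>) \<le> S \<and>
        (\<forall>q\<in>{..<length ps} \<times> {..<length ps}. \<exists>t k \<rho>'. exec reach (load_pair q \<rho>) t k \<rho>' \<and>
          real t \<le> Q \<and> real k \<le> S \<and> ireg \<rho>' 0 =
            (if (case q of (i, j) \<Rightarrow> ps ! i \<rightarrow>\<^sup>*\<^bsub>transmission_graph (set ps) r\<^esub> ps ! j) then 1 else 0) \<and> \<rho>' \<in> I)"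
      using orc unfolding reachability_oracle_def data_structure_def by blast
    have I: "\<sigma> \<in> I" "\<And>\<rho>. \<rho> \<in> I \<Longrightarrow> finite_store \<rho>" "\<And>\<rho>. \<rho> \<in> I \<Longrightarrow> real (cells \<rho>) \<le> S"
      using \<sigma> all by blast+
    have query: "\<exists>t k \<rho>'. exec reach (load_pair (i, j) \<rho>) t k \<rho>' \<and> real t \<le> Q \<and> real k \<le> S \<and>
        ireg \<rho>' 0 = (if ps ! i \<rightarrow>\<^sup>*\<^bsub>transmission_graph (set ps) r\<^esub> ps ! j then 1 else 0) \<and> \<rho>' \<in> I"
      if "\<rho> \<in> I" "i < n" "j < n" for \<rho> i j
    proof -
      have "(i, j) \<in> {..<length ps} \<times> {..<length ps}" using that(2,3) asm(3) by simp
      from bspec[OF conjunct2[OF conjunct2[OF bspec[OF all that(1)]]] this] show ?thesis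
        unfolding prod.case .
    qed
    have npos: "0 < n" using n n_pos by simp
    have lgs: "1 \<le> lg (real n)" "1 \<le> lg \<Psi>" by (simp_all add: lg_def)
    obtain p where p: "2 * n \<le> 2 ^ p" "real p + 3 \<le> 6 * lg (real n)" using power_bound_lg[OF npos] by blast
    define B where "B = Max (lev ` {..<2 * n})"
    have B: "lev v \<le> B" if "v < 2 * sites.n ps" for v using that by (simp add: B_def n)
    have "B \<in> lev ` {..<2 * n}" unfolding B_def using npos by (intro Max_in) (auto simp: lessThan_empty_iff bot_nat_def)
    then have Blg: "real B + 1 \<le> 2 * lg \<Psi>"
      using lev_le_lg lgs(2) unfolding asm(4) n by fastforce
    let ?\<sigma> = "sites_store ps r"
    have inp: "holds_input ?\<sigma>" "\<forall>a>2. rarr ?\<sigma> a = []" "\<forall>a. iarr ?\<sigma> a = []"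
      by (simp_all add: holds_input_def sites_store_def n_def)
    have fin: "finite_store ?\<sigma>"
    proof -
      have "{a. rarr ?\<sigma> a \<noteq> []} \<subseteq> {..2}" using inp(2) by (auto simp: not_less[symmetric])
      then show ?thesis using inp(3) finite_subset by (auto simp: finite_store_def)
    qed
    obtain t k \<tau> where run: "exec construct ?\<sigma> t k \<tau>" "t \<le> construct_unit * (n * ((B + 1) * (p + 3)))"
      and post: "\<exists>g m L. grouped ps r g \<and> grouped.ready ps r g m L \<tau> \<and> m \<le> B"
      using runs_construct[OF inp p(1)[unfolded n] B] unfolding runs_def n by blast
    obtain g m L where g: "grouped ps r g" "grouped.ready ps r g m L \<tau>" "m \<le> B" using post by blast
    interpret G: grouped ps r g by (rule g(1))
    interpret O: reach_oracle ps r g reach I S Q m L p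
      by unfold_locales (use I query p(1) n in auto)
    have BP: "(real B + 1) * (real p + 3) \<le> 12 * (lg (real n) * lg \<Psi>)"
      using mult_mono[OF Blg p(2)] lgs by (simp add: mult_ac)

    have lg0: "1 \<le> lg (real n) * lg \<Psi>" using mult_mono[OF lgs order_trans[OF zero_le_one lgs(1)] zero_le_one] by simp
    have "real t \<le> real construct_unit * (real n * ((real B + 1) * (real p + 3)))"
      using run(2) by (metis (mono_tags, opaque_lifting) of_nat_1 of_nat_add of_nat_le_iff of_nat_mult of_nat_numeral)
    also have "\<dots> \<le> real construct_unit * (real n * (12 * (lg (real n) * lg \<Psi>)))"
      by (intro mult_left_mono BP) simp_all
    also have "\<dots> = 12 * real construct_unit * (real n * lg (real n) * lg \<Psi>)" by simp
    also have "\<dots> \<le> total_const * (real n * lg (real n) * lg \<Psi>)"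
      using lgs by (intro mult_right_mono) (simp_all add: total_const_def)
    finally have time: "real t \<le> total_const * (real n * lg (real n) * lg \<Psi>)" .
    have "31 * real n \<le> 31 * (real n * lg \<Psi>)"
      using lgs(2) mult_left_mono[of 1 "lg \<Psi>" "real n"] by simp
    also have "\<dots> \<le> total_const * (real n * lg \<Psi>)"
      using lgs by (intro mult_right_mono) (simp_all add: total_const_def)
    finally have space: "O.space \<le> S + total_const * (real n * lg \<Psi>)" by (simp add: n)
    have Q0: "0 \<le> Q"
      using query[OF I(1) npos npos] by (metis of_nat_0_le_iff order_trans)
    have "(real m + 1) * (real p + 3) \<le> (real B + 1) * (real p + 3)"
      using g(3) by (intro mult_right_mono) simp_all
    then have "real find_unit * ((real m + 1) * (real p + 3)) \<le> real find_unit * (12 * (lg (real n) * lg \<Psi>))"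
      using BP by (intro mult_left_mono) linarith+
    then have "O.try_time \<le> real find_unit * (12 * (lg (real n) * lg \<Psi>)) + (Q + 20)"
      unfolding O.try_time_def of_nat_mult of_nat_add of_nat_1 of_nat_numeral by linarith
    then have "338 * O.try_time + 10 \<le> 338 * Q + (338 * (12 * real find_unit) + (338 * 20 + 10)) * (lg (real n) * lg \<Psi>)"
      using lg0 unfolding distrib_right mult.assoc by linarith
    also have "\<dots> \<le> total_const * Q + total_const * (lg (real n) * lg \<Psi>)"
      using Q0 lg0 by (intro add_mono mult_right_mono) (simp_all add: total_const_def)
    finally have "338 * O.try_time + 10 \<le> total_const * (Q + lg (real n) * lg \<Psi>)"
      by (simp add: distrib_left)
    from O.geometric_oracle[OF g(2) I(1) space this] exec_even[OF run(1) fin I(2)[OF I(1)]] time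
    show ?thesis by blast
  qed
  show ?thesis
  proof (rule exI[of _ total_const], rule conjI, simp add: total_const_def add_nonneg_pos,
      rule exI[of _ "ren even_name construct"], rule allI)
    fix reach :: com
    show "\<exists>geo_query. \<forall>P r ps S Q \<sigma>.
      finite P \<and> P \<noteq> {} \<and> (\<forall>p\<in>P. 0 < r p) \<and> distinct ps \<and> set ps = P \<longrightarrow>
      (let n = card P; \<Psi> = radius_ratio P r in
        reachability_oracle ps r reach (S n) (Q n) \<sigma> \<longrightarrow>
        (\<exists>t m \<tau>. exec (ren even_name construct) (link (sites_store ps r) \<sigma>) t m \<tau> \<and>
           real t \<le> total_const * (real n * lg (real n) * lg \<Psi>) \<and>
           geometric_reachability_oracle ps r geo_query
             (S n + total_const * (real n * lg \<Psi>)) (total_const * (Q n + lg (real n) * lg \<Psi>)) \<tau>))"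
      unfolding Let_def
    \<comment> \<open>The new query program depends only on the text of the given one. The
      construction program does not even depend on that: it works on the even names and never looks
      at the oracle.\<close>
    proof (intro exI[of _ "geo_query reach"] allI impI)
      fix P :: "point set" and r :: "point \<Rightarrow> real" and ps :: "point list" and S Q :: "nat \<Rightarrow> real" and \<sigma> :: store
      assume a: "finite P \<and> P \<noteq> {} \<and> (\<forall>p\<in>P. 0 < r p) \<and> distinct ps \<and> set ps = P"
        and o: "reachability_oracle ps r reach (S (card P)) (Q (card P)) \<sigma>"
      have "card P = length ps" using a distinct_card by blast
      moreover have "radius_ratio P r = radius_ratio (set ps) r" using a by simp
      moreover have "ps \<noteq> []" "\<forall>p\<in>set ps. 0 < r p" using a by auto
      ultimately show "\<exists>t m \<tau>. exec (ren even_name construct) (link (sites_store ps r) \<sigma>) t m \<tau> \<and>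
         real t \<le> total_const * (real (card P) * lg (real (card P)) * lg (radius_ratio P r)) \<and>
         geometric_reachability_oracle ps r (geo_query reach)
           (S (card P) + total_const * (real (card P) * lg (radius_ratio P r)))
           (total_const * (Q (card P) + lg (real (card P)) * lg (radius_ratio P r))) \<tau>"
        using o by (intro main)
    qed
  qed
qed


end
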